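(* Let $\epsilon\in(0,1)$, $\delta>0$, and let $\sigma\in\,]0,s_4^2]$ be such that $8\zeta_*(\sigma)\le\sqrt n$. Let $\Theta_\delta$ be a finite $\delta$-net of the unit sphere $\mathbb S_d=\{\theta\in\mathbb R^d:\|\theta\|=1\}$ and let $Q$ be a symmetric $d\times d$ matrix, depending on the sample, satisfying (whenever such a matrix exists) $\mathbf{Tr}(Q^2)\le\mathbf{Tr}(G^2)$ and $$B_-(\theta)\le\theta^\top Q\theta\le B_+(\theta),\qquad\theta\in\Theta_\delta .$$ Then, with probability at least $1-2\epsilon$, for any $\theta\in\mathbb S_d$, $$\big|\max\{\theta^\top Q\theta,\sigma\}-\max\{N(\theta),\sigma\}\big|\le2\max\{N(\theta),\sigma\}\,B_*\big(N(\theta)\big)+5\delta\sqrt{\mathbf{Tr}(G^2)},$$ $$\big|\max\{\theta^\top Q\theta,\sigma\}-\max\{N(\theta),\sigma\}\big|\le2\max\{\theta^\top Q\theta,\sigma\}\,B_*\big(\min\{\theta^\top Q\theta,s_4^2\}\big)+5\delta\sqrt{\mathbf{Tr}(G^2)}.$$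
   Context: $X\in\mathbb R^d$ is a random vector of law $\mathrm P$, and $X_1,\dots,X_n$ is an i.i.d. sample from $\mathrm P$; $N(\theta)=\mathbb E[\langle\theta,X\rangle^2]$, $G=\mathbb E[XX^\top]$, $\mathbf{Tr}(G)=\mathbb E[\|X\|^2]$. The quantities $$s_4=\mathbb E[\|X\|^4]^{1/4},\qquad \kappa=\sup_{\theta\in\mathbb R^d,\ \mathbb E[\langle\theta,X\rangle^2]>0}\frac{\mathbb E[\langle\theta,X\rangle^4]}{\mathbb E[\langle\theta,X\rangle^2]^2}$$ are assumed finite, and $\kappa\ge3/2$. Let $\psi:\mathbb R\to\mathbb R$ be the odd function with $\psi(t)=-\log(1-t+t^2/2)$ for $0\le t\le1$ and $\psi(t)=\log 2$ for $t\ge1$. For $\lambda>0$ let $r_\lambda(\theta)=\frac1n\sum_{i=1}^n\psi(\langle\theta,X_i\rangle^2-\lambda)$, $\widehat\alpha_\lambda(\theta)=\sup\{\alpha\in\mathbb R_+: r_\lambda(\alpha\theta)\le0\}\in(0,+\infty]$, and $\widetilde N_\lambda(\theta)=\lambda/\widehat\alpha_\lambda(\theta)^2$ (equal to $0$ if $\widehat\alpha_\lambda(\theta)=+\infty$). Let $c=\frac{15}{8\log(2)(\sqrt2-1)}\exp\big(\frac{1+2\sqrt2}{2}\big)$, $a=1/2$, $K=1+\big\lceil a^{-1}\log\big(\frac{n}{72(2+c)\kappa^{1/2}}\big)\big\rceil$, assumed $\ge1$, and $\Lambda=\{(\lambda_j,\beta_j):0\le j<K\}$ with $$\lambda_j=\sqrt{\frac{2}{n(\kappa-1)}\Big(\frac{2+3c}{4(2+c)\kappa^{1/2}\exp(-ja)}+\log(K/\epsilon)\Big)},\qquad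 \beta_j=\sqrt{2(2+c)\kappa^{1/2}s_4^4\,n\exp[-(j-1/2)a]}.$$ For $(\lambda,\beta)\in\Lambda$ put $\xi=\frac{\kappa\lambda}{2}$, $\mu=\lambda(\kappa-1)+\frac{(2+c)\kappa^{1/2}s_4^2}{\beta}$, $\gamma=\frac\lambda2(\kappa-1)+\frac{(2+c)\kappa^{1/2}s_4^2}{\beta}+\frac{(2+3c)s_4^4}{2\beta^2\lambda}+\frac{\log(|\Lambda|/\epsilon)}{n\lambda}$, $\delta_{\lambda,\beta}=\frac{\beta}{2n\lambda}$, and for $t>0$, with $\tau=\delta_{\lambda,\beta}\lambda/t$, $$\Phi_-(t)=t\Big(1-\frac{\gamma+\tau}{1+\mu-\gamma-\tau}\Big)\ \text{if }\xi-\mu+2\gamma+2\tau<1,\qquad \Phi_-(t)=0\text{ otherwise},$$ $$\Phi_+(t)=t\Big(1+\frac{\gamma+\tau}{1-\mu-\gamma-2\tau}\Big)^{-1}\ \text{if }\xi+\mu+\gamma+2\tau<1,\qquad \Phi_+(t)=0\text{ otherwise},$$ with $\Phi_\pm(0)=0$ (these functions depend on $(\lambda,\beta)$), and $\Phi_+^{-1}(u)=\sup\{t\in\mathbb R_+:\Phi_+(t)\le u\}$. For $\theta\in\mathbb S_d$, $$B_-(\theta)=\max_{(\lambda,\beta)\in\Lambda}\Phi_-\big(\widetilde N_\lambda(\theta)\big),\qquad B_+(\theta)=\min_{(\lambda,\beta)\in\Lambda}\Phi_+^{-1}\big(\widetilde N_\lambda(\theta)\big).$$ A $\delta$-net of $\mathbb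 S_d$ is a set $\Theta_\delta\subset\mathbb S_d$ with $\sup_{\theta\in\mathbb S_d}\min_{\xi\in\Theta_\delta}\|\theta-\xi\|\le\delta$. Further, $$\zeta_*(t)=\sqrt{2.032(\kappa-1)\Big(\frac{0.73\,\mathbf{Tr}(G)}{t}+\log(K)+\log(\epsilon^{-1})\Big)}+\sqrt{\frac{98.5\,\kappa\,\mathbf{Tr}(G)}{t}},$$ $$B_*(t)=\frac{n^{-1/2}\zeta_*(\max\{t,\sigma\})}{1-4n^{-1/2}\zeta_*(\max\{t,\sigma\})}\ \text{ if }\big[6+(\kappa-1)^{-1}\big]\zeta_*(\max\{t,\sigma\})\le\sqrt n,\qquad B_*(t)=+\infty\text{ otherwise.}$$ "With probability at least $p$" means that the event contains a measurable event of probability at least $p$. *)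

theory Defs
  imports "HOL-Probability.Probability"
begin

text \<open>
  Throughout, \<open>P\<close> is the law of the random vector, a Borel probability measure on
  \<open>real ^ 'd\<close>, and a sample of size \<open>n\<close> is a function \<open>x\<close> on \<open>{1..n}\<close>.
\<close>

section \<open>The law\<close>

definition energy :: "(real ^ 'd) measure \<Rightarrow> real ^ 'd \<Rightarrow> real" where
  "energy P \<theta> = (\<integral>x. (\<theta> \<bullet> x)\<^sup>2 \<partial>P)"

definition gram :: "(real ^ 'd) measure \<Rightarrow> real ^ 'd ^ 'd" where
  "gram P = (\<chi> i j. \<integral>x. x $ i * x $ j \<partial>P)"

definition s4 :: "(real ^ 'd) measure \<Rightarrow> real" where
  "s4 P = root 4 (\<integral>x. norm x ^ 4 \<partial>P)"

definition kurtosis_ratios :: "(real ^ 'd) measure \<Rightarrow> real set" where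
  "kurtosis_ratios P =
     (\<lambda>\<theta>. (\<integral>x. (\<theta> \<bullet> x) ^ 4 \<partial>P) / (\<integral>x. (\<theta> \<bullet> x)\<^sup>2 \<partial>P)\<^sup>2) ` {\<theta>. (\<integral>x. (\<theta> \<bullet> x)\<^sup>2 \<partial>P) > 0}"

text \<open>A supremum in the reals: meaningful when \<open>bdd_above (kurtosis_ratios P)\<close>.\<close>

definition kappa :: "(real ^ 'd) measure \<Rightarrow> real" where
  "kappa P = Sup (kurtosis_ratios P)"

section \<open>The truncated energy estimator\<close>

definition psi :: "real \<Rightarrow> real" where
  "psi t = (if t \<ge> 1 then ln 2
            else if t \<ge> 0 then - ln (1 - t + t\<^sup>2 / 2)
            else if t > - 1 then ln (1 + t + t\<^sup>2 / 2)
            else - ln 2)"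

definition r_crit :: "nat \<Rightarrow> (nat \<Rightarrow> real ^ 'd) \<Rightarrow> real \<Rightarrow> real ^ 'd \<Rightarrow> real" where
  "r_crit n x l \<theta> = (1 / real n) * (\<Sum>i=1..n. psi ((\<theta> \<bullet> x i)\<^sup>2 - l))"

definition alpha_hat :: "nat \<Rightarrow> (nat \<Rightarrow> real ^ 'd) \<Rightarrow> real \<Rightarrow> real ^ 'd \<Rightarrow> ereal" where
  "alpha_hat n x l \<theta> = Sup (ereal ` {\<alpha>. \<alpha> \<ge> 0 \<and> r_crit n x l (\<alpha> *\<^sub>R \<theta>) \<le> 0})"

definition N_tilde :: "nat \<Rightarrow> (nat \<Rightarrow> real ^ 'd) \<Rightarrow> real \<Rightarrow> real ^ 'd \<Rightarrow> real" where
  "N_tilde n x l \<theta> =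
     (if alpha_hat n x l \<theta> = \<infinity> then 0 else l / (real_of_ereal (alpha_hat n x l \<theta>))\<^sup>2)"

section \<open>The parameter grid\<close>

definition c_const :: real where
  "c_const = 15 / (8 * ln 2 * (sqrt 2 - 1)) * exp ((1 + 2 * sqrt 2) / 2)"

definition a_const :: real where
  "a_const = 1 / 2"

definition K_grid :: "(real ^ 'd) measure \<Rightarrow> nat \<Rightarrow> int" where
  "K_grid P n = 1 + \<lceil>(1 / a_const) * ln (real n / (72 * (2 + c_const) * sqrt (kappa P)))\<rceil>"

definition lambda_grid :: "(real ^ 'd) measure \<Rightarrow> nat \<Rightarrow> real \<Rightarrow> int \<Rightarrow> real" where
  "lambda_grid P n \<epsilon> j =
     sqrt (2 / (real n * (kappa P - 1)) *
           ((2 + 3 * c_const) / (4 * (2 + c_const) * sqrt (kappa P) * exp (- (of_int j * a_const)))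
            + ln (of_int (K_grid P n) / \<epsilon>)))"

definition beta_grid :: "(real ^ 'd) measure \<Rightarrow> nat \<Rightarrow> int \<Rightarrow> real" where
  "beta_grid P n j =
     sqrt (2 * (2 + c_const) * sqrt (kappa P) * s4 P ^ 4 * real n
           * exp (- ((of_int j - 1 / 2) * a_const)))"

definition Lambda :: "(real ^ 'd) measure \<Rightarrow> nat \<Rightarrow> real \<Rightarrow> (real \<times> real) set" where
  "Lambda P n \<epsilon> = (\<lambda>j. (lambda_grid P n \<epsilon> j, beta_grid P n j)) ` {0..<K_grid P n}"

section \<open>The confidence bounds\<close>

definition xi :: "(real ^ 'd) measure \<Rightarrow> real \<Rightarrow> real" where
  "xi P l = kappa P * l / 2"

definition mu :: "(real ^ 'd) measure \<Rightarrow> real \<Rightarrow> real \<Rightarrow> real" where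
  "mu P l b = l * (kappa P - 1) + (2 + c_const) * sqrt (kappa P) * (s4 P)\<^sup>2 / b"

definition gam :: "(real ^ 'd) measure \<Rightarrow> nat \<Rightarrow> real \<Rightarrow> real \<Rightarrow> real \<Rightarrow> real" where
  "gam P n \<epsilon> l b =
     l / 2 * (kappa P - 1)
     + (2 + c_const) * sqrt (kappa P) * (s4 P)\<^sup>2 / b
     + (2 + 3 * c_const) * s4 P ^ 4 / (2 * b\<^sup>2 * l)
     + ln (real (card (Lambda P n \<epsilon>)) / \<epsilon>) / (real n * l)"

definition delta_param :: "nat \<Rightarrow> real \<Rightarrow> real \<Rightarrow> real" where
  "delta_param n l b = b / (2 * real n * l)"

definition Phi_minus :: "(real ^ 'd) measure \<Rightarrow> nat \<Rightarrow> real \<Rightarrow> real \<Rightarrow> real \<Rightarrow> real \<Rightarrow> real" where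
  "Phi_minus P n \<epsilon> l b t =
     (let \<tau> = delta_param n l b * l / t; \<mu> = mu P l b; \<gamma> = gam P n \<epsilon> l b in
        if t > 0 \<and> xi P l - \<mu> + 2 * \<gamma> + 2 * \<tau> < 1
        then t * (1 - (\<gamma> + \<tau>) / (1 + \<mu> - \<gamma> - \<tau>))
        else 0)"

definition Phi_plus :: "(real ^ 'd) measure \<Rightarrow> nat \<Rightarrow> real \<Rightarrow> real \<Rightarrow> real \<Rightarrow> real \<Rightarrow> real" where
  "Phi_plus P n \<epsilon> l b t =
     (let \<tau> = delta_param n l b * l / t; \<mu> = mu P l b; \<gamma> = gam P n \<epsilon> l b in
        if t > 0 \<and> xi P l + \<mu> + \<gamma> + 2 * \<tau> < 1
        then t * inverse (1 + (\<gamma> + \<tau>) / (1 - \<mu> - \<gamma> - 2 * \<tau>))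
        else 0)"

definition Phi_plus_inv :: "(real ^ 'd) measure \<Rightarrow> nat \<Rightarrow> real \<Rightarrow> real \<Rightarrow> real \<Rightarrow> real \<Rightarrow> ereal" where
  "Phi_plus_inv P n \<epsilon> l b u = Sup (ereal ` {t. t \<ge> 0 \<and> Phi_plus P n \<epsilon> l b t \<le> u})"

definition B_minus :: "(real ^ 'd) measure \<Rightarrow> nat \<Rightarrow> real \<Rightarrow> (nat \<Rightarrow> real ^ 'd) \<Rightarrow> real ^ 'd \<Rightarrow> real" where
  "B_minus P n \<epsilon> x \<theta> =
     Max ((\<lambda>(l, b). Phi_minus P n \<epsilon> l b (N_tilde n x l \<theta>)) ` Lambda P n \<epsilon>)"

definition B_plus :: "(real ^ 'd) measure \<Rightarrow> nat \<Rightarrow> real \<Rightarrow> (nat \<Rightarrow> real ^ 'd) \<Rightarrow> real ^ 'd \<Rightarrow> ereal" where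
  "B_plus P n \<epsilon> x \<theta> =
     Min ((\<lambda>(l, b). Phi_plus_inv P n \<epsilon> l b (N_tilde n x l \<theta>)) ` Lambda P n \<epsilon>)"

section \<open>Nets, the constrained matrices, and the error bound\<close>

text \<open>For finite \<open>\<Theta>\<close> the distance from a point to \<open>\<Theta>\<close> is attained, so this says
  \<open>sup\<^sub>\<theta> min\<^sub>\<xi> norm (\<theta> - \<xi>) \<le> \<delta>\<close>.\<close>

definition sphere_net :: "real \<Rightarrow> (real ^ 'd) set \<Rightarrow> bool" where
  "sphere_net \<delta> \<Theta> \<longleftrightarrow>
     \<Theta> \<subseteq> sphere 0 1 \<and> (\<forall>\<theta>\<in>sphere 0 1. \<exists>\<xi>\<in>\<Theta>. norm (\<theta> - \<xi>) \<le> \<delta>)"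

definition quad :: "real ^ 'd ^ 'd \<Rightarrow> real ^ 'd \<Rightarrow> real" where
  "quad Q \<theta> = \<theta> \<bullet> (Q *v \<theta>)"

definition admissible ::
  "(real ^ 'd) measure \<Rightarrow> nat \<Rightarrow> real \<Rightarrow> (real ^ 'd) set \<Rightarrow> (nat \<Rightarrow> real ^ 'd) \<Rightarrow> real ^ 'd ^ 'd \<Rightarrow> bool"
where
  "admissible P n \<epsilon> \<Theta> x Q \<longleftrightarrow>
     transpose Q = Q \<and>
     trace (Q ** Q) \<le> trace (gram P ** gram P) \<and>
     (\<forall>\<theta>\<in>\<Theta>. B_minus P n \<epsilon> x \<theta> \<le> quad Q \<theta> \<and> ereal (quad Q \<theta>) \<le> B_plus P n \<epsilon> x \<theta>)"

definition zeta_star :: "(real ^ 'd) measure \<Rightarrow> nat \<Rightarrow> real \<Rightarrow> real \<Rightarrow> real" where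
  "zeta_star P n \<epsilon> t =
     sqrt (2.032 * (kappa P - 1) *
           (0.73 * trace (gram P) / t + ln (of_int (K_grid P n)) + ln (inverse \<epsilon>)))
     + sqrt (98.5 * kappa P * trace (gram P) / t)"

definition B_star :: "(real ^ 'd) measure \<Rightarrow> nat \<Rightarrow> real \<Rightarrow> real \<Rightarrow> real \<Rightarrow> ereal" where
  "B_star P n \<epsilon> \<sigma> t =
     (let z = zeta_star P n \<epsilon> (max t \<sigma>) in
        if (6 + inverse (kappa P - 1)) * z \<le> sqrt (real n)
        then ereal ((z / sqrt (real n)) / (1 - 4 * (z / sqrt (real n))))
        else \<infinity>)"

end

theory Submission
  imports Defs
begin

text \<open>
  Perturb \<open>\<theta>\<close> by a Gaussian of covariance \<open>\<beta>\<^sup>-\<^sup>1 I\<close>. As \<open>\<psi>'' \<ge> - 2\<close> and \<open>\<psi>\<close> is bounded,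
  \<open>\<psi>((\<theta> \<bullet> x)\<^sup>2 - \<lambda>)\<close> is at most the Gaussian mean of the logarithm of a positive polynomial in the
  perturbed inner product. The Donsker--Varadhan inequality and a Chernoff bound turn this into a
  bound on the empirical criterion that holds for all \<open>\<theta>\<close> at once and depends on the law only
  through fourth moments, hence not on the dimension. Evaluating it where the criterion vanishes
  gives the confidence interval for \<open>N(\<theta>)\<close>. On that event \<open>G\<close> itself meets the constraints,
  so \<open>Q\<close> does too, and for \<open>\<theta>\<close> in the net both \<open>N(\<theta>)\<close> and \<open>\<theta>\<^sup>T Q \<theta>\<close> lie in the same
  intervals, one of which is short because the grid contains nearly optimal \<open>(\<lambda>, \<beta>)\<close>. Passing from
  the net to the sphere uses that \<open>t \<mapsto> t B\<^sub>*(t)\<close> is nondecreasing with slope at most \<open>1 / 4\<close>.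
\<close>

section \<open>Numerical bounds\<close>

text \<open>The obstacle is that \<psi> is neither convex nor concave, so its Gaussian mean need not
  dominate its value at the centre. Semiconvexity loses at most the variance \<open>V\<close> of the
  perturbed square, boundedness at most 2 ln 2. The loss \<open>min V (2 * ln 2)\<close> is repaid
  by the logarithm of a quadratic, and this is what the term with \<open>c_const\<close> in the
  polynomial buys. The value c of \<open>c_const\<close> enters through 40 \<le> c \<le> 44.29. The
  lower bound lets the logarithm cover the loss; the upper one gives the constants 0.73 and 98.5 and
  makes the grid long enough to reach \<sigma>. The condition on \<open>zeta_star\<close> at
  \<sigma> says that the relative width w, which is \<open>zeta_star\<close> divided by sqrt n, is
  at most 1/8 from \<sigma> on. This keeps w / (1 - 4 w) at most 1/4 and \<open>B_star\<close>
  finite. The factor 2 in the failure probability counts upper and lower deviations.\<close>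

lemma exp_le_taylor:
  fixes x :: real
  assumes "0 \<le> x" "x \<le> 1 / 2"
  shows "exp x \<le> 1 + x + x\<^sup>2 / 2 + x ^ 3 / 6 + x ^ 4 / 24 + x ^ 5 / 120 + x ^ 6 / 360"
proof -
  obtain t where t: "\<bar>t\<bar> \<le> \<bar>x\<bar>" "exp x = (\<Sum>m<6. x ^ m / fact m) + exp t / fact 6 * x ^ 6"
    using Maclaurin_exp_le[of x 6] by blast
  \<comment> \<open>Lagrange remainder: exp \<le> 2 on [0, 1/2] turns the denominator 720 into
    360.\<close>
  have "exp t \<le> exp (1 / 2)" using t(1) assms by simp
  also have "\<dots> \<le> (2 :: real)" using exp_half_le2 .
  finally have "exp t * x ^ 6 \<le> 2 * x ^ 6" by (rule mult_right_mono) simp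
  moreover have "exp x = 1 + x + x\<^sup>2 / 2 + x ^ 3 / 6 + x ^ 4 / 24 + x ^ 5 / 120 + exp t * x ^ 6 / 720"
    using t(2) by (simp add: eval_nat_numeral)
  ultimately show ?thesis by linarith
qed

lemma exp_ge_taylor:
  fixes x :: real
  assumes "0 \<le> x"
  shows "1 + x + x\<^sup>2 / 2 + x ^ 3 / 6 \<le> exp x"
proof -
  obtain t where "exp x = (\<Sum>m<4. x ^ m / fact m) + exp t / fact 4 * x ^ 4"
    using Maclaurin_exp_le[of x 4] by blast
  moreover have "0 \<le> exp t / fact 4 * x ^ 4" by simp
  ultimately show ?thesis by (simp add: eval_nat_numeral)
qed

text \<open>Taking eighth roots brings the argument into the range of the Taylor bound. The
  precision is dictated by \<open>c_const\<close>, which has ln 2 in its denominator and whose upper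
  bound leaves little slack.\<close>

lemma ln2_lower: "0.69314 \<le> ln (2 :: real)"
proof -
  have "exp (0.69314 :: real) = exp 0.0866425 ^ 8"
    by (simp flip: exp_of_nat_mult)
  also have "\<dots> \<le> 1.0905069 ^ 8"
    by (intro power_mono order.trans[OF exp_le_taylor]) (simp_all add: power_divide)
  also have "\<dots> \<le> 2" by (simp add: power_divide)
  finally show ?thesis by (subst ln_ge_iff) simp_all
qed

lemma sqrt2_bounds: "1.4142135 \<le> sqrt 2" "sqrt 2 \<le> 1.4142136"
  by (rule real_le_rsqrt, simp add: power_divide) (rule real_le_lsqrt, simp_all add: power_divide)

text \<open>The bound has to be sharp: (2 + 2.2553) / 2 * (2 + 44.29) is just below 98.5, the
  constant in the second root of \<open>zeta_star\<close>.\<close>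

lemma c_const_upper: "c_const \<le> 44.29"
proof -
  have "exp ((1 + 2 * sqrt 2) / 2) \<le> exp (1.9142136 :: real)" using sqrt2_bounds by simp
  also have "\<dots> = exp 0.2392767 ^ 8" by (simp flip: exp_of_nat_mult)
  also have "\<dots> \<le> 1.2703303 ^ 8"
    by (intro power_mono order.trans[OF exp_le_taylor]) (simp_all add: power_divide)
  also have "\<dots> \<le> 6.78166" by (simp add: power_divide)
  finally have e: "exp ((1 + 2 * sqrt 2) / 2) \<le> 6.78166" .
  have "8 * 0.69314 * (1.4142135 - 1) \<le> 8 * ln 2 * (sqrt 2 - 1)"
    using sqrt2_bounds ln2_lower by (intro mult_mono) auto
  then have "15 / (8 * ln 2 * (sqrt 2 - 1)) \<le> 15 / (8 * 0.69314 * (1.4142135 - 1))"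
    by (intro divide_left_mono) auto
  then have "c_const \<le> 15 / (8 * 0.69314 * (1.4142135 - 1)) * 6.78166"
    unfolding c_const_def using e sqrt2_bounds by (intro mult_mono) auto
  then show ?thesis by simp
qed

text \<open>40 is four times the slope in exp (2 V) \<le> 1 + 10 V, the estimate on which the
  smoothing inequality rests for small \<open>V\<close>.\<close>

lemma c_const_lower: "40 \<le> c_const"
proof -
  have "(1.59 :: real) ^ 4 \<le> exp 0.4785 ^ 4"
    by (intro power_mono order.trans[OF _ exp_ge_taylor]) (simp_all add: power_divide)
  also have "\<dots> = exp (1.914 :: real)" by (simp flip: exp_of_nat_mult)
  also have "\<dots> \<le> exp ((1 + 2 * sqrt 2) / 2)" using sqrt2_bounds by simp
  finally have e: "1.59 ^ 4 \<le> exp ((1 + 2 * sqrt 2) / 2)" .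
  have "8 * ln 2 * (sqrt 2 - 1) \<le> 8 * (25 / 36) * (1.4142136 - 1)"
    using sqrt2_bounds ln2_le_25_over_36 by (intro mult_mono) auto
  moreover have "0 < 8 * ln 2 * (sqrt 2 - 1)" using sqrt2_bounds by simp
  ultimately have "15 / (8 * (25 / 36) * (1.4142136 - 1)) \<le> 15 / (8 * ln 2 * (sqrt 2 - 1))"
    by (intro divide_left_mono) auto
  then have "15 / (8 * (25 / 36) * (1.4142136 - 1)) * 1.59 ^ 4 \<le> c_const"
    unfolding c_const_def using e sqrt2_bounds by (intro mult_mono) auto
  then show ?thesis by (simp add: power_divide)
qed

text \<open>2 + 2.064 is twice the constant 2.032 of \<open>zeta_star\<close>.\<close>

lemma exp_quarter_sum: "exp (1 / 4) + exp (- 1 / 4) \<le> (2.064 :: real)"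
proof -
  have "exp (1 / 4 :: real) \<le> 1.2841"
    by (rule order.trans[OF exp_le_taylor]) (simp_all add: power_divide)
  moreover have "1.2838 \<le> exp (1 / 4 :: real)"
    by (rule order.trans[OF _ exp_ge_taylor]) (simp_all add: power_divide)
  then have "exp (- 1 / 4 :: real) \<le> 1 / 1.2838"
    by (simp add: exp_minus field_simps)
  ultimately show ?thesis by simp
qed

lemma exp_half_sum: "exp (1 / 2) + exp (- 1 / 2) \<le> (2.2553 :: real)"
proof -
  have "exp (1 / 2 :: real) \<le> 1.648742"
    by (rule order.trans[OF exp_le_taylor]) (simp_all add: power_divide)
  moreover have "(1.133138 :: real) ^ 4 \<le> exp (1 / 8) ^ 4"
    by (intro power_mono order.trans[OF _ exp_ge_taylor]) (simp_all add: power_divide)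
  then have "1.133138 ^ 4 \<le> exp (1 / 2 :: real)" by (simp flip: exp_of_nat_mult)
  then have "exp (- 1 / 2 :: real) \<le> 1 / 1.133138 ^ 4"
    by (simp add: exp_minus field_simps power_divide)
  ultimately show ?thesis by (simp add: power_divide)
qed

section \<open>The influence function\<close>

lemma psi_minus: "psi (- t) = - psi t"
  by (auto simp: psi_def)

lemma one_minus_quadratic_pos: "0 < 1 - t + t\<^sup>2 / (2 :: real)"
proof -
  have "1 - t + t\<^sup>2 / 2 = (1 + (1 - t)\<^sup>2) / 2" by (simp add: power2_eq_square algebra_simps)
  also have "\<dots> > 0" by (simp add: add_pos_nonneg)
  finally show ?thesis .
qed

lemma one_plus_quadratic_ge: "1 / 2 \<le> 1 + t + t\<^sup>2 / (2 :: real)"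
proof -
  have "1 + t + t\<^sup>2 / 2 = (1 + (1 + t)\<^sup>2) / 2" by (simp add: power2_eq_square algebra_simps)
  then show ?thesis by simp
qed

text \<open>On [0, 1[ this is (1 + t + t^2/2) (1 - t + t^2/2) = 1 + t^4/4 \<ge> 1; on ]-1, 0[ it is
  an equality; on the plateaus exp \<psi> is 2 or 1/2. The exponential of the truncated quantity is
  thus controlled by two moments.\<close>

lemma exp_psi_le: "exp (psi t) \<le> 1 + t + t\<^sup>2 / 2"
proof -
  consider "t \<ge> 1" | "0 \<le> t" "t < 1" | "- 1 < t" "t < 0" | "t \<le> - 1" by linarith
  then show ?thesis
  proof cases
    case 1
    then have "1 \<le> t + t\<^sup>2 / 2" by (simp add: add_increasing2)
    then show ?thesis using 1 by (simp add: psi_def)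
  next
    case 2
    have "(1 + t + t\<^sup>2 / 2) * (1 - t + t\<^sup>2 / 2) = 1 + (t\<^sup>2)\<^sup>2 / 4"
      by (simp add: power2_eq_square algebra_simps)
    then have "1 \<le> (1 + t + t\<^sup>2 / 2) * (1 - t + t\<^sup>2 / 2)" by simp
    then have "1 / (1 - t + t\<^sup>2 / 2) \<le> 1 + t + t\<^sup>2 / 2"
      using one_minus_quadratic_pos[of t] by (simp add: pos_divide_le_eq)
    then show ?thesis using 2 one_minus_quadratic_pos[of t]
      by (simp add: psi_def exp_minus inverse_eq_divide)
  next
    case 3
    have "0 < 1 + t + t\<^sup>2 / 2" using one_plus_quadratic_ge[of t] by linarith
    then show ?thesis using 3 by (simp add: psi_def)
  next
    case 4
    have "exp (psi t) = 1 / 2" using 4 by (simp add: psi_def exp_minus)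
    then show ?thesis using one_plus_quadratic_ge[of t] by simp
  qed
qed

text \<open>Since \<psi> is odd its derivative is even, so one formula in |t| serves every branch;
  clipping |t| at 1 makes the numerator vanish on the plateaus.\<close>

definition psi' :: "real \<Rightarrow> real" where
  "psi' t = (let u = min \<bar>t\<bar> 1 in (1 - u) / (1 - u + u\<^sup>2 / 2))"

text \<open>The branches of \<open>psi\<close> meet at 0 and 1 with equal values and slopes, so the
  left and right difference quotients can be treated separately.\<close>

lemma has_real_derivative_glue:
  fixes f g h :: "real \<Rightarrow> real"
  assumes "(g has_real_derivative D) (at a)" "(h has_real_derivative D) (at a)"
    and "\<delta> > 0" "\<And>x. a - \<delta> < x \<Longrightarrow> x \<le> a \<Longrightarrow> f x = g x" "\<And>x. a \<le> x \<Longrightarrow> x < a + \<delta> \<Longrightarrow> f x = h x"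
  shows "(f has_real_derivative D) (at a)"
proof -
  have fa: "f a = g a" "f a = h a" using assms(3) by (auto intro: assms(4,5))
  have "((\<lambda>y. (f y - f a) / (y - a)) \<longlongrightarrow> D) (at_left a)"
  proof (rule Lim_transform_eventually)
    show "((\<lambda>y. (g y - g a) / (y - a)) \<longlongrightarrow> D) (at_left a)"
      using assms(1) by (simp add: has_field_derivative_iff filterlim_at_split)
    show "\<forall>\<^sub>F y in at_left a. (g y - g a) / (y - a) = (f y - f a) / (y - a)"
      unfolding eventually_at_left_field using assms(3,4) fa
      by (intro exI[of _ "a - \<delta>"]) auto
  qed
  moreover have "((\<lambda>y. (f y - f a) / (y - a)) \<longlongrightarrow> D) (at_right a)"
  proof (rule Lim_transform_eventually)
    show "((\<lambda>y. (h y - h a) / (y - a)) \<longlongrightarrow> D) (at_right a)"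
      using assms(2) by (simp add: has_field_derivative_iff filterlim_at_split)
    show "\<forall>\<^sub>F y in at_right a. (h y - h a) / (y - a) = (f y - f a) / (y - a)"
      unfolding eventually_at_right_field using assms(3,5) fa
      by (intro exI[of _ "a + \<delta>"]) auto
  qed
  ultimately show ?thesis by (simp add: has_field_derivative_iff filterlim_at_split)
qed

lemma psi_has_derivative: "(psi has_real_derivative psi' t) (at t)"
proof -
  define f where "f = (\<lambda>t :: real. - ln (1 - t + t\<^sup>2 / 2))"
  have f: "(f has_real_derivative (1 - x) / (1 - x + x\<^sup>2 / 2)) (at x)" for x
    unfolding f_def using one_minus_quadratic_pos[of x]
    by (auto intro!: derivative_eq_intros simp: minus_divide_left)
  have fm: "((\<lambda>x. - f (- x)) has_real_derivative (1 + x) / (1 + x + x\<^sup>2 / 2)) (at x)" for x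
    using DERIV_minus[OF DERIV_chain2[OF f DERIV_minus[OF DERIV_ident[of "at x"]]]] by simp
  have f1: "f 1 = ln 2" by (simp add: f_def ln_div)
  have nonneg: "(psi has_real_derivative psi' t) (at t)" if "t \<ge> 0" for t
  proof -
    consider "t > 1" | "t = 1" | "0 < t" "t < 1" | "t = 0" using \<open>t \<ge> 0\<close> by linarith
    then show ?thesis
    proof cases
      case 1
      show ?thesis
        by (rule has_real_derivative_glue[of "\<lambda>_. ln 2" _ _ "\<lambda>_. ln 2" "t - 1"])
          (use 1 in \<open>auto simp: psi_def psi'_def\<close>)
    next
      case 2
      show ?thesis
        by (rule has_real_derivative_glue[of f _ _ "\<lambda>_. ln 2" 1])
          (use 2 f[of 1] f1 in \<open>auto simp: psi_def psi'_def f_def\<close>)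
    next
      case 3
      show ?thesis
        by (rule has_real_derivative_glue[of f _ _ f "min t (1 - t)"])
          (use 3 f[of t] in \<open>auto simp: psi_def psi'_def f_def\<close>)
    next
      case 4
      show ?thesis
        by (rule has_real_derivative_glue[of "\<lambda>x. - f (- x)" _ _ f 1])
          (use 4 f[of 0] fm[of 0] in \<open>auto simp: psi_def psi'_def f_def\<close>)
    qed
  qed
  show ?thesis
  proof (cases "t \<ge> 0")
    case False
    have "((\<lambda>x. psi (- x)) has_real_derivative psi' (- t) * - 1) (at t)"
      using nonneg[of "- t"] False
      by (intro DERIV_chain2[of psi _ "\<lambda>x. - x"]) (auto intro!: derivative_eq_intros)
    then show ?thesis
      by (auto simp: psi_minus psi'_def dest: DERIV_minus)
  qed (rule nonneg)
qed

lemma psi'_nonneg: "0 \<le> psi' t"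
  unfolding psi'_def Let_def using one_minus_quadratic_pos by (intro divide_nonneg_pos) auto

lemma psi_mono: "s \<le> t \<Longrightarrow> psi s \<le> psi t"
  using psi_has_derivative psi'_nonneg by (metis DERIV_nonneg_imp_nondecreasing)

lemma continuous_on_psi [continuous_intros]:
  "continuous_on A f \<Longrightarrow> continuous_on A (\<lambda>x. psi (f x))"
proof -
  have "continuous_on UNIV psi"
    using psi_has_derivative by (meson DERIV_isCont continuous_at_imp_continuous_on)
  then show "continuous_on A f \<Longrightarrow> continuous_on A (\<lambda>x. psi (f x))"
    by (rule continuous_on_compose2) auto
qed

lemma borel_measurable_psi [measurable]: "psi \<in> borel_measurable borel"
  using continuous_on_psi[OF continuous_on_id] by (rule borel_measurable_continuous_onI)

lemma psi_le_ln2: "psi t \<le> ln 2"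
  using psi_mono[of t "max t 1"] by (simp add: psi_def[of "max t 1"])

lemma psi_ge_minus_ln2: "- ln 2 \<le> psi t"
  using psi_le_ln2[of "- t"] by (simp add: psi_minus)

lemma psi_pos: "0 < psi t" if "0 < t"
proof (cases "t \<ge> 1")
  case False
  then have "1 - t + t\<^sup>2 / 2 < 1" using that mult_strict_left_mono[of t 2 t]
    by (simp add: power2_eq_square)
  then show ?thesis using False that one_minus_quadratic_pos[of t] by (simp add: psi_def)
qed (simp add: psi_def)

text \<open>The derivative drops at rate at most 2, because \<open>\<psi>'' \<ge> - 2\<close>; hence \<open>\<psi> t + t\<^sup>2\<close> is convex.\<close>

lemma psi'_one_sided_lipschitz: "psi' s - psi' t \<le> 2 * \<bar>t - s\<bar>"
proof -
  define u v where "u = min \<bar>s\<bar> 1" and "v = min \<bar>t\<bar> 1"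
  have uv: "0 \<le> u" "u \<le> 1" "0 \<le> v" "v \<le> 1" by (auto simp: u_def v_def)
  define q where "q = (\<lambda>x :: real. 1 - x + x\<^sup>2 / 2)"
  have q: "q x > 0" "q x \<ge> 1 / 2" for x
    using one_minus_quadratic_pos[of x] one_plus_quadratic_ge[of "- x"] by (auto simp: q_def)
  have diff: "psi' s - psi' t = (v - u) * (v + u - u * v) / 2 / (q u * q v)"
  proof -
    have "psi' s - psi' t = (1 - u) / q u - (1 - v) / q v"
      by (simp add: psi'_def q_def u_def v_def Let_def)
    also have "\<dots> = ((1 - u) * q v - (1 - v) * q u) / (q u * q v)"
      using q(1)[of u] q(1)[of v] by (simp add: field_simps)
    also have "(1 - u) * q v - (1 - v) * q u = (v - u) * (v + u - u * v) / 2"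
      by (simp add: q_def power2_eq_square field_simps)
    finally show ?thesis .
  qed
  have num: "0 \<le> v + u - u * v" "v + u - u * v \<le> 1"
  proof -
    have "u * v \<le> u" using uv by (simp add: mult_left_le)
    then show "0 \<le> v + u - u * v" using uv by simp
    have "0 \<le> (1 - u) * (1 - v)" using uv by simp
    then show "v + u - u * v \<le> 1" by (simp add: algebra_simps)
  qed
  show ?thesis
  proof (cases "u \<le> v")
    case True
    \<comment> \<open>A numerator of at most (v - u) / 2 over a denominator of at least 1/4 gives
      the constant 2.\<close>
    have "1 / 2 * (1 / 2) \<le> q u * q v" using q(2)[of u] q(2)[of v] by (intro mult_mono) auto
    moreover have "(v - u) * (v + u - u * v) \<le> v - u" using True num by (simp add: mult_left_le)
    ultimately have "(v - u) * (v + u - u * v) / 2 / (q u * q v) \<le> (v - u) / 2 / (1 / 4)"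
      using True by (intro frac_le) auto
    also have "\<dots> = 2 * (v - u)" by simp
    finally have "psi' s - psi' t \<le> 2 * (v - u)" unfolding diff .
    moreover have "v - u \<le> \<bar>t - s\<bar>" by (auto simp: u_def v_def)
    then have "2 * (v - u) \<le> 2 * \<bar>t - s\<bar>" by simp
    ultimately show ?thesis by (rule order.trans)
  next
    case False
    then have "(v - u) * (v + u - u * v) / 2 / (q u * q v) \<le> 0"
      using num q(1)[of u] q(1)[of v]
      by (intro divide_nonpos_pos) (auto simp: mult_nonpos_nonneg)
    moreover have "0 \<le> 2 * \<bar>t - s\<bar>" by simp
    ultimately show ?thesis unfolding diff by linarith
  qed
qed

text \<open>Subtracting the tangent at \<open>z0\<close> from \<psi> + (x - z0)^2 leaves a function
  that decreases before \<open>z0\<close> and increases after it. Integrated against a law of mean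
  \<open>z0\<close>, the inequality bounds the Jensen defect of \<psi> by the variance.\<close>

lemma psi_semiconvex: "psi z \<ge> psi z0 + psi' z0 * (z - z0) - (z - z0)\<^sup>2"
proof -
  define g where "g = (\<lambda>x. psi x + (x - z0)\<^sup>2 - psi' z0 * (x - z0))"
  have g: "(g has_real_derivative psi' x + 2 * (x - z0) - psi' z0) (at x)" for x
    unfolding g_def by (auto intro!: derivative_eq_intros psi_has_derivative)
  have "g z0 \<le> g z"
  proof (cases "z0 \<le> z")
    case True
    show ?thesis
    proof (rule DERIV_nonneg_imp_nondecreasing[OF True])
      fix x assume "z0 \<le> x" "x \<le> z"
      then show "\<exists>y. (g has_real_derivative y) (at x) \<and> 0 \<le> y"
        using g[of x] psi'_one_sided_lipschitz[of z0 x] by (intro exI conjI) auto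
    qed
  next
    case False
    then have "z \<le> z0" by simp
    then show ?thesis
    proof (rule DERIV_nonpos_imp_nonincreasing)
      fix x assume "z \<le> x" "x \<le> z0"
      then show "\<exists>y. (g has_real_derivative y) (at x) \<and> y \<le> 0"
        using g[of x] psi'_one_sided_lipschitz[of x z0] by (intro exI conjI) auto
    qed
  qed
  then show ?thesis by (simp add: g_def)
qed

section \<open>Gaussian measures\<close>

abbreviation std_normal :: "real measure" where
  "std_normal \<equiv> density lborel std_normal_density"

lemma prob_space_std_normal: "prob_space std_normal"
  by (rule prob_space_normal_density) simp

lemma integrable_std_normal_power: "integrable std_normal (\<lambda>x. x ^ k)"
  by (subst integrable_density) (auto intro: integrable_std_normal_moment)

lemma std_normal_moments:
  "(\<integral>x. x \<partial>std_normal) = 0" "(\<integral>x. x\<^sup>2 \<partial>std_normal) = 1"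
  "(\<integral>x. x ^ 3 \<partial>std_normal) = 0" "(\<integral>x. x ^ 4 \<partial>std_normal) = 3"
  using integral_std_normal_moment_odd[of 0] integral_std_normal_moment_even[of 1]
    integral_std_normal_moment_odd[of 1] integral_std_normal_moment_even[of 2]
  by (simp_all add: integral_density fact_numeral numeral_3_eq_3[symmetric])

lemma distr_std_normal_uminus: "distr std_normal borel uminus = std_normal"
proof (rule measure_eqI)
  fix A :: "real set" assume "A \<in> sets (distr std_normal borel uminus)"
  then have A[measurable]: "A \<in> sets borel" by simp
  have [measurable]: "uminus -` A \<in> sets borel"
    using measurable_sets[OF _ A, of "uminus" borel] by simp
  have "emeasure (distr std_normal borel uminus) A = (\<integral>\<^sup>+x. ennreal (std_normal_density x) * indicator A (- x) \<partial>lborel)"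
    by (subst emeasure_distr) (auto simp: emeasure_density intro!: nn_integral_cong split: split_indicator)
  also have "\<dots> = (\<integral>\<^sup>+x. ennreal (std_normal_density x) * indicator A x \<partial>lborel)"
    by (subst nn_integral_real_affine[where c = "- 1" and t = 0])
      (auto simp: normal_density_def)
  finally show "emeasure (distr std_normal borel uminus) A = emeasure std_normal A"
    by (simp add: emeasure_density)
qed simp

text \<open>Cameron-Martin formula on the line, by completing the square in the density.\<close>

lemma distr_std_normal_shift:
  "distr std_normal borel ((+) a) = density std_normal (\<lambda>x. ennreal (exp (a * x - a\<^sup>2 / 2)))"
proof (rule measure_eqI)
  fix A :: "real set" assume "A \<in> sets (distr std_normal borel ((+) a))"
  then have A[measurable]: "A \<in> sets borel" by simp
  have [measurable]: "(+) a -` A \<in> sets borel"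
    using measurable_sets[OF _ A, of "(+) a" borel] by simp
  have dens: "std_normal_density (x - a) = std_normal_density x * exp (a * x - a\<^sup>2 / 2)" for x
    by (simp add: normal_density_def power2_eq_square algebra_simps diff_divide_distrib
        add_divide_distrib flip: exp_add)
  have "emeasure (distr std_normal borel ((+) a)) A = (\<integral>\<^sup>+x. ennreal (std_normal_density x) * indicator A (a + x) \<partial>lborel)"
    by (subst emeasure_distr) (auto simp: emeasure_density intro!: nn_integral_cong split: split_indicator)
  also have "\<dots> = (\<integral>\<^sup>+x. ennreal (std_normal_density (x - a)) * indicator A x \<partial>lborel)"
    by (subst nn_integral_real_affine[where c = 1 and t = "- a"])
      (auto simp: algebra_simps)
  finally show "emeasure (distr std_normal borel ((+) a)) A
      = emeasure (density std_normal (\<lambda>x. ennreal (exp (a * x - a\<^sup>2 / 2)))) A"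
    by (simp add: emeasure_density nn_integral_density dens ennreal_mult mult.assoc)
qed simp

section \<open>Standard Gaussian vectors\<close>

definition gauss_coords :: "('d :: finite \<Rightarrow> real) measure" where
  "gauss_coords = (\<Pi>\<^sub>M i\<in>UNIV. std_normal)"

text \<open>The product measure lives on functions from the index type; its image carries it over to
  the vector type of the sample.\<close>

definition std_gaussian :: "(real ^ 'd) measure" where
  "std_gaussian = distr gauss_coords borel (\<lambda>f. \<chi> i. f i)"

lemma prob_space_gauss_coords: "prob_space gauss_coords"
  unfolding gauss_coords_def by (intro prob_space_PiM prob_space_std_normal)

lemma sets_gauss_coords [measurable_cong]: "sets gauss_coords = sets (\<Pi>\<^sub>M i\<in>UNIV. borel)"
  unfolding gauss_coords_def by (rule sets_PiM_cong) auto

lemma space_gauss_coords [simp]: "space gauss_coords = UNIV"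
  by (simp add: gauss_coords_def space_PiM PiE_UNIV_domain)

lemma measurable_vec_lambda_coords [measurable]:
  "(\<lambda>f. \<chi> i. f i) \<in> measurable (\<Pi>\<^sub>M i\<in>UNIV. borel) (borel :: (real ^ 'd) measure)"
  by (rule borel_measurable_euclidean_space[THEN iffD2]) (auto simp: Basis_vec_def inner_axis)

lemma prob_space_std_gaussian: "prob_space std_gaussian"
  unfolding std_gaussian_def
  by (rule prob_space.prob_space_distr[OF prob_space_gauss_coords]) measurable

lemma sets_std_gaussian [measurable_cong, simp]: "sets std_gaussian = sets borel"
  by (simp add: std_gaussian_def)

lemma space_std_gaussian [simp]: "space std_gaussian = UNIV"
  by (simp add: std_gaussian_def)

text \<open>A linear combination of independent standard normals is normal with variance |v|^2. The
  Gaussian mean of a function of one inner product thereby becomes a one-dimensional integral,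
  whatever the dimension.\<close>

lemma distr_std_gaussian_inner:
  "distr std_gaussian borel (\<lambda>y. y \<bullet> (v :: real ^ 'd)) = distr std_normal borel (\<lambda>g. norm v * g)"
proof (cases "v = 0")
  case True
  show ?thesis using True
    by (intro measure_eqI)
      (auto simp: emeasure_distr prob_space.emeasure_space_1[OF prob_space_std_normal, simplified]
        prob_space.emeasure_space_1[OF prob_space_std_gaussian, simplified] split: split_indicator)
next
  case False
  interpret N: prob_space std_normal by (rule prob_space_std_normal)
  interpret gauss_coords: prob_space "gauss_coords :: ('d \<Rightarrow> real) measure"
    by (rule prob_space_gauss_coords)
  \<comment> \<open>A zero coordinate would contribute a degenerate normal, so the sum runs over the
    support of \<open>v\<close> only.\<close>
  define I where "I = {i. v $ i \<noteq> 0}"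
  have I: "finite I" "I \<noteq> {}" using False by (auto simp: I_def vec_eq_iff)
  have coord: "distr gauss_coords borel (\<lambda>f. f i) = std_normal" for i :: 'd
    unfolding gauss_coords_def using distr_PiM_component[OF prob_space_std_normal, of i UNIV]
    by (simp cong: distr_cong)
  have indep0: "gauss_coords.indep_vars (\<lambda>_. borel) (\<lambda>i f. f i) (UNIV :: 'd set)"
  proof (subst gauss_coords.indep_vars_iff_distr_eq_PiM)
    have "distr gauss_coords (\<Pi>\<^sub>M i\<in>UNIV. borel) (\<lambda>f. f) = (gauss_coords :: ('d \<Rightarrow> real) measure)"
      by (rule distr_id2) (simp add: sets_gauss_coords)
    then show "distr gauss_coords (\<Pi>\<^sub>M i\<in>UNIV. borel) (\<lambda>f. \<lambda>i\<in>UNIV. f i)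
        = (\<Pi>\<^sub>M i\<in>UNIV. distr gauss_coords borel (\<lambda>f. f (i :: 'd)))"
      by (simp add: coord gauss_coords_def[symmetric] restrict_def)
  qed auto
  have dist0: "distributed gauss_coords lborel (\<lambda>f. f i) std_normal_density" for i :: 'd
  proof -
    have "distr gauss_coords lborel (\<lambda>f. f i) = distr gauss_coords borel (\<lambda>f. f i)"
      by (intro distr_cong) auto
    then show ?thesis by (simp add: distributed_def coord)
  qed
  have "gauss_coords.indep_vars (\<lambda>_. borel) (\<lambda>i f. v $ i * f i) I"
    using gauss_coords.indep_vars_compose2[OF gauss_coords.indep_vars_subset[OF indep0, of I],
        of "\<lambda>i x. v $ i * x" "\<lambda>_. borel"] by simp
  moreover have "distributed gauss_coords lborel (\<lambda>f. v $ i * f i) (normal_density 0 \<bar>v $ i\<bar>)"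
    if "i \<in> I" for i
    using gauss_coords.normal_density_affine[OF dist0[of i], of "v $ i" 0] that
    by (simp add: I_def)
  ultimately have "distributed gauss_coords lborel (\<lambda>f. \<Sum>i\<in>I. v $ i * f i)
      (normal_density (\<Sum>i\<in>I. 0) (sqrt (\<Sum>i\<in>I. \<bar>v $ i\<bar>\<^sup>2)))"
    using I by (intro gauss_coords.sum_indep_normal) (auto simp: I_def)
  also have "(\<lambda>f. \<Sum>i\<in>I. v $ i * f i) = (\<lambda>f. (\<chi> i. f i) \<bullet> v)"
    unfolding inner_vec_def
    by (intro ext sum.mono_neutral_cong_left) (auto simp: I_def)
  also have "sqrt (\<Sum>i\<in>I. \<bar>v $ i\<bar>\<^sup>2) = norm v"
    unfolding norm_vec_def L2_set_def
    by (intro arg_cong[of _ _ sqrt] sum.mono_neutral_cong_left) (auto simp: I_def)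
  finally have D: "distributed gauss_coords lborel (\<lambda>f. (\<chi> i. f i) \<bullet> v) (normal_density 0 (norm v))"
    by simp
  have id: "distributed std_normal lborel (\<lambda>g. g) std_normal_density"
    by (simp add: distributed_def distr_id2 cong: distr_cong)
  have D': "distributed std_normal lborel (\<lambda>g. norm v * g) (normal_density 0 (norm v))"
    using N.normal_density_affine[OF id, of "norm v" 0] False by simp
  have "distr std_gaussian borel (\<lambda>y. y \<bullet> v) = distr gauss_coords lborel (\<lambda>f. (\<chi> i. f i) \<bullet> v)"
    unfolding std_gaussian_def by (subst distr_distr) (auto simp: comp_def intro!: distr_cong)
  also have "\<dots> = distr std_normal lborel (\<lambda>g. norm v * g)"
    using D D' by (simp add: distributed_def)
  also have "\<dots> = distr std_normal borel (\<lambda>g. norm v * g)"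
    by (intro distr_cong) auto
  finally show ?thesis .
qed

text \<open>Cameron-Martin formula in the whole space. The translated product measure and the
  product measure with exponential density agree on rectangles, coordinate by coordinate, and the
  exponents add up to <y, a> - |a|^2/2.\<close>

lemma nn_integral_std_gaussian_shift:
  fixes f :: "real ^ 'd \<Rightarrow> ennreal"
  assumes [measurable]: "f \<in> borel_measurable borel"
  shows "(\<integral>\<^sup>+y. f (a + y) \<partial>std_gaussian)
    = (\<integral>\<^sup>+y. f y * ennreal (exp (y \<bullet> a - (norm a)\<^sup>2 / 2)) \<partial>std_gaussian)"
proof -
  interpret std_normal_product: product_prob_space "\<lambda>_. std_normal" UNIV
    by (intro product_prob_spaceI prob_space_std_normal)
  define e where "e = (\<lambda>i x. ennreal (exp (a $ i * x - (a $ i)\<^sup>2 / 2)))"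
  have e[measurable]: "e i \<in> borel_measurable borel" for i by (simp add: e_def)
  define N where "N = (\<lambda>i. density std_normal (e i))"
  have N: "N i = distr std_normal borel ((+) (a $ i))" for i
    unfolding N_def e_def by (rule distr_std_normal_shift[symmetric])
  interpret N: product_prob_space N UNIV
    unfolding N by (intro product_prob_spaceI prob_space.prob_space_distr prob_space_std_normal) auto
  have "distr gauss_coords (\<Pi>\<^sub>M i\<in>UNIV. borel) (\<lambda>f i. a $ i + f i) = (\<Pi>\<^sub>M i\<in>UNIV. N i)"
  proof (rule N.PiM_eqI)
    fix A assume "\<And>i. i \<in> UNIV \<Longrightarrow> A i \<in> sets (N i)"
    then have A[measurable]: "A i \<in> sets borel" for i by (simp add: N)
    have [measurable]: "(+) (a $ i) -` A i \<in> sets borel" for i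
      using measurable_sets[OF _ A, of "(+) (a $ i)" borel] by simp
    have "emeasure (distr gauss_coords (\<Pi>\<^sub>M i\<in>UNIV. borel) (\<lambda>f i. a $ i + f i)) (Pi\<^sub>E UNIV A)
        = emeasure gauss_coords (Pi\<^sub>E UNIV (\<lambda>i. (+) (a $ i) -` A i))"
      by (subst emeasure_distr)
        (auto intro!: measurable_PiM_single' sets_PiM_I_finite arg_cong2[of _ _ _ _ emeasure] simp: space_PiM)
    also have "\<dots> = (\<Prod>i\<in>UNIV. emeasure std_normal ((+) (a $ i) -` A i))"
      unfolding gauss_coords_def by (rule std_normal_product.emeasure_PiM) auto
    also have "\<dots> = (\<Prod>i\<in>UNIV. emeasure (N i) (A i))"
      by (simp add: N emeasure_distr)
    finally show "emeasure (distr gauss_coords (\<Pi>\<^sub>M i\<in>UNIV. borel) (\<lambda>f i. a $ i + f i)) (Pi\<^sub>E UNIV A)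
        = (\<Prod>i\<in>UNIV. emeasure (N i) (A i))" .
  qed (auto simp: N intro!: sets_PiM_cong)
  moreover have "density gauss_coords (\<lambda>f. \<Prod>i\<in>UNIV. e i (f i)) = (\<Pi>\<^sub>M i\<in>UNIV. N i)"
  proof (rule N.PiM_eqI)
    fix A assume "\<And>i. i \<in> UNIV \<Longrightarrow> A i \<in> sets (N i)"
    then have A[measurable]: "A i \<in> sets borel" for i by (simp add: N)
    have "emeasure (density gauss_coords (\<lambda>f. \<Prod>i\<in>UNIV. e i (f i))) (Pi\<^sub>E UNIV A)
        = (\<integral>\<^sup>+f. (\<Prod>i\<in>UNIV. e i (f i)) * indicator (Pi\<^sub>E UNIV A) f \<partial>gauss_coords)"
      by (rule emeasure_density) (auto intro!: sets_PiM_I_finite simp: sets_gauss_coords)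
    also have "\<dots> = (\<integral>\<^sup>+f. (\<Prod>i\<in>UNIV. e i (f i) * indicator (A i) (f i)) \<partial>gauss_coords)"
      by (intro nn_integral_cong) (auto simp: prod.distrib indicator_def PiE_iff)
    also have "\<dots> = (\<Prod>i\<in>UNIV. \<integral>\<^sup>+x. e i x * indicator (A i) x \<partial>std_normal)"
      unfolding gauss_coords_def by (rule std_normal_product.product_nn_integral_prod) auto
    also have "\<dots> = (\<Prod>i\<in>UNIV. emeasure (N i) (A i))"
      unfolding N_def by (intro prod.cong refl emeasure_density[symmetric]) auto
    finally show "emeasure (density gauss_coords (\<lambda>f. \<Prod>i\<in>UNIV. e i (f i))) (Pi\<^sub>E UNIV A)
        = (\<Prod>i\<in>UNIV. emeasure (N i) (A i))" .
  qed (auto simp: N sets_gauss_coords intro!: sets_PiM_cong)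
  ultimately have eq: "distr gauss_coords (\<Pi>\<^sub>M i\<in>UNIV. borel) (\<lambda>f i. a $ i + f i)
      = density gauss_coords (\<lambda>f. \<Prod>i\<in>UNIV. e i (f i))" by simp
  have e_prod: "(\<Prod>i\<in>UNIV. e i (g i)) = ennreal (exp ((\<chi> i. g i) \<bullet> a - (norm a)\<^sup>2 / 2))" for g
  proof -
    have "(norm a)\<^sup>2 = (\<Sum>i\<in>UNIV. (a $ i)\<^sup>2)"
      by (simp add: norm_vec_def L2_set_def sum_nonneg)
    then have "(\<chi> i. g i) \<bullet> a - (norm a)\<^sup>2 / 2 = (\<Sum>i\<in>UNIV. a $ i * g i - (a $ i)\<^sup>2 / 2)"
      by (simp add: inner_vec_def sum_subtractf sum_divide_distrib mult.commute)
    then show ?thesis by (simp add: e_def prod_ennreal exp_sum)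
  qed
  have "(\<integral>\<^sup>+y. f (a + y) \<partial>std_gaussian) = (\<integral>\<^sup>+g. f (a + (\<chi> i. g i)) \<partial>gauss_coords)"
    unfolding std_gaussian_def by (subst nn_integral_distr) auto
  also have "\<dots> = (\<integral>\<^sup>+g. f (\<chi> i. g i) \<partial>distr gauss_coords (\<Pi>\<^sub>M i\<in>UNIV. borel) (\<lambda>f i. a $ i + f i))"
    by (subst nn_integral_distr)
      (auto intro!: measurable_PiM_single' nn_integral_cong arg_cong[of _ _ f] simp: space_PiM vec_eq_iff)
  also have "\<dots> = (\<integral>\<^sup>+g. (\<Prod>i\<in>UNIV. e i (g i)) * f (\<chi> i. g i) \<partial>gauss_coords)"
    unfolding eq by (subst nn_integral_density) auto
  also have "\<dots> = (\<integral>\<^sup>+y. f y * ennreal (exp (y \<bullet> a - (norm a)\<^sup>2 / 2)) \<partial>std_gaussian)"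
    unfolding std_gaussian_def e_prod by (subst nn_integral_distr) (auto simp: mult.commute)
  finally show ?thesis .
qed

section \<open>The one-dimensional smoothing inequality\<close>

lemma has_bochner_integral_std_normal_quartic:
  "has_bochner_integral std_normal (\<lambda>x. a0 + a1 * x + a2 * x\<^sup>2 + a3 * x ^ 3 + a4 * x ^ 4) (a0 + a2 + 3 * a4)"
proof -
  interpret prob_space std_normal by (rule prob_space_std_normal)
  have "has_bochner_integral std_normal (\<lambda>x. a0 + a1 * x + a2 * x\<^sup>2 + a3 * x ^ 3 + a4 * x ^ 4)
      (a0 + a1 * 0 + a2 * 1 + a3 * 0 + a4 * 3)"
    using integrable_std_normal_power[of 1] integrable_std_normal_power std_normal_moments prob_space
    by (intro has_bochner_integral_add has_bochner_integral_mult_right)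
      (auto simp: has_bochner_integral_iff)
  then show ?thesis by (simp add: mult.commute)
qed

text \<open>Averaging over \<open>g\<close> and \<open>- g\<close> replaces any quantitative anti-concentration of the Gaussian.\<close>

lemma symmetrized_product_bound:
  fixes a b m k V c s :: real
  assumes c: "c \<ge> 40" and a: "a = c * s\<^sup>2 / 2" and b: "b = c * s ^ 4 / 4"
    and V: "V = 4 * m\<^sup>2 * s\<^sup>2 + 2 * s ^ 4"
  shows "exp (2 * min V (2 * ln 2)) \<le> (1 + b + a * (m + k)\<^sup>2) * (1 + b + a * (m - k)\<^sup>2)"
proof -
  define v where "v = a * m\<^sup>2 + b"
  have v: "v = c * V / 8" by (simp add: v_def a b V field_simps)
  have nn: "0 \<le> a" "0 \<le> b" "0 \<le> V" using c by (auto simp: a b V)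
  have expand: "(1 + b + a * (m + k)\<^sup>2) * (1 + b + a * (m - k)\<^sup>2)
      = (1 + b)\<^sup>2 + 2 * (1 + b) * (a * m\<^sup>2 + a * k\<^sup>2) + (a * (m\<^sup>2 - k\<^sup>2))\<^sup>2"
    by (simp add: power2_eq_square algebra_simps)
  have ge: "1 + 2 * b + b\<^sup>2 + 2 * (a * m\<^sup>2 + a * k\<^sup>2) + (a * (m\<^sup>2 - k\<^sup>2))\<^sup>2
      \<le> (1 + b + a * (m + k)\<^sup>2) * (1 + b + a * (m - k)\<^sup>2)"
  proof -
    have "0 \<le> 2 * b * (a * m\<^sup>2 + a * k\<^sup>2)" using nn by simp
    then show ?thesis unfolding expand by (simp add: power2_eq_square algebra_simps)
  qed
  show ?thesis
  proof (cases "V \<le> 1")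
    case True
    \<comment> \<open>Chord of exp between 0 and 2; with e \<le> 3 it gives 1 + 8 V, relaxed to 1 +
      10 V.\<close>
    have "exp ((1 - V) *\<^sub>R 0 + V *\<^sub>R 2) \<le> (1 - V) * exp 0 + V * exp (2 :: real)"
      using True nn by (intro convex_onD[OF exp_convex]) auto
    moreover have "exp (2 :: real) \<le> 9"
      using power_mono[OF exp_le, of 2] by (simp flip: exp_of_nat_mult)
    then have "V * exp 2 \<le> V * 9" using nn by (intro mult_left_mono) auto
    ultimately have "exp (2 * V) \<le> 1 + 10 * V" using nn by (simp add: mult.commute)
    also have "10 * V \<le> c * V / 4" using mult_right_mono[OF c, of V] nn by simp
    also have "1 + c * V / 4 = 1 + 2 * v" by (simp add: v)
    also have "\<dots> \<le> (1 + b + a * (m + k)\<^sup>2) * (1 + b + a * (m - k)\<^sup>2)"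
      using ge nn by (intro order.trans[OF _ ge]) (simp add: v_def)
    finally have "exp (2 * V) \<le> (1 + b + a * (m + k)\<^sup>2) * (1 + b + a * (m - k)\<^sup>2)" by simp
    moreover have "exp (2 * min V (2 * ln 2)) \<le> exp (2 * V)" by simp
    ultimately show ?thesis by linarith
  next
    case False
    \<comment> \<open>For V > 1 the left side is capped at 2^4 = 16, while c \<ge> 40 makes c V / 2
      - 1 at least 19.\<close>
    have "exp (2 * min V (2 * ln 2)) \<le> exp (of_nat 4 * ln (2 :: real))" by simp
    also have "\<dots> = 16" by (subst exp_of_nat_mult) simp
    also have "\<dots> \<le> c * V / 2 - 1"
      using mult_mono[OF c, of 1 V] c False by simp
    also have "\<dots> = 4 * v - 1" by (simp add: v)
    also have "\<dots> \<le> 1 + 2 * b + b\<^sup>2 + 2 * (a * m\<^sup>2 + a * k\<^sup>2) + (a * (m\<^sup>2 - k\<^sup>2))\<^sup>2"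
    proof -
      \<comment> \<open>The difference of the two sides to be compared is the sum of these two
        squares.\<close>
      have "0 \<le> (a * (m\<^sup>2 - k\<^sup>2) - 1)\<^sup>2" "0 \<le> (b - 1)\<^sup>2" by simp_all
      then show ?thesis by (simp add: v_def power2_eq_square algebra_simps)
    qed
    also note ge
    finally show ?thesis .
  qed
qed

text \<open>\<open>V\<close> is the variance of (m + s g)^2 and 2 ln 2 is the oscillation of \<psi>.
  Their minimum bounds the Jensen defect of \<psi>, and this logarithm is built to compensate
  it.\<close>

lemma expectation_ln_quadratic:
  fixes a b m V c s :: real
  assumes c: "c \<ge> 40" and a: "a = c * s\<^sup>2 / 2" and b: "b = c * s ^ 4 / 4"
    and V: "V = 4 * m\<^sup>2 * s\<^sup>2 + 2 * s ^ 4"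
  shows "integrable std_normal (\<lambda>g. ln (1 + b + a * (m + s * g)\<^sup>2))"
    and "min V (2 * ln 2) \<le> (\<integral>g. ln (1 + b + a * (m + s * g)\<^sup>2) \<partial>std_normal)"
proof -
  interpret prob_space std_normal by (rule prob_space_std_normal)
  let ?f = "\<lambda>g. ln (1 + b + a * (m + s * g)\<^sup>2)"
  have nn: "0 \<le> a" "0 \<le> b" using c by (auto simp: a b)
  then have arg: "1 \<le> 1 + b + a * (m + s * g)\<^sup>2" for g by simp
  have "integrable std_normal (\<lambda>g. (b + a * m\<^sup>2) + (2 * a * m * s) * g + (a * s\<^sup>2) * g\<^sup>2 + 0 * g ^ 3 + 0 * g ^ 4)"
    by (rule integrable.intros, rule has_bochner_integral_std_normal_quartic)
  then have int0: "integrable std_normal (\<lambda>g. b + a * (m + s * g)\<^sup>2)"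
    by (simp add: power2_eq_square algebra_simps)
  show int: "integrable std_normal ?f"
  proof (rule Bochner_Integration.integrable_bound[OF int0])
    show "AE g in std_normal. norm (?f g) \<le> norm (b + a * (m + s * g)\<^sup>2)"
    proof (rule AE_I2)
      fix g
      have "ln (1 + (b + a * (m + s * g)\<^sup>2)) \<le> b + a * (m + s * g)\<^sup>2"
        using nn by (intro ln_add_one_self_le_self) simp
      then show "norm (?f g) \<le> norm (b + a * (m + s * g)\<^sup>2)" using arg[of g] nn by (simp add: add.assoc)
    qed
  qed measurable
  have int': "integrable std_normal (\<lambda>g. ?f (- g))" and eq: "(\<integral>g. ?f (- g) \<partial>std_normal) = (\<integral>g. ?f g \<partial>std_normal)"
    using integrable_distr_eq[of uminus std_normal borel ?f] integral_distr[of uminus std_normal borel ?f] int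
    by (simp_all add: distr_std_normal_uminus)
  have "2 * min V (2 * ln 2) = (\<integral>g. 2 * min V (2 * ln 2) \<partial>std_normal)" using prob_space by simp
  also have "\<dots> \<le> (\<integral>g. ?f g + ?f (- g) \<partial>std_normal)"
  proof (rule integral_mono)
    fix g
    have "2 * min V (2 * ln 2) = ln (exp (2 * min V (2 * ln 2)))" by simp
    also have "\<dots> \<le> ln ((1 + b + a * (m + s * g)\<^sup>2) * (1 + b + a * (m - s * g)\<^sup>2))"
      using symmetrized_product_bound[OF assms, of "s * g"] by (intro ln_mono) auto
    also have "\<dots> = ?f g + ?f (- g)"
      using arg[of g] arg[of "- g"] by (subst ln_mult) auto
    finally show "2 * min V (2 * ln 2) \<le> ?f g + ?f (- g)" .
  qed (use int int' in auto)
  also have "\<dots> = 2 * (\<integral>g. ?f g \<partial>std_normal)" using int int' eq by simp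
  finally show "min V (2 * ln 2) \<le> (\<integral>g. ?f g \<partial>std_normal)" by simp
qed

text \<open>Here \<open>v\<close> stands for \<open>\<parallel>x\<parallel>\<^sup>2 / \<beta>\<close> and \<open>y\<close> for the perturbed inner product, so that \<open>y\<^sup>2 - v - l\<close> has
  Gaussian mean \<open>(\<theta> \<bullet> x)\<^sup>2 - l\<close>. The last summand pays for the variance lost through
  \<open>\<psi>'' \<ge> - 2\<close>; the sign \<open>\<eta>\<close> selects the upper or the lower deviation.\<close>

definition pac_poly :: "real \<Rightarrow> real \<Rightarrow> real \<Rightarrow> real \<Rightarrow> real" where
  "pac_poly \<eta> l v y = 1 + \<eta> * (y\<^sup>2 - v - l) + (y\<^sup>2 - v - l)\<^sup>2 / 2 + c_const * v * (y\<^sup>2 + v / 2)"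

lemma pac_poly_ge_half:
  assumes "\<eta>\<^sup>2 = 1" "0 \<le> v"
  shows "1 / 2 \<le> pac_poly \<eta> l v y"
proof -
  have "1 / 2 \<le> 1 + \<eta> * (y\<^sup>2 - v - l) + (y\<^sup>2 - v - l)\<^sup>2 / 2"
    using one_plus_quadratic_ge[of "\<eta> * (y\<^sup>2 - v - l)"] assms(1) by (simp add: power_mult_distrib)
  moreover have "0 \<le> c_const * v * (y\<^sup>2 + v / 2)" using assms(2) c_const_lower by simp
  ultimately show ?thesis unfolding pac_poly_def by linarith
qed

lemma abs_ln_le: "\<bar>ln x\<bar> \<le> x + 1" if "1 / 2 \<le> x" for x :: real
proof -
  have "ln x \<le> x - 1" using that by (intro ln_le_minus_one) simp
  moreover have "- ln 2 \<le> ln x"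
    using that ln_mono[of "1 / 2" x] by (simp add: ln_div)
  ultimately show ?thesis using that ln2_le_25_over_36 by auto
qed

text \<open>With y = m + s g, the argument y^2 - s^2 - l has mean m^2 - l and variance 4 m^2 s^2 + 2
  s^4, and y^2 + s^2/2 has mean m^2 + 3 s^2/2.\<close>

lemma pac_poly_expectation:
  fixes m s :: real
  assumes "\<eta>\<^sup>2 = 1"
  shows "has_bochner_integral std_normal (\<lambda>g. pac_poly \<eta> l (s\<^sup>2) (m + s * g))
    (1 + \<eta> * (m\<^sup>2 - l) + ((m\<^sup>2 - l)\<^sup>2 + 4 * m\<^sup>2 * s\<^sup>2 + 2 * s ^ 4) / 2
      + c_const * s\<^sup>2 * (m\<^sup>2 + 3 / 2 * s\<^sup>2))"
proof -
  define z where "z = m\<^sup>2 - s\<^sup>2 - l"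
  have "has_bochner_integral std_normal (\<lambda>g.
      (1 + \<eta> * z + z\<^sup>2 / 2 + c_const * s\<^sup>2 * (m\<^sup>2 + s\<^sup>2 / 2))
      + (2 * m * s) * (\<eta> + z + c_const * s\<^sup>2) * g
      + (s\<^sup>2 * (\<eta> + z + c_const * s\<^sup>2) + 2 * m\<^sup>2 * s\<^sup>2) * g\<^sup>2
      + (2 * m * s ^ 3) * g ^ 3 + (s ^ 4 / 2) * g ^ 4)
      ((1 + \<eta> * z + z\<^sup>2 / 2 + c_const * s\<^sup>2 * (m\<^sup>2 + s\<^sup>2 / 2))
      + (s\<^sup>2 * (\<eta> + z + c_const * s\<^sup>2) + 2 * m\<^sup>2 * s\<^sup>2) + 3 * (s ^ 4 / 2))"
    by (rule has_bochner_integral_std_normal_quartic)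
  moreover have "(1 + \<eta> * z + z\<^sup>2 / 2 + c_const * s\<^sup>2 * (m\<^sup>2 + s\<^sup>2 / 2))
      + (s\<^sup>2 * (\<eta> + z + c_const * s\<^sup>2) + 2 * m\<^sup>2 * s\<^sup>2) + 3 * (s ^ 4 / 2)
      = 1 + \<eta> * (m\<^sup>2 - l) + ((m\<^sup>2 - l)\<^sup>2 + 4 * m\<^sup>2 * s\<^sup>2 + 2 * s ^ 4) / 2
      + c_const * s\<^sup>2 * (m\<^sup>2 + 3 / 2 * s\<^sup>2)"
    by (simp add: z_def power2_eq_square power4_eq_xxxx field_simps)
  moreover have "pac_poly \<eta> l (s\<^sup>2) (m + s * g) =
      (1 + \<eta> * z + z\<^sup>2 / 2 + c_const * s\<^sup>2 * (m\<^sup>2 + s\<^sup>2 / 2))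
      + (2 * m * s) * (\<eta> + z + c_const * s\<^sup>2) * g
      + (s\<^sup>2 * (\<eta> + z + c_const * s\<^sup>2) + 2 * m\<^sup>2 * s\<^sup>2) * g\<^sup>2
      + (2 * m * s ^ 3) * g ^ 3 + (s ^ 4 / 2) * g ^ 4" for g
    by (simp add: pac_poly_def z_def power2_eq_square power3_eq_cube power4_eq_xxxx field_simps)
  ultimately show ?thesis by (simp only:)
qed

text \<open>The mean of \<psi> falls short of \<psi> at the mean by at most
  \<open>min V (2 * ln 2)\<close>, and ln D with D = 1 + b + a y^2 has at least that mean. Since exp
  \<psi> \<le> 2, the product D exp \<psi> is at most exp \<psi> + 2 (D - 1), and
  \<open>pac_poly\<close> dominates this sum.\<close>

lemma psi_le_expectation_ln_pac_poly:
  fixes m s :: real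
  assumes \<eta>: "\<eta>\<^sup>2 = 1"
  shows "integrable std_normal (\<lambda>g. ln (pac_poly \<eta> l (s\<^sup>2) (m + s * g)))"
    and "psi (\<eta> * (m\<^sup>2 - l)) \<le> (\<integral>g. ln (pac_poly \<eta> l (s\<^sup>2) (m + s * g)) \<partial>std_normal)"
proof -
  interpret prob_space std_normal by (rule prob_space_std_normal)
  define V where "V = 4 * m\<^sup>2 * s\<^sup>2 + 2 * s ^ 4"
  define a b where "a = c_const * s\<^sup>2 / 2" and "b = c_const * s ^ 4 / 4"
  define h where "h = (\<lambda>g. (m + s * g)\<^sup>2 - s\<^sup>2 - l)"
  define z0 where "z0 = m\<^sup>2 - l"
  have [measurable]: "h \<in> borel_measurable borel" by (simp add: h_def)
  let ?F = "\<lambda>g. pac_poly \<eta> l (s\<^sup>2) (m + s * g)"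
  have F: "1 / 2 \<le> ?F g" for g using \<eta> by (rule pac_poly_ge_half) simp
  have intF: "integrable std_normal ?F"
    by (rule integrable.intros, rule pac_poly_expectation[OF \<eta>])
  have measF[measurable]: "?F \<in> borel_measurable borel" by (simp add: pac_poly_def)
  show intln: "integrable std_normal (\<lambda>g. ln (?F g))"
  proof (rule Bochner_Integration.integrable_bound[OF Bochner_Integration.integrable_add[OF intF integrable_const[of "1::real"]]])
    show "AE g in std_normal. norm (ln (?F g)) \<le> norm (?F g + 1)"
    proof (rule AE_I2)
      fix g show "norm (ln (?F g)) \<le> norm (?F g + 1)"
        using abs_ln_le[OF F[of g]] F[of g] by simp
    qed
  qed measurable
  have int_psi: "integrable std_normal (\<lambda>g. psi (\<eta> * h g))"
    by (rule integrable_const_bound[of _ "ln 2"])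
      (auto simp: abs_le_iff psi_le_ln2 intro: minus_le_iff[THEN iffD1] psi_ge_minus_ln2)
  note lnq = expectation_ln_quadratic[OF c_const_lower a_def b_def V_def]
  have lnF: "psi (\<eta> * h g) + ln (1 + b + a * (m + s * g)\<^sup>2) \<le> ln (?F g)" for g
  proof -
    define D where "D = 1 + b + a * (m + s * g)\<^sup>2"
    have ab: "0 \<le> a" "0 \<le> b" using c_const_lower by (simp_all add: a_def b_def)
    then have D: "1 \<le> D" by (simp add: D_def)
    have "exp (psi (\<eta> * h g)) * (D - 1) \<le> 2 * (D - 1)"
      using D psi_le_ln2[of "\<eta> * h g"] by (intro mult_right_mono) (auto simp: ln_ge_iff)
    moreover have "2 * (D - 1) = c_const * s\<^sup>2 * ((m + s * g)\<^sup>2 + s\<^sup>2 / 2)"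
      by (simp add: D_def a_def b_def power2_eq_square power4_eq_xxxx field_simps)
    moreover have "exp (psi (\<eta> * h g)) \<le> 1 + \<eta> * h g + (h g)\<^sup>2 / 2"
      using exp_psi_le[of "\<eta> * h g"] \<eta> by (simp add: power_mult_distrib)
    ultimately have "exp (psi (\<eta> * h g)) * D \<le> ?F g"
      by (simp add: pac_poly_def h_def algebra_simps)
    then have "ln (exp (psi (\<eta> * h g)) * D) \<le> ln (?F g)" using D by (intro ln_mono) auto
    then show ?thesis using D by (simp add: ln_mult D_def)
  qed
  have Epsi: "psi (\<eta> * z0) - min V (2 * ln 2) \<le> (\<integral>g. psi (\<eta> * h g) \<partial>std_normal)"
  proof -
    define d where "d = psi' (\<eta> * z0)"
    \<comment> \<open>The downward parabola \<psi> + d \<eta> r - r^2 with r = h g - z0, expanded in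
      powers of g so that its mean can be read off.\<close>
    define q where "q = (\<lambda>g. (psi (\<eta> * z0) - d * \<eta> * s\<^sup>2 - s ^ 4) + (d * \<eta> * 2 * m * s + 4 * m * s ^ 3) * g
        + (d * \<eta> * s\<^sup>2 - 4 * m\<^sup>2 * s\<^sup>2 + 2 * s ^ 4) * g\<^sup>2 + (- 4 * m * s ^ 3) * g ^ 3 + (- (s ^ 4)) * g ^ 4)"
    have q: "has_bochner_integral std_normal q (psi (\<eta> * z0) - V)"
      using has_bochner_integral_std_normal_quartic[of "psi (\<eta> * z0) - d * \<eta> * s\<^sup>2 - s ^ 4"
          "d * \<eta> * 2 * m * s + 4 * m * s ^ 3" "d * \<eta> * s\<^sup>2 - 4 * m\<^sup>2 * s\<^sup>2 + 2 * s ^ 4"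
          "- 4 * m * s ^ 3" "- (s ^ 4)"]
      by (simp add: q_def V_def diff_diff_eq)
    have "psi (\<eta> * z0) - V = (\<integral>g. q g \<partial>std_normal)"
      using q by (simp add: has_bochner_integral_iff)
    also have "\<dots> \<le> (\<integral>g. psi (\<eta> * h g) \<partial>std_normal)"
    proof (rule integral_mono[OF _ int_psi])
      show "integrable std_normal q" using q by (rule integrable.intros)
      fix g
      define r where "r = 2 * m * s * g + s\<^sup>2 * (g\<^sup>2 - 1)"
      have r: "h g - z0 = r"
        by (simp add: r_def h_def z0_def power2_eq_square algebra_simps)
      have "q g = psi (\<eta> * z0) + d * \<eta> * r - r\<^sup>2"
        unfolding q_def r_def by (simp only: power2_eq_square power3_eq_cube power4_eq_xxxx ring_distribs ac_simps)
      also have "\<dots> = psi (\<eta> * z0) + d * \<eta> * (h g - z0) - (h g - z0)\<^sup>2" unfolding r ..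
      also have "\<dots> = psi (\<eta> * z0) + d * (\<eta> * h g - \<eta> * z0) - (\<eta> * h g - \<eta> * z0)\<^sup>2"
        using \<eta> by (simp add: power_mult_distrib flip: right_diff_distrib)
      also have "\<dots> \<le> psi (\<eta> * h g)" unfolding d_def by (rule psi_semiconvex)
      finally show "q g \<le> psi (\<eta> * h g)" .
    qed
    finally have "psi (\<eta> * z0) - V \<le> (\<integral>g. psi (\<eta> * h g) \<partial>std_normal)" .
    moreover have "psi (\<eta> * z0) - 2 * ln 2 \<le> (\<integral>g. psi (\<eta> * h g) \<partial>std_normal)"
    proof -
      have "(\<integral>g. - ln 2 \<partial>std_normal) \<le> (\<integral>g. psi (\<eta> * h g) \<partial>std_normal)"
        by (intro integral_mono int_psi psi_ge_minus_ln2) simp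
      then show ?thesis using psi_le_ln2[of "\<eta> * z0"] prob_space by simp
    qed
    ultimately show ?thesis by (simp add: min_def)
  qed
  have "psi (\<eta> * z0) \<le> (\<integral>g. psi (\<eta> * h g) \<partial>std_normal) + (\<integral>g. ln (1 + b + a * (m + s * g)\<^sup>2) \<partial>std_normal)"
    using Epsi lnq(2) by linarith
  also have "\<dots> = (\<integral>g. psi (\<eta> * h g) + ln (1 + b + a * (m + s * g)\<^sup>2) \<partial>std_normal)"
    using int_psi lnq(1) by simp
  also have "\<dots> \<le> (\<integral>g. ln (?F g) \<partial>std_normal)"
    using int_psi lnq(1) intln lnF by (intro integral_mono) auto
  finally show "psi (\<eta> * (m\<^sup>2 - l)) \<le> (\<integral>g. ln (?F g) \<partial>std_normal)" by (simp add: z0_def)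
qed

section \<open>Moments of the law\<close>

lemma integral_std_gaussian_inner:
  fixes f :: "real \<Rightarrow> real"
  assumes [measurable]: "f \<in> borel_measurable borel"
  shows "integrable std_gaussian (\<lambda>y. f (y \<bullet> (v :: real ^ 'd))) \<longleftrightarrow> integrable std_normal (\<lambda>g. f (norm v * g))"
    and "(\<integral>y. f (y \<bullet> v) \<partial>std_gaussian) = (\<integral>g. f (norm v * g) \<partial>std_normal)"
proof -
  have "integrable std_gaussian (\<lambda>y. f (y \<bullet> v)) \<longleftrightarrow> integrable (distr std_gaussian borel (\<lambda>y. y \<bullet> v)) f"
    by (rule integrable_distr_eq[symmetric]) auto
  also have "\<dots> \<longleftrightarrow> integrable std_normal (\<lambda>g. f (norm v * g))"
    unfolding distr_std_gaussian_inner by (rule integrable_distr_eq) auto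
  finally show "integrable std_gaussian (\<lambda>y. f (y \<bullet> v)) \<longleftrightarrow> integrable std_normal (\<lambda>g. f (norm v * g))" .
  have "(\<integral>y. f (y \<bullet> v) \<partial>std_gaussian) = (\<integral>t. f t \<partial>distr std_gaussian borel (\<lambda>y. y \<bullet> v))"
    by (rule integral_distr[symmetric]) auto
  also have "\<dots> = (\<integral>g. f (norm v * g) \<partial>std_normal)"
    unfolding distr_std_gaussian_inner by (rule integral_distr) auto
  finally show "(\<integral>y. f (y \<bullet> v) \<partial>std_gaussian) = (\<integral>g. f (norm v * g) \<partial>std_normal)" .
qed

text \<open>The Donsker--Varadhan inequality for the Gaussian prior and its translate by \<open>a\<close>, whose
  relative entropy is \<open>\<parallel>a\<parallel>\<^sup>2 / 2\<close>.\<close>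

lemma gaussian_change_of_measure:
  fixes f :: "real ^ 'd \<Rightarrow> real"
  assumes f[measurable]: "f \<in> borel_measurable borel"
    and C: "C > 0" "(\<integral>\<^sup>+y. ennreal (exp (f y)) \<partial>std_gaussian) \<le> ennreal C"
    and int: "integrable std_gaussian (\<lambda>y. f (a + y))"
  shows "(\<integral>y. f (a + y) \<partial>std_gaussian) \<le> ln C + (norm a)\<^sup>2 / 2"
proof -
  interpret prob_space "std_gaussian :: (real ^ 'd) measure" by (rule prob_space_std_gaussian)
  \<comment> \<open>The log-density of the translate relative to the prior, taken at a + y, is
    subtracted from f. Then exp u has the same integral as exp f, and Jensen's inequality for exp
    concludes.\<close>
  define u where "u = (\<lambda>y. f (a + y) - y \<bullet> a - (norm a)\<^sup>2 / 2)"
  have [measurable]: "u \<in> borel_measurable borel" by (simp add: u_def)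
  have lin: "integrable std_gaussian (\<lambda>y. y \<bullet> a)" "(\<integral>y. y \<bullet> a \<partial>std_gaussian) = 0"
    using integral_std_gaussian_inner[of "\<lambda>x. x" a] integrable_std_normal_power[of 1] std_normal_moments(1)
    by simp_all
  have u: "integrable std_gaussian u" and Eu: "(\<integral>y. u y \<partial>std_gaussian) = (\<integral>y. f (a + y) \<partial>std_gaussian) - (norm a)\<^sup>2 / 2"
    using int lin prob_space unfolding u_def by simp_all
  have "(\<integral>\<^sup>+y. ennreal (exp (u y)) \<partial>std_gaussian)
      = (\<integral>\<^sup>+y. ennreal (exp (f (a + y) - (a + y) \<bullet> a + (norm a)\<^sup>2 / 2)) \<partial>std_gaussian)"
    by (intro nn_integral_cong) (simp add: u_def inner_add_left dot_square_norm)
  also have "\<dots> = (\<integral>\<^sup>+y. ennreal (exp (f y - y \<bullet> a + (norm a)\<^sup>2 / 2))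
      * ennreal (exp (y \<bullet> a - (norm a)\<^sup>2 / 2)) \<partial>std_gaussian)"
    by (rule nn_integral_std_gaussian_shift) measurable
  also have "\<dots> = (\<integral>\<^sup>+y. ennreal (exp (f y)) \<partial>std_gaussian)"
    by (intro nn_integral_cong) (simp flip: ennreal_mult exp_add)
  finally have le: "(\<integral>\<^sup>+y. ennreal (exp (u y)) \<partial>std_gaussian) \<le> ennreal C" using C by simp
  have int_exp: "integrable std_gaussian (\<lambda>y. exp (u y))"
    by (rule integrableI_nonneg) (use le_less_trans[OF le ennreal_less_top] in \<open>simp_all\<close>)
  have "ennreal (\<integral>y. exp (u y) \<partial>std_gaussian) \<le> ennreal C"
    using le int_exp by (subst (asm) nn_integral_eq_integral) auto
  then have "(\<integral>y. exp (u y) \<partial>std_gaussian) \<le> C" using C by (simp add: ennreal_le_iff)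
  define c where "c = (\<integral>y. u y \<partial>std_gaussian)"
  have "exp c = (\<integral>y. exp c * (1 + (u y - c)) \<partial>std_gaussian)"
    using u prob_space by (simp add: c_def)
  also have "\<dots> \<le> (\<integral>y. exp (u y) \<partial>std_gaussian)"
  proof (rule integral_mono)
    fix y
    have "exp c * (1 + (u y - c)) \<le> exp c * exp (u y - c)"
      by (intro mult_left_mono exp_ge_add_one_self) simp
    then show "exp c * (1 + (u y - c)) \<le> exp (u y)" by (simp flip: exp_add)
  qed (use u int_exp in auto)
  also have "\<dots> \<le> C" by fact
  finally have "c \<le> ln C" using C by (simp add: ln_ge_iff)
  then show ?thesis using Eu by (simp add: c_def)
qed

section \<open>Moment inequalities for a law of bounded kurtosis\<close>

locale kurtosis_law = prob_space P for P :: "(real ^ 'd) measure" +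
  assumes sets_P [measurable_cong, simp]: "sets P = sets borel"
    and int4: "integrable P (\<lambda>x. norm x ^ 4)"
    and bdd_kurtosis: "bdd_above (kurtosis_ratios P)"
    and kappa_pos: "kappa P > 0"
begin

lemma space_P [simp]: "space P = UNIV"
  using sets_eq_imp_space_eq[OF sets_P] by simp

lemma integrable_bounded_by_norm4:
  fixes f :: "real ^ 'd \<Rightarrow> real"
  assumes [measurable]: "f \<in> borel_measurable borel" and "\<And>x. \<bar>f x\<bar> \<le> 1 + C * norm x ^ 4"
  shows "integrable P f"
proof (rule Bochner_Integration.integrable_bound)
  show "integrable P (\<lambda>x. 1 + C * norm x ^ 4)" using int4 by simp
  show "AE x in P. norm (f x) \<le> norm (1 + C * norm x ^ 4)"
    using assms(2) by (intro AE_I2) (simp add: order.trans[OF _ abs_ge_self])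
qed measurable

lemma norm2_le: "(norm x)\<^sup>2 \<le> 1 + norm x ^ 4"
proof -
  have "0 \<le> ((norm x)\<^sup>2 - 1)\<^sup>2" "0 \<le> (norm x)\<^sup>2" by simp_all
  moreover have "((norm x)\<^sup>2 - 1)\<^sup>2 = norm x ^ 4 - 2 * (norm x)\<^sup>2 + 1"
    by (simp add: power2_diff flip: power_mult)
  ultimately show ?thesis by linarith
qed

lemma inner2_le: "(\<theta> \<bullet> x)\<^sup>2 \<le> (norm \<theta>)\<^sup>2 * (norm x)\<^sup>2"
  using power_mono[OF Cauchy_Schwarz_ineq2, of \<theta> x 2] by (simp add: power_mult_distrib)

lemma inner4_le: "(\<theta> \<bullet> x) ^ 4 \<le> norm \<theta> ^ 4 * norm x ^ 4"
  using power_mono[OF inner2_le[of \<theta> x], of 2] by (simp add: power_mult_distrib flip: power_mult)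

lemma integrable_norm2: "integrable P (\<lambda>x. (norm x)\<^sup>2)"
  by (rule integrable_bounded_by_norm4[of _ 1]) (auto intro: norm2_le)

lemma integrable_inner2: "integrable P (\<lambda>x. (\<theta> \<bullet> x)\<^sup>2)"
proof (rule Bochner_Integration.integrable_bound)
  show "integrable P (\<lambda>x. (norm \<theta>)\<^sup>2 * (norm x)\<^sup>2)" using integrable_norm2 by simp
  show "AE x in P. norm ((\<theta> \<bullet> x)\<^sup>2) \<le> norm ((norm \<theta>)\<^sup>2 * (norm x)\<^sup>2)"
    using inner2_le by (intro AE_I2) simp
qed measurable

lemma integrable_inner4: "integrable P (\<lambda>x. (\<theta> \<bullet> x) ^ 4)"
proof (rule Bochner_Integration.integrable_bound)
  show "integrable P (\<lambda>x. norm \<theta> ^ 4 * norm x ^ 4)" using int4 by simp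
  show "AE x in P. norm ((\<theta> \<bullet> x) ^ 4) \<le> norm (norm \<theta> ^ 4 * norm x ^ 4)"
    using inner4_le by (intro AE_I2) (simp add: power_abs)
qed measurable

lemma integrable_inner2_norm2: "integrable P (\<lambda>x. (\<theta> \<bullet> x)\<^sup>2 * (norm x)\<^sup>2)"
proof (rule Bochner_Integration.integrable_bound)
  show "integrable P (\<lambda>x. (norm \<theta>)\<^sup>2 * norm x ^ 4)" using int4 by simp
  show "AE x in P. norm ((\<theta> \<bullet> x)\<^sup>2 * (norm x)\<^sup>2) \<le> norm ((norm \<theta>)\<^sup>2 * norm x ^ 4)"
  proof (rule AE_I2)
    fix x
    show "norm ((\<theta> \<bullet> x)\<^sup>2 * (norm x)\<^sup>2) \<le> norm ((norm \<theta>)\<^sup>2 * norm x ^ 4)"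
      using mult_right_mono[OF inner2_le[of \<theta> x], of "(norm x)\<^sup>2"]
      by (simp add: mult.assoc flip: power_add)
  qed
qed measurable

lemma energy_nonneg: "0 \<le> energy P \<theta>"
  unfolding energy_def by (rule Bochner_Integration.integral_nonneg) simp

lemma s4_power4: "s4 P ^ 4 = (\<integral>x. norm x ^ 4 \<partial>P)"
  unfolding s4_def by (rule real_root_pow_pos2) (auto intro: Bochner_Integration.integral_nonneg)

lemma s4_nonneg: "0 \<le> s4 P"
  unfolding s4_def by (auto intro: Bochner_Integration.integral_nonneg)

text \<open>A direction of zero energy does not occur in \<open>kurtosis_ratios\<close>, but there
  the inner product vanishes almost surely and both sides are 0.\<close>

lemma fourth_moment_le: "(\<integral>x. (\<theta> \<bullet> x) ^ 4 \<partial>P) \<le> kappa P * (energy P \<theta>)\<^sup>2"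
proof (cases "energy P \<theta> > 0")
  case True
  then have "(\<integral>x. (\<theta> \<bullet> x) ^ 4 \<partial>P) / (energy P \<theta>)\<^sup>2 \<in> kurtosis_ratios P"
    by (auto simp: kurtosis_ratios_def energy_def)
  then have "(\<integral>x. (\<theta> \<bullet> x) ^ 4 \<partial>P) / (energy P \<theta>)\<^sup>2 \<le> kappa P"
    unfolding kappa_def using bdd_kurtosis by (rule cSup_upper)
  then show ?thesis using True by (simp add: pos_divide_le_eq)
next
  case False
  then have "energy P \<theta> = 0" using energy_nonneg[of \<theta>] by linarith
  then have "(\<integral>x. (\<theta> \<bullet> x)\<^sup>2 \<partial>P) = 0" by (simp add: energy_def)
  then have "AE x in P. (\<theta> \<bullet> x)\<^sup>2 = 0"
    using integral_nonneg_eq_0_iff_AE[OF integrable_inner2[of \<theta>]] by simp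
  then have "(\<integral>x. (\<theta> \<bullet> x) ^ 4 \<partial>P) = (\<integral>x. 0 \<partial>P)"
    by (intro integral_cong_AE) auto
  then show ?thesis using kappa_pos by simp
qed

lemma integral_Cauchy_Schwarz:
  fixes f g :: "real ^ 'd \<Rightarrow> real"
  assumes f: "integrable P (\<lambda>x. (f x)\<^sup>2)" and g: "integrable P (\<lambda>x. (g x)\<^sup>2)"
    and fg: "integrable P (\<lambda>x. f x * g x)"
  shows "(\<integral>x. f x * g x \<partial>P)\<^sup>2 \<le> (\<integral>x. (f x)\<^sup>2 \<partial>P) * (\<integral>x. (g x)\<^sup>2 \<partial>P)"
proof -
  define a b c where "a = (\<integral>x. (f x)\<^sup>2 \<partial>P)" and "b = (\<integral>x. f x * g x \<partial>P)" and "c = (\<integral>x. (g x)\<^sup>2 \<partial>P)"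
  have nn: "0 \<le> a" "0 \<le> c" by (auto simp: a_def c_def intro: Bochner_Integration.integral_nonneg)
  have quad: "0 \<le> s\<^sup>2 * a - 2 * s * t * b + t\<^sup>2 * c" for s t
  proof -
    have "0 \<le> (\<integral>x. (s * f x - t * g x)\<^sup>2 \<partial>P)" by (rule Bochner_Integration.integral_nonneg) simp
    also have "\<dots> = (\<integral>x. s\<^sup>2 * (f x)\<^sup>2 - 2 * s * t * (f x * g x) + t\<^sup>2 * (g x)\<^sup>2 \<partial>P)"
      by (intro Bochner_Integration.integral_cong) (auto simp: power2_eq_square algebra_simps)
    also have "\<dots> = s\<^sup>2 * a - 2 * s * t * b + t\<^sup>2 * c"
      using f g fg by (simp add: a_def b_def c_def)
    finally show ?thesis .
  qed
  have "b\<^sup>2 \<le> a * c"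
  proof (cases "c = 0")
    case True
    have "b = 0"
    proof (rule ccontr)
      assume "b \<noteq> 0"
      \<comment> \<open>With c = 0 this choice makes the quadratic form equal to -1.\<close>
      then show False using quad[of 1 "(a + 1) / (2 * b)"] True by simp
    qed
    then show ?thesis using nn by simp
  next
    case False
    then have "0 < c" using nn by simp
    have "0 \<le> c * (a * c - b\<^sup>2)"
      using quad[of c b] by (simp add: power2_eq_square algebra_simps)
    then show ?thesis using \<open>0 < c\<close> by (simp add: zero_le_mult_iff)
  qed
  then show ?thesis by (simp add: a_def b_def c_def)
qed

text \<open>Cauchy-Schwarz for <\<theta>, x>^2 and |x|^2, followed by the kurtosis bound. This is
  the source of the product of sqrt kappa and s_4^2 in \<open>mu\<close> and
  \<open>gam\<close>.\<close>

lemma mixed_moment_le: "(\<integral>x. (\<theta> \<bullet> x)\<^sup>2 * (norm x)\<^sup>2 \<partial>P) \<le> sqrt (kappa P) * (s4 P)\<^sup>2 * energy P \<theta>"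
proof -
  have "(\<integral>x. (\<theta> \<bullet> x)\<^sup>2 * (norm x)\<^sup>2 \<partial>P)\<^sup>2 \<le> (\<integral>x. ((\<theta> \<bullet> x)\<^sup>2)\<^sup>2 \<partial>P) * (\<integral>x. ((norm x)\<^sup>2)\<^sup>2 \<partial>P)"
    using integrable_inner4[of \<theta>] int4 integrable_inner2_norm2[of \<theta>]
    by (intro integral_Cauchy_Schwarz) (simp_all flip: power_mult)
  also have "\<dots> = (\<integral>x. (\<theta> \<bullet> x) ^ 4 \<partial>P) * s4 P ^ 4"
    by (simp add: s4_power4 flip: power_mult)
  also have "\<dots> \<le> kappa P * (energy P \<theta>)\<^sup>2 * s4 P ^ 4"
    by (intro mult_right_mono fourth_moment_le) simp
  also have "\<dots> = (sqrt (kappa P) * (s4 P)\<^sup>2 * energy P \<theta>)\<^sup>2"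
    using kappa_pos by (simp add: power_mult_distrib flip: power_mult)
  finally show ?thesis
    by (rule power2_le_imp_le) (simp add: kappa_pos energy_nonneg less_imp_le)
qed

end

section \<open>The PAC-Bayesian bound\<close>

context kurtosis_law
begin

definition pac_factor :: "real \<Rightarrow> real \<Rightarrow> real \<Rightarrow> real ^ 'd \<Rightarrow> real ^ 'd \<Rightarrow> real" where
  "pac_factor \<eta> l \<beta> \<theta> x = pac_poly \<eta> l ((norm x)\<^sup>2 / \<beta>) (\<theta> \<bullet> x)"

text \<open>With 1 removed, this is the R of 1 + R \<le> exp R, the compensator that normalises the
  product of the factors over the sample.\<close>

definition pac_excess :: "real \<Rightarrow> real \<Rightarrow> real \<Rightarrow> real ^ 'd \<Rightarrow> real" where
  "pac_excess \<eta> l \<beta> \<theta> = (\<integral>x. pac_factor \<eta> l \<beta> \<theta> x \<partial>P) - 1"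

text \<open>Half of the variance 4 m^2 s^2 + 2 s^4 plus the compensating term c s^2 (m^2 + 3 s^2/2)
  gives the coefficients 2 + c and (2 + 3c) / 2; the moments are then replaced by their kurtosis
  bounds.\<close>

definition pac_bound :: "real \<Rightarrow> real \<Rightarrow> real \<Rightarrow> real ^ 'd \<Rightarrow> real" where
  "pac_bound \<eta> l \<beta> \<theta> = \<eta> * (energy P \<theta> - l)
    + (kappa P * (energy P \<theta>)\<^sup>2 - 2 * l * energy P \<theta> + l\<^sup>2) / 2
    + (2 + c_const) * sqrt (kappa P) * (s4 P)\<^sup>2 * energy P \<theta> / \<beta>
    + (2 + 3 * c_const) * s4 P ^ 4 / (2 * \<beta>\<^sup>2)"

lemma measurable_pac_factor [measurable]:
  assumes [measurable]: "f \<in> borel_measurable N" "g \<in> borel_measurable N"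
  shows "(\<lambda>z. pac_factor \<eta> l \<beta> (f z) (g z)) \<in> borel_measurable N"
  unfolding pac_factor_def pac_poly_def by measurable

lemma pac_factor_ge_half: "\<eta>\<^sup>2 = 1 \<Longrightarrow> 0 < \<beta> \<Longrightarrow> 1 / 2 \<le> pac_factor \<eta> l \<beta> \<theta> x"
  unfolding pac_factor_def by (rule pac_poly_ge_half) auto

lemma pac_factor_gaussian:
  assumes "0 < \<beta>"
  shows "pac_factor \<eta> l \<beta> (\<theta> + y /\<^sub>R sqrt \<beta>) x
    = pac_poly \<eta> l ((norm x / sqrt \<beta>)\<^sup>2) (\<theta> \<bullet> x + (y \<bullet> x) / sqrt \<beta>)"
proof -
  have "(norm x / sqrt \<beta>)\<^sup>2 = (norm x)\<^sup>2 / \<beta>" using assms by (simp add: power_divide)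
  moreover have "(\<theta> + y /\<^sub>R sqrt \<beta>) \<bullet> x = \<theta> \<bullet> x + (y \<bullet> x) / sqrt \<beta>"
    by (simp add: inner_add_left divide_inverse_commute)
  ultimately show ?thesis by (simp add: pac_factor_def)
qed

lemma pac_factor_gaussian_mean:
  assumes "\<eta>\<^sup>2 = 1" "0 < \<beta>"
  shows "integrable std_gaussian (\<lambda>y. pac_factor \<eta> l \<beta> (\<theta> + y /\<^sub>R sqrt \<beta>) x)"
    and "(\<integral>y. pac_factor \<eta> l \<beta> (\<theta> + y /\<^sub>R sqrt \<beta>) x \<partial>std_gaussian)
      = 1 + \<eta> * ((\<theta> \<bullet> x)\<^sup>2 - l) + ((\<theta> \<bullet> x)\<^sup>2 - l)\<^sup>2 / 2
        + (2 + c_const) * ((\<theta> \<bullet> x)\<^sup>2 * (norm x)\<^sup>2) / \<beta> + (2 + 3 * c_const) * norm x ^ 4 / (2 * \<beta>\<^sup>2)"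
proof -
  let ?f = "\<lambda>t. pac_poly \<eta> l ((norm x / sqrt \<beta>)\<^sup>2) (\<theta> \<bullet> x + t / sqrt \<beta>)"
  have [measurable]: "?f \<in> borel_measurable borel" unfolding pac_poly_def by measurable
  have *: "has_bochner_integral std_normal (\<lambda>g. ?f (norm x * g))
    (1 + \<eta> * ((\<theta> \<bullet> x)\<^sup>2 - l) + (((\<theta> \<bullet> x)\<^sup>2 - l)\<^sup>2 + 4 * (\<theta> \<bullet> x)\<^sup>2 * (norm x / sqrt \<beta>)\<^sup>2 + 2 * (norm x / sqrt \<beta>) ^ 4) / 2
      + c_const * (norm x / sqrt \<beta>)\<^sup>2 * ((\<theta> \<bullet> x)\<^sup>2 + 3 / 2 * (norm x / sqrt \<beta>)\<^sup>2))"
    using pac_poly_expectation[OF assms(1), of l "norm x / sqrt \<beta>" "\<theta> \<bullet> x"]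
    by (simp add: mult.commute)
  show "integrable std_gaussian (\<lambda>y. pac_factor \<eta> l \<beta> (\<theta> + y /\<^sub>R sqrt \<beta>) x)"
    using * unfolding pac_factor_gaussian[OF assms(2)]
    by (subst integral_std_gaussian_inner(1)[of ?f]) (auto intro: integrable.intros)
  have "(\<integral>y. pac_factor \<eta> l \<beta> (\<theta> + y /\<^sub>R sqrt \<beta>) x \<partial>std_gaussian) = (\<integral>g. ?f (norm x * g) \<partial>std_normal)"
    unfolding pac_factor_gaussian[OF assms(2)]
    by (rule integral_std_gaussian_inner(2)) measurable
  also have "\<dots> = 1 + \<eta> * ((\<theta> \<bullet> x)\<^sup>2 - l) + (((\<theta> \<bullet> x)\<^sup>2 - l)\<^sup>2 + 4 * (\<theta> \<bullet> x)\<^sup>2 * (norm x / sqrt \<beta>)\<^sup>2 + 2 * (norm x / sqrt \<beta>) ^ 4) / 2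
      + c_const * (norm x / sqrt \<beta>)\<^sup>2 * ((\<theta> \<bullet> x)\<^sup>2 + 3 / 2 * (norm x / sqrt \<beta>)\<^sup>2)"
    using * by (rule has_bochner_integral_integral_eq)
  also have "(norm x / sqrt \<beta>)\<^sup>2 = (norm x)\<^sup>2 / \<beta>" using assms(2) by (simp add: power_divide)
  also have "(norm x / sqrt \<beta>) ^ 4 = norm x ^ 4 / \<beta>\<^sup>2"
    using assms(2) power_mult[of "sqrt \<beta>" 2 2] by (simp add: power_divide)
  also have "1 + \<eta> * ((\<theta> \<bullet> x)\<^sup>2 - l) + (((\<theta> \<bullet> x)\<^sup>2 - l)\<^sup>2 + 4 * (\<theta> \<bullet> x)\<^sup>2 * ((norm x)\<^sup>2 / \<beta>) + 2 * (norm x ^ 4 / \<beta>\<^sup>2)) / 2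
      + c_const * ((norm x)\<^sup>2 / \<beta>) * ((\<theta> \<bullet> x)\<^sup>2 + 3 / 2 * ((norm x)\<^sup>2 / \<beta>))
      = 1 + \<eta> * ((\<theta> \<bullet> x)\<^sup>2 - l) + ((\<theta> \<bullet> x)\<^sup>2 - l)\<^sup>2 / 2
        + (2 + c_const) * ((\<theta> \<bullet> x)\<^sup>2 * (norm x)\<^sup>2) / \<beta> + (2 + 3 * c_const) * norm x ^ 4 / (2 * \<beta>\<^sup>2)"
    using assms(2) by (simp add: field_simps power2_eq_square power4_eq_xxxx)
  finally show "(\<integral>y. pac_factor \<eta> l \<beta> (\<theta> + y /\<^sub>R sqrt \<beta>) x \<partial>std_gaussian)
      = 1 + \<eta> * ((\<theta> \<bullet> x)\<^sup>2 - l) + ((\<theta> \<bullet> x)\<^sup>2 - l)\<^sup>2 / 2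
        + (2 + c_const) * ((\<theta> \<bullet> x)\<^sup>2 * (norm x)\<^sup>2) / \<beta> + (2 + 3 * c_const) * norm x ^ 4 / (2 * \<beta>\<^sup>2)" .
qed

lemma psi_le_gaussian_ln_pac_factor:
  assumes "\<eta>\<^sup>2 = 1" "0 < \<beta>"
  shows "integrable std_gaussian (\<lambda>y. ln (pac_factor \<eta> l \<beta> (\<theta> + y /\<^sub>R sqrt \<beta>) x))"
    and "psi (\<eta> * ((\<theta> \<bullet> x)\<^sup>2 - l)) \<le> (\<integral>y. ln (pac_factor \<eta> l \<beta> (\<theta> + y /\<^sub>R sqrt \<beta>) x) \<partial>std_gaussian)"
proof -
  let ?f = "\<lambda>t. ln (pac_poly \<eta> l ((norm x / sqrt \<beta>)\<^sup>2) (\<theta> \<bullet> x + t / sqrt \<beta>))"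
  have [measurable]: "?f \<in> borel_measurable borel" unfolding pac_poly_def by measurable
  note * = psi_le_expectation_ln_pac_poly[OF assms(1), where l = l and s = "norm x / sqrt \<beta>" and m = "\<theta> \<bullet> x"]
  show "integrable std_gaussian (\<lambda>y. ln (pac_factor \<eta> l \<beta> (\<theta> + y /\<^sub>R sqrt \<beta>) x))"
    using *(1) unfolding pac_factor_gaussian[OF assms(2)]
    by (subst integral_std_gaussian_inner(1)[of ?f]) auto
  have "(\<integral>y. ln (pac_factor \<eta> l \<beta> (\<theta> + y /\<^sub>R sqrt \<beta>) x) \<partial>std_gaussian) = (\<integral>g. ?f (norm x * g) \<partial>std_normal)"
    unfolding pac_factor_gaussian[OF assms(2)]
    by (rule integral_std_gaussian_inner(2)) measurable
  then show "psi (\<eta> * ((\<theta> \<bullet> x)\<^sup>2 - l)) \<le> (\<integral>y. ln (pac_factor \<eta> l \<beta> (\<theta> + y /\<^sub>R sqrt \<beta>) x) \<partial>std_gaussian)"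
    using *(2) by simp
qed

lemma integrable_pac_factor: "integrable P (\<lambda>x. pac_factor \<eta> l \<beta> \<theta> x)"
proof -
  have "integrable P (\<lambda>x. (1 - \<eta> * l + l\<^sup>2 / 2) + (\<eta> - l) * ((\<theta> \<bullet> x)\<^sup>2) + (l - \<eta>) / \<beta> * (norm x)\<^sup>2
      + (\<theta> \<bullet> x) ^ 4 / 2 + (c_const - 1) / \<beta> * ((\<theta> \<bullet> x)\<^sup>2 * (norm x)\<^sup>2)
      + (c_const + 1) / (2 * \<beta>\<^sup>2) * norm x ^ 4)"
    using integrable_inner2 integrable_norm2 integrable_inner4 integrable_inner2_norm2 int4
    by (intro Bochner_Integration.integrable_add integrable_mult_right) auto
  moreover have "pac_factor \<eta> l \<beta> \<theta> x = (1 - \<eta> * l + l\<^sup>2 / 2) + (\<eta> - l) * ((\<theta> \<bullet> x)\<^sup>2) + (l - \<eta>) / \<beta> * (norm x)\<^sup>2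
      + (\<theta> \<bullet> x) ^ 4 / 2 + (c_const - 1) / \<beta> * ((\<theta> \<bullet> x)\<^sup>2 * (norm x)\<^sup>2)
      + (c_const + 1) / (2 * \<beta>\<^sup>2) * norm x ^ 4" for x
    unfolding pac_factor_def pac_poly_def divide_inverse
    by (simp add: power2_eq_square power4_eq_xxxx algebra_simps)
  ultimately show ?thesis by simp
qed

text \<open>The factor is positive and its mean over y is a polynomial in x controlled by fourth
  moments, which settles joint integrability. After exchanging the integrals, the moment
  inequalities apply term by term.\<close>

lemma gaussian_pac_excess_le:
  assumes \<eta>: "\<eta>\<^sup>2 = 1" and \<beta>: "0 < \<beta>"
  shows "integrable std_gaussian (\<lambda>y. pac_excess \<eta> l \<beta> (\<theta> + y /\<^sub>R sqrt \<beta>))"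
    and "(\<integral>y. pac_excess \<eta> l \<beta> (\<theta> + y /\<^sub>R sqrt \<beta>) \<partial>std_gaussian) \<le> pac_bound \<eta> l \<beta> \<theta>"
proof -
  interpret G: prob_space "std_gaussian :: (real ^ 'd) measure" by (rule prob_space_std_gaussian)
  interpret PG: pair_sigma_finite P "std_gaussian :: (real ^ 'd) measure" ..
  let ?F = "\<lambda>(x, y). pac_factor \<eta> l \<beta> (\<theta> + y /\<^sub>R sqrt \<beta>) x"
  let ?E = "\<lambda>x. (1 - \<eta> * l + l\<^sup>2 / 2) + (\<eta> - l) * (\<theta> \<bullet> x)\<^sup>2 + (\<theta> \<bullet> x) ^ 4 / 2
        + (2 + c_const) / \<beta> * ((\<theta> \<bullet> x)\<^sup>2 * (norm x)\<^sup>2) + (2 + 3 * c_const) / (2 * \<beta>\<^sup>2) * norm x ^ 4"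
  have Ey: "(\<integral>y. ?F (x, y) \<partial>std_gaussian) = ?E x" for x
  proof -
    have "((\<theta> \<bullet> x)\<^sup>2 - l)\<^sup>2 / 2 = (\<theta> \<bullet> x) ^ 4 / 2 - l * (\<theta> \<bullet> x)\<^sup>2 + l\<^sup>2 / 2"
      by (simp add: power2_diff flip: power_mult)
    then show ?thesis
      using pac_factor_gaussian_mean(2)[OF assms, of l \<theta> x] by (simp add: left_diff_distrib right_diff_distrib)
  qed
  have pos: "0 \<le> pac_factor \<eta> l \<beta> (\<theta> + y /\<^sub>R sqrt \<beta>) x" for x y
    using pac_factor_ge_half[OF assms, of l "\<theta> + y /\<^sub>R sqrt \<beta>" x] by linarith
  have intE: "integrable P ?E"
    using integrable_inner2 integrable_inner4 integrable_inner2_norm2 int4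
    by (intro Bochner_Integration.integrable_add integrable_mult_right) auto
  have int: "integrable (P \<Otimes>\<^sub>M std_gaussian) ?F"
  proof (rule PG.Fubini_integrable)
    show "integrable P (\<lambda>x. \<integral>y. norm (?F (x, y)) \<partial>std_gaussian)"
      using intE Ey by (simp add: pos)
    show "AE x in P. integrable std_gaussian (\<lambda>y. ?F (x, y))"
      using pac_factor_gaussian_mean(1)[OF assms] by simp
  qed measurable
  have "integrable std_gaussian (\<lambda>y. \<integral>x. ?F (x, y) \<partial>P)"
    using PG.integrable_snd[of "\<lambda>x y. ?F (x, y)"] int by simp
  then show "integrable std_gaussian (\<lambda>y. pac_excess \<eta> l \<beta> (\<theta> + y /\<^sub>R sqrt \<beta>))"
    by (simp add: pac_excess_def)
  have "(\<integral>y. pac_excess \<eta> l \<beta> (\<theta> + y /\<^sub>R sqrt \<beta>) \<partial>std_gaussian) = (\<integral>y. \<integral>x. ?F (x, y) \<partial>P \<partial>std_gaussian) - 1"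
    using \<open>integrable std_gaussian (\<lambda>y. \<integral>x. ?F (x, y) \<partial>P)\<close> G.prob_space
    by (simp add: pac_excess_def)
  also have "(\<integral>y. \<integral>x. ?F (x, y) \<partial>P \<partial>std_gaussian) \<le> pac_bound \<eta> l \<beta> \<theta> + 1"
  proof -
    have "(\<integral>y. \<integral>x. ?F (x, y) \<partial>P \<partial>std_gaussian) = (\<integral>x. \<integral>y. ?F (x, y) \<partial>std_gaussian \<partial>P)"
      using PG.Fubini_integral[of "\<lambda>x y. ?F (x, y)"] int by simp
    also have "\<dots> = (\<integral>x. ?E x \<partial>P)" using Ey by simp
    also have "\<dots> = (1 - \<eta> * l + l\<^sup>2 / 2) + (\<eta> - l) * energy P \<theta> + (\<integral>x. (\<theta> \<bullet> x) ^ 4 \<partial>P) / 2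
          + (2 + c_const) / \<beta> * (\<integral>x. (\<theta> \<bullet> x)\<^sup>2 * (norm x)\<^sup>2 \<partial>P) + (2 + 3 * c_const) / (2 * \<beta>\<^sup>2) * s4 P ^ 4"
      using integrable_inner2 integrable_inner4 integrable_inner2_norm2 int4 prob_space
      by (simp add: energy_def s4_power4)
    also have "\<dots> \<le> (1 - \<eta> * l + l\<^sup>2 / 2) + (\<eta> - l) * energy P \<theta> + (kappa P * (energy P \<theta>)\<^sup>2) / 2
          + (2 + c_const) / \<beta> * (sqrt (kappa P) * (s4 P)\<^sup>2 * energy P \<theta>) + (2 + 3 * c_const) / (2 * \<beta>\<^sup>2) * s4 P ^ 4"
    proof -
      have "(2 + c_const) / \<beta> * (\<integral>x. (\<theta> \<bullet> x)\<^sup>2 * (norm x)\<^sup>2 \<partial>P)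
          \<le> (2 + c_const) / \<beta> * (sqrt (kappa P) * (s4 P)\<^sup>2 * energy P \<theta>)"
        using \<beta> c_const_lower by (intro mult_left_mono mixed_moment_le) auto
      moreover have "(\<integral>x. (\<theta> \<bullet> x) ^ 4 \<partial>P) / 2 \<le> kappa P * (energy P \<theta>)\<^sup>2 / 2"
        using fourth_moment_le[of \<theta>] by simp
      ultimately show ?thesis by linarith
    qed
    also have "\<dots> = pac_bound \<eta> l \<beta> \<theta> + 1"
      by (simp add: pac_bound_def algebra_simps add_divide_distrib diff_divide_distrib)
    finally show ?thesis .
  qed
  finally show "(\<integral>y. pac_excess \<eta> l \<beta> (\<theta> + y /\<^sub>R sqrt \<beta>) \<partial>std_gaussian) \<le> pac_bound \<eta> l \<beta> \<theta>" by simp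
qed

text \<open>For fixed y, independence and 1 + R \<le> exp R bound the mean of exp H by 1. Averaging
  over the Gaussian prior preserves this, and Markov's inequality yields the event. The parameter
  \<theta> enters only afterwards, by translating the prior by a = sqrt \<beta> \<theta>; hence one
  event serves all \<theta>, at the entropy cost \<beta> |\<theta>|^2/2.\<close>

lemma pac_bayes:
  fixes M :: "'a measure" and X :: "nat \<Rightarrow> 'a \<Rightarrow> real ^ 'd"
  assumes M: "prob_space M"
    and indep: "prob_space.indep_vars M (\<lambda>_. borel) X {1..n}"
    and law: "\<And>i. i \<in> {1..n} \<Longrightarrow> distr M borel (X i) = P"
    and \<eta>: "\<eta>\<^sup>2 = 1" and \<beta>: "0 < \<beta>" and \<epsilon>: "0 < \<epsilon>"
  shows "\<exists>A\<in>sets M. measure M (space M - A) \<le> \<epsilon> \<and> (\<forall>\<omega>\<in>A. \<forall>\<theta>.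
    (\<Sum>i=1..n. psi (\<eta> * ((\<theta> \<bullet> X i \<omega>)\<^sup>2 - l))) \<le> n * pac_bound \<eta> l \<beta> \<theta> + \<beta> * (norm \<theta>)\<^sup>2 / 2 + ln (1 / \<epsilon>))"
proof -
  interpret M: prob_space M by (rule M)
  interpret G: prob_space "std_gaussian :: (real ^ 'd) measure" by (rule prob_space_std_gaussian)
  interpret MG: pair_sigma_finite M "std_gaussian :: (real ^ 'd) measure" ..
  have X[measurable]: "X i \<in> borel_measurable M" if "i \<in> {1..n}" for i
    using indep that unfolding M.indep_vars_def by auto
  define H where "H = (\<lambda>\<omega> y. (\<Sum>i=1..n. ln (pac_factor \<eta> l \<beta> (y /\<^sub>R sqrt \<beta>) (X i \<omega>)))
    - n * pac_excess \<eta> l \<beta> (y /\<^sub>R sqrt \<beta>))"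
  have [measurable]: "pac_excess \<eta> l \<beta> \<in> borel_measurable borel"
    unfolding pac_excess_def by measurable
  have H[measurable]: "(\<lambda>(\<omega>, y). H \<omega> y) \<in> borel_measurable (M \<Otimes>\<^sub>M std_gaussian)"
    unfolding H_def by measurable
  define W where "W = (\<lambda>\<omega>. \<integral>\<^sup>+y. ennreal (exp (H \<omega> y)) \<partial>std_gaussian)"
  have [measurable]: "W \<in> borel_measurable M" unfolding W_def by measurable
  have inner: "(\<integral>\<^sup>+\<omega>. ennreal (exp (H \<omega> y)) \<partial>M) \<le> 1" for y
  proof -
    define t where "t = y /\<^sub>R sqrt \<beta>"
    define R where "R = pac_excess \<eta> l \<beta> t"
    have F: "1 / 2 \<le> pac_factor \<eta> l \<beta> t x" for x by (rule pac_factor_ge_half[OF \<eta> \<beta>])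
    have Fpos: "0 < pac_factor \<eta> l \<beta> t x" for x using F[of x] by linarith
    have EF: "(\<integral>\<^sup>+x. ennreal (pac_factor \<eta> l \<beta> t x) \<partial>P) = ennreal (1 + R)"
      using integrable_pac_factor Fpos
      by (subst nn_integral_eq_integral) (auto simp: R_def pac_excess_def less_imp_le)
    have "(\<integral>x. 0 \<partial>P) \<le> (\<integral>x. pac_factor \<eta> l \<beta> t x \<partial>P)"
      using integrable_pac_factor Fpos by (intro integral_mono) (auto simp: less_imp_le)
    then have R: "0 \<le> 1 + R" by (simp add: R_def pac_excess_def)
    have "(\<integral>\<^sup>+\<omega>. ennreal (exp (H \<omega> y)) \<partial>M)
        = (\<integral>\<^sup>+\<omega>. ennreal (exp (- (n * R))) * (\<Prod>i\<in>{1..n}. ennreal (pac_factor \<eta> l \<beta> t (X i \<omega>))) \<partial>M)"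
    proof (rule nn_integral_cong)
      fix \<omega>
      have "exp (H \<omega> y) = exp (- (n * R)) * (\<Prod>i\<in>{1..n}. pac_factor \<eta> l \<beta> t (X i \<omega>))"
        using Fpos by (simp add: H_def t_def[symmetric] R_def[symmetric] diff_conv_add_uminus exp_add exp_sum
            mult.commute del: add_uminus_conv_diff)
      then show "ennreal (exp (H \<omega> y))
          = ennreal (exp (- (n * R))) * (\<Prod>i\<in>{1..n}. ennreal (pac_factor \<eta> l \<beta> t (X i \<omega>)))"
        using Fpos by (simp add: ennreal_mult prod_ennreal prod_nonneg less_imp_le)
    qed
    also have "\<dots> = ennreal (exp (- (n * R))) * (\<integral>\<^sup>+\<omega>. (\<Prod>i\<in>{1..n}. ennreal (pac_factor \<eta> l \<beta> t (X i \<omega>))) \<partial>M)"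
      by (rule nn_integral_cmult) measurable
    also have "(\<integral>\<^sup>+\<omega>. (\<Prod>i\<in>{1..n}. ennreal (pac_factor \<eta> l \<beta> t (X i \<omega>))) \<partial>M)
        = (\<Prod>i\<in>{1..n}. \<integral>\<^sup>+\<omega>. ennreal (pac_factor \<eta> l \<beta> t (X i \<omega>)) \<partial>M)"
      by (intro M.indep_vars_nn_integral M.indep_vars_compose2[OF indep]) auto
    also have "\<dots> = (\<Prod>i\<in>{1..n}. \<integral>\<^sup>+x. ennreal (pac_factor \<eta> l \<beta> t x) \<partial>distr M borel (X i))"
      by (intro prod.cong refl nn_integral_distr[symmetric]) auto
    also have "\<dots> = ennreal (1 + R) ^ n" using law EF by simp
    also have "ennreal (exp (- (n * R))) * ennreal (1 + R) ^ n = ennreal ((exp (- R) * (1 + R)) ^ n)"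
      using R by (simp add: ennreal_power power_mult_distrib flip: ennreal_mult exp_of_nat_mult)
    also have "\<dots> \<le> 1"
    proof -
      have "exp (- R) * (1 + R) \<le> exp (- R) * exp R"
        by (intro mult_left_mono exp_ge_add_one_self) simp
      then have "exp (- R) * (1 + R) \<le> 1" by (simp flip: exp_add)
      then show ?thesis using R by (simp add: power_le_one)
    qed
    finally show ?thesis .
  qed
  have "(\<integral>\<^sup>+\<omega>. W \<omega> \<partial>M) = (\<integral>\<^sup>+y. \<integral>\<^sup>+\<omega>. ennreal (exp (H \<omega> y)) \<partial>M \<partial>std_gaussian)"
    unfolding W_def by (rule MG.Fubini'[symmetric]) measurable
  also have "\<dots> \<le> (\<integral>\<^sup>+y. 1 \<partial>(std_gaussian :: (real ^ 'd) measure))" by (intro nn_integral_mono inner)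
  also have "\<dots> = 1" using G.emeasure_space_1 by simp
  finally have EW: "(\<integral>\<^sup>+\<omega>. W \<omega> \<partial>M) \<le> 1" .
  define A where "A = {\<omega> \<in> space M. W \<omega> \<le> ennreal (1 / \<epsilon>)}"
  have A[measurable]: "A \<in> sets M" unfolding A_def by measurable
  have "emeasure M (space M - A) \<le> emeasure M {\<omega> \<in> space M. 1 \<le> ennreal \<epsilon> * W \<omega>}"
  proof (rule emeasure_mono)
    show "space M - A \<subseteq> {\<omega> \<in> space M. 1 \<le> ennreal \<epsilon> * W \<omega>}"
    proof
      fix \<omega> assume w: "\<omega> \<in> space M - A"
      then have "ennreal (1 / \<epsilon>) \<le> W \<omega>" by (auto simp: A_def)
      then have "ennreal \<epsilon> * ennreal (1 / \<epsilon>) \<le> ennreal \<epsilon> * W \<omega>" by (rule mult_left_mono) simp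
      then show "\<omega> \<in> {\<omega> \<in> space M. 1 \<le> ennreal \<epsilon> * W \<omega>}"
        using w \<epsilon> by (simp flip: ennreal_mult)
    qed
  qed measurable
  also have "\<dots> \<le> ennreal \<epsilon> * (\<integral>\<^sup>+\<omega>. W \<omega> * indicator (space M) \<omega> \<partial>M)"
    using nn_integral_Markov_inequality[of W "space M" M "ennreal \<epsilon>"] by simp
  also have "\<dots> \<le> ennreal \<epsilon> * 1"
    using EW by (intro mult_left_mono order.trans[OF _ EW] nn_integral_mono) (auto split: split_indicator)
  finally have "measure M (space M - A) \<le> \<epsilon>"
    using \<epsilon> by (simp add: M.emeasure_eq_measure)
  moreover have "(\<Sum>i=1..n. psi (\<eta> * ((\<theta> \<bullet> X i \<omega>)\<^sup>2 - l)))
      \<le> n * pac_bound \<eta> l \<beta> \<theta> + \<beta> * (norm \<theta>)\<^sup>2 / 2 + ln (1 / \<epsilon>)" if w: "\<omega> \<in> A" for \<omega> \<theta>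
  proof -
    have w': "\<omega> \<in> space M" using w by (simp add: A_def)
    define a where "a = sqrt \<beta> *\<^sub>R \<theta>"
    have a: "(a + y) /\<^sub>R sqrt \<beta> = \<theta> + y /\<^sub>R sqrt \<beta>" for y
      using \<beta> by (simp add: a_def scaleR_add_right)
    note lnF = psi_le_gaussian_ln_pac_factor[OF \<eta> \<beta>, where l = l and \<theta> = \<theta>]
    note R = gaussian_pac_excess_le[OF \<eta> \<beta>, where l = l and \<theta> = \<theta>]
    have int: "integrable std_gaussian (\<lambda>y. H \<omega> (a + y))"
      unfolding H_def a using lnF(1) R(1) by (intro Bochner_Integration.integrable_diff Bochner_Integration.integrable_sum integrable_mult_right)
    have "(\<Sum>i=1..n. psi (\<eta> * ((\<theta> \<bullet> X i \<omega>)\<^sup>2 - l))) - n * pac_bound \<eta> l \<beta> \<theta>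
        \<le> (\<Sum>i=1..n. \<integral>y. ln (pac_factor \<eta> l \<beta> (\<theta> + y /\<^sub>R sqrt \<beta>) (X i \<omega>)) \<partial>std_gaussian)
          - n * (\<integral>y. pac_excess \<eta> l \<beta> (\<theta> + y /\<^sub>R sqrt \<beta>) \<partial>std_gaussian)"
      by (intro diff_mono sum_mono mult_left_mono lnF(2) R(2)) simp
    also have "\<dots> = (\<integral>y. H \<omega> (a + y) \<partial>std_gaussian)"
      unfolding H_def a using lnF(1) R(1) by simp
    also have "\<dots> \<le> ln (1 / \<epsilon>) + (norm a)\<^sup>2 / 2"
    proof (rule gaussian_change_of_measure)
      show "H \<omega> \<in> borel_measurable borel"
        unfolding H_def by measurable
      show "(\<integral>\<^sup>+y. ennreal (exp (H \<omega> y)) \<partial>std_gaussian) \<le> ennreal (1 / \<epsilon>)"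
        using w by (simp add: A_def W_def)
    qed (use \<epsilon> int in simp_all)
    also have "(norm a)\<^sup>2 = \<beta> * (norm \<theta>)\<^sup>2" using \<beta> by (simp add: a_def power_mult_distrib)
    finally show ?thesis by simp
  qed
  ultimately show ?thesis by (intro bexI[OF _ A] conjI ballI allI)
qed

end

section \<open>From the criterion to the energy\<close>

lemma r_crit_mono:
  assumes "0 \<le> \<alpha>" "\<alpha> \<le> \<beta>"
  shows "r_crit n x l (\<alpha> *\<^sub>R \<theta>) \<le> r_crit n x l (\<beta> *\<^sub>R \<theta>)"
proof -
  have "\<alpha>\<^sup>2 \<le> \<beta>\<^sup>2" using assms by (intro power_mono)
  then have "psi ((\<alpha> *\<^sub>R \<theta> \<bullet> x i)\<^sup>2 - l) \<le> psi ((\<beta> *\<^sub>R \<theta> \<bullet> x i)\<^sup>2 - l)" for i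
    by (intro psi_mono diff_right_mono) (simp add: power_mult_distrib mult_right_mono)
  then show ?thesis
    unfolding r_crit_def by (intro mult_left_mono sum_mono) auto
qed

lemma continuous_on_r_crit_ray: "continuous_on A (\<lambda>\<alpha>. r_crit n x l (\<alpha> *\<^sub>R \<theta>))"
  unfolding r_crit_def by (intro continuous_intros)

lemma r_crit_zero_neg: "n \<ge> 1 \<Longrightarrow> 0 < l \<Longrightarrow> r_crit n x l 0 < 0"
  using psi_pos[of l] by (simp add: r_crit_def psi_minus)

lemma alpha_hat_le:
  assumes "0 \<le> \<alpha>" "0 < r_crit n x l (\<alpha> *\<^sub>R \<theta>)"
  shows "alpha_hat n x l \<theta> \<le> ereal \<alpha>"
  unfolding alpha_hat_def
proof (rule Sup_least, safe)
  fix \<beta> assume "0 \<le> \<beta>" "r_crit n x l (\<beta> *\<^sub>R \<theta>) \<le> 0"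
  then show "ereal \<beta> \<le> ereal \<alpha>"
    using r_crit_mono[of \<alpha> \<beta> n x l \<theta>] assms by (cases "\<alpha> \<le> \<beta>") auto
qed

text \<open>By continuity, a positive value at the supremum would allow a smaller upper bound, since
  the criterion is monotone along the ray, and a negative value would allow a larger member. The
  root is not 0 because the criterion is negative there.\<close>

lemma alpha_hat_root:
  assumes "n \<ge> 1" "0 < l" "alpha_hat n x l \<theta> \<noteq> \<infinity>"
  obtains a where "0 < a" "alpha_hat n x l \<theta> = ereal a" "r_crit n x l (a *\<^sub>R \<theta>) = 0"
proof -
  let ?f = "\<lambda>\<alpha>. r_crit n x l (\<alpha> *\<^sub>R \<theta>)"
  let ?S = "{\<alpha>. \<alpha> \<ge> 0 \<and> ?f \<alpha> \<le> 0}"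
  have f0: "?f 0 < 0" using r_crit_zero_neg[OF assms(1,2)] by simp
  then have ge0: "0 \<le> alpha_hat n x l \<theta>"
    unfolding alpha_hat_def by (intro Sup_upper2[of "ereal 0"]) auto
  then obtain a where a: "alpha_hat n x l \<theta> = ereal a" "0 \<le> a"
    using assms(3) by (cases "alpha_hat n x l \<theta>") auto
  have cont: "isCont ?f a"
    using continuous_on_r_crit_ray[of UNIV n x l \<theta>] by (simp add: continuous_on_eq_continuous_at)
  have not_pos: "\<not> 0 < ?f a"
  proof
    assume pos: "0 < ?f a"
    then have "a \<noteq> 0" using f0 by auto
    then have "0 < a" using a by simp
    obtain e where e: "0 < e" "\<forall>y. \<bar>y - a\<bar> < e \<longrightarrow> \<bar>?f y - ?f a\<bar> < ?f a"
      using cont[unfolded continuous_at_eps_delta, rule_format, OF pos] by (auto simp: dist_real_def)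
    define y where "y = max 0 (a - e / 2)"
    have "\<bar>y - a\<bar> < e" using e \<open>0 < a\<close> by (auto simp: y_def)
    then have "0 < ?f y" using e(2) by fastforce
    then have "alpha_hat n x l \<theta> \<le> ereal y" by (intro alpha_hat_le) (auto simp: y_def)
    then have "a \<le> y" using a by simp
    then show False using e \<open>0 < a\<close> by (simp add: y_def max_def split: if_splits)
  qed
  have not_neg: "\<not> ?f a < 0"
  proof
    assume neg: "?f a < 0"
    then have "0 < - ?f a" by simp
    then obtain e where e: "0 < e" "\<forall>y. \<bar>y - a\<bar> < e \<longrightarrow> \<bar>?f y - ?f a\<bar> < - ?f a"
      using cont[unfolded continuous_at_eps_delta, rule_format, of "- ?f a"] by (auto simp: dist_real_def)
    have "\<bar>a + e / 2 - a\<bar> < e" using e by simp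
    then have "?f (a + e / 2) < 0" using e(2) by fastforce
    then have "ereal (a + e / 2) \<le> alpha_hat n x l \<theta>"
      unfolding alpha_hat_def using a e by (intro Sup_upper) auto
    then show False using a e by simp
  qed
  have "?f a = 0" using not_pos not_neg by simp
  moreover have "0 < a" using calculation f0 a by (cases "a = 0") auto
  ultimately show ?thesis using a that by blast
qed

text \<open>A convex parabola that is nonpositive at s0 = g / (m - g) and negative at 1 is negative
  on ]s0, 1]. The point s0 serves as an explicit upper bound for the first zero and is the relative
  loss used in the confidence bounds.\<close>

lemma convex_quadratic_neg:
  fixes \<xi> m g s :: real
  assumes "0 \<le> \<xi>" "0 \<le> g" "\<xi> + 2 * g < m" "g / (m - g) < s" "s \<le> 1"
  shows "\<xi> * s\<^sup>2 - m * s + g < 0"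
proof -
  define s0 where "s0 = g / (m - g)"
  have mg: "0 < m - g" using assms by linarith
  have s0: "s0 * (m - g) = g" using mg by (simp add: s0_def)
  have lt: "s0 < s" "s0 < 1" using assms by (auto simp: s0_def)
  define p where "p = (\<lambda>s. \<xi> * s\<^sup>2 - m * s + g)"
  have p1: "p 1 < 0" using assms by (simp add: p_def)
  have "p s0 = \<xi> * s0\<^sup>2 - s0 * g" using s0 by (simp add: p_def algebra_simps)
  also have "s0 * g = s0\<^sup>2 * (m - g)" using s0 by (simp add: power2_eq_square mult.assoc)
  also have "\<xi> * s0\<^sup>2 - s0\<^sup>2 * (m - g) = s0\<^sup>2 * (\<xi> - (m - g))" by (simp add: algebra_simps)
  also have "\<dots> \<le> 0" using assms by (intro mult_nonneg_nonpos) auto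
  finally have ps0: "p s0 \<le> 0" .
  have "(1 - s0) * p s = (1 - s) * p s0 + (s - s0) * p 1 - \<xi> * ((1 - s) * (s - s0) * (1 - s0))"
    by (simp add: p_def power2_eq_square algebra_simps)
  moreover have "(1 - s) * p s0 \<le> 0" using ps0 assms by (simp add: mult_nonneg_nonpos)
  moreover have "(s - s0) * p 1 < 0" using p1 lt by (simp add: mult_pos_neg)
  moreover have "0 \<le> \<xi> * ((1 - s) * (s - s0) * (1 - s0))" using assms lt by simp
  ultimately have "(1 - s0) * p s < 0" by linarith
  then show ?thesis using lt by (simp add: mult_less_0_iff p_def)
qed

section \<open>Confidence bounds from bounds on the criterion\<close>

lemma energy_scaleR: "energy P (a *\<^sub>R \<theta>) = a\<^sup>2 * energy P \<theta>"
  by (simp add: energy_def power_mult_distrib)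

text \<open>The PAC-Bayesian bound as a quadratic in the relative deviation t = N / l - 1, with
  \<open>xi\<close>, \<open>mu\<close>, \<open>gam\<close> and \<open>delta_param\<close> as
  coefficients; \<open>r_lower\<close> is its counterpart for the opposite sign.\<close>

definition r_upper :: "(real ^ 'd) measure \<Rightarrow> nat \<Rightarrow> real \<Rightarrow> real \<Rightarrow> real \<Rightarrow> real ^ 'd \<Rightarrow> real" where
  "r_upper P n \<epsilon> l b \<theta> = (let t = energy P \<theta> / l - 1 in
     l * (xi P l * t\<^sup>2 + (1 + mu P l b) * t + gam P n \<epsilon> l b + delta_param n l b * (norm \<theta>)\<^sup>2))"

definition r_lower :: "(real ^ 'd) measure \<Rightarrow> nat \<Rightarrow> real \<Rightarrow> real \<Rightarrow> real \<Rightarrow> real ^ 'd \<Rightarrow> real" where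
  "r_lower P n \<epsilon> l b \<theta> = (let t = energy P \<theta> / l - 1 in
     - l * (xi P l * t\<^sup>2 - (1 - mu P l b) * t + gam P n \<epsilon> l b + delta_param n l b * (norm \<theta>)\<^sup>2))"

lemma N_tilde_nonneg: "0 < l \<Longrightarrow> 0 \<le> N_tilde n x l \<theta>"
  by (simp add: N_tilde_def)

context
  fixes P :: "(real ^ 'd) measure" and n :: nat and \<epsilon> l b :: real and x :: "nat \<Rightarrow> real ^ 'd"
  assumes n: "n \<ge> 1" and l: "0 < l" and b: "0 < b"
    and nonneg: "0 \<le> xi P l" "0 \<le> mu P l b" "0 \<le> gam P n \<epsilon> l b"
begin

text \<open>At the root a of the criterion \<open>r_upper\<close> is nonnegative, and N(a \<theta>)
  / l = N / u there. Hence s = 1 - N / u satisfies a quadratic inequality, and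
  \<open>convex_quadratic_neg\<close> keeps s below the loss of \<open>Phi_minus\<close>.\<close>

lemma Phi_minus_le_energy:
  assumes upper: "\<And>\<theta>. r_crit n x l \<theta> \<le> r_upper P n \<epsilon> l b \<theta>" and \<theta>: "norm \<theta> = 1"
  shows "Phi_minus P n \<epsilon> l b (N_tilde n x l \<theta>) \<le> energy P \<theta>"
proof (cases "alpha_hat n x l \<theta> = \<infinity>")
  case True
  then show ?thesis by (simp add: N_tilde_def Phi_minus_def energy_def)
next
  case False
  obtain a where a: "0 < a" "alpha_hat n x l \<theta> = ereal a" "r_crit n x l (a *\<^sub>R \<theta>) = 0"
    using alpha_hat_root[OF n l False] by blast
  define N where "N = energy P \<theta>"
  define u where "u = N_tilde n x l \<theta>"
  have u: "u = l / a\<^sup>2" "0 < u" using a l by (simp_all add: u_def N_tilde_def)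
  have N: "0 \<le> N" by (simp add: N_def energy_def)
  define \<tau> where "\<tau> = delta_param n l b * l / u"
  have \<tau>: "\<tau> = delta_param n l b * a\<^sup>2" using u a l by (simp add: \<tau>_def field_simps)
  have \<tau>0: "0 \<le> \<tau>" using n l b by (simp add: \<tau> delta_param_def)
  define \<xi> \<mu> \<gamma> where "\<xi> = xi P l" and "\<mu> = mu P l b" and "\<gamma> = gam P n \<epsilon> l b"
  show ?thesis
  proof (cases "\<xi> - \<mu> + 2 * \<gamma> + 2 * \<tau> < 1")
    case True
    define g where "g = \<gamma> + \<tau>"
    define s where "s = 1 - N / u"
    have "0 \<le> l * (\<xi> * (N / u - 1)\<^sup>2 + (1 + \<mu>) * (N / u - 1) + \<gamma> + \<tau>)"
      using upper[of "a *\<^sub>R \<theta>"] a \<theta> l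
      by (simp add: r_upper_def energy_scaleR Let_def N_def u(1) \<xi>_def \<mu>_def \<gamma>_def \<tau> mult.commute)
    then have "0 \<le> \<xi> * (N / u - 1)\<^sup>2 + (1 + \<mu>) * (N / u - 1) + \<gamma> + \<tau>"
      using l by (simp only: zero_le_mult_iff) linarith
    also have "\<dots> = \<xi> * s\<^sup>2 - (1 + \<mu>) * s + g"
      by (simp add: s_def g_def power2_eq_square algebra_simps)
    finally have "0 \<le> \<xi> * s\<^sup>2 - (1 + \<mu>) * s + g" .
    moreover have "s \<le> 1" using divide_nonneg_pos[OF N u(2)] by (simp add: s_def)
    ultimately have "s \<le> g / (1 + \<mu> - g)"
      using convex_quadratic_neg[of \<xi> g "1 + \<mu>" s] nonneg \<tau>0 True
      by (auto simp: \<xi>_def \<mu>_def \<gamma>_def g_def not_less[symmetric])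
    then have "u * (1 - g / (1 + \<mu> - g)) \<le> u * (N / u)"
      using u by (intro mult_left_mono) (auto simp: s_def)
    then have "u * (1 - g / (1 + \<mu> - g)) \<le> N" using u(2) by simp
    then show ?thesis using True u(2)
      by (simp add: Phi_minus_def Let_def u_def[symmetric] \<tau>_def[symmetric] \<xi>_def[symmetric]
          \<mu>_def[symmetric] \<gamma>_def[symmetric] N_def[symmetric] g_def diff_diff_eq)
  next
    case False
    then show ?thesis using N
      by (simp add: Phi_minus_def Let_def u_def[symmetric] \<tau>_def[symmetric] \<xi>_def[symmetric]
          \<mu>_def[symmetric] \<gamma>_def[symmetric] N_def[symmetric])
  qed
qed

text \<open>The scale \<alpha> is chosen with N(\<alpha> \<theta>) = l (1 + t), where t is the loss
  of \<open>Phi_plus\<close>. There \<open>r_lower\<close> is positive, so the criterion has already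
  crossed 0 and \<open>N_tilde\<close> is at least l / \<alpha>^2 = N / (1 + t).\<close>

lemma Phi_plus_energy_le:
  assumes lower: "\<And>\<theta>. r_lower P n \<epsilon> l b \<theta> \<le> r_crit n x l \<theta>" and \<theta>: "norm \<theta> = 1"
  shows "Phi_plus P n \<epsilon> l b (energy P \<theta>) \<le> N_tilde n x l \<theta>"
proof -
  define N where "N = energy P \<theta>"
  define \<tau> where "\<tau> = delta_param n l b * l / N"
  define \<xi> \<mu> \<gamma> where "\<xi> = xi P l" and "\<mu> = mu P l b" and "\<gamma> = gam P n \<epsilon> l b"
  show ?thesis
  proof (cases "N > 0 \<and> \<xi> + \<mu> + \<gamma> + 2 * \<tau> < 1")
    case True
    then have N: "0 < N" and less: "\<xi> + \<mu> + \<gamma> + 2 * \<tau> < 1" by auto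
    have \<tau>0: "0 < \<tau>" using n l b N by (simp add: \<tau>_def delta_param_def)
    \<comment> \<open>\<open>m\<close> absorbs a second \<tau>: the penalty at \<alpha> \<theta> is
      \<tau> (1 + t) and so grows with the scale. This explains the 2 \<tau> in
      \<open>Phi_plus\<close>.\<close>
    define g m where "g = \<gamma> + \<tau>" and "m = 1 - \<mu> - \<tau>"
    define t where "t = g / (1 - \<mu> - \<gamma> - 2 * \<tau>)"
    have mg: "\<xi> < m - g" "0 < m - g" using less nonneg by (auto simp: m_def g_def \<xi>_def)
    have mg': "1 - \<mu> - \<gamma> - 2 * \<tau> = m - g" by (simp add: m_def g_def)
    have g0: "0 < g" using \<tau>0 nonneg by (simp add: g_def \<gamma>_def)
    have t: "0 < t" "t * (m - g) = g" using mg g0 unfolding t_def mg' by auto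
    define \<alpha> where "\<alpha> = sqrt (l * (1 + t) / N)"
    have \<alpha>: "0 < \<alpha>" "\<alpha>\<^sup>2 = l * (1 + t) / N" using t l N by (auto simp: \<alpha>_def)
    have q: "\<xi> * t\<^sup>2 - (1 - \<mu>) * t + \<gamma> + \<tau> * (1 + t) = - (t\<^sup>2 * ((m - g) - \<xi>))"
    proof -
      have "\<xi> * t\<^sup>2 - (1 - \<mu>) * t + \<gamma> + \<tau> * (1 + t) = \<xi> * t\<^sup>2 - m * t + g"
        by (simp add: m_def g_def algebra_simps)
      also have "m * t = t\<^sup>2 * (m - g) + g"
      proof -
        have "t\<^sup>2 * (m - g) = t * g" using t by (simp add: power2_eq_square mult.assoc)
        then show ?thesis using t by (simp add: algebra_simps)
      qed
      finally show ?thesis by (simp add: algebra_simps)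
    qed
    have E: "\<alpha>\<^sup>2 * N / l - 1 = t" "delta_param n l b * \<alpha>\<^sup>2 = \<tau> * (1 + t)"
      using N l by (auto simp: \<alpha>(2) \<tau>_def field_simps)
    have "r_lower P n \<epsilon> l b (\<alpha> *\<^sub>R \<theta>) = - l * (\<xi> * t\<^sup>2 - (1 - \<mu>) * t + \<gamma> + \<tau> * (1 + t))"
      using E \<theta> \<alpha>(1)
      by (simp add: r_lower_def energy_scaleR Let_def N_def \<xi>_def \<mu>_def \<gamma>_def mult.commute)
    also have "\<dots> = l * (t\<^sup>2 * ((m - g) - \<xi>))" unfolding q by simp
    also have "\<dots> > 0" using l t mg by simp
    finally have "0 < r_crit n x l (\<alpha> *\<^sub>R \<theta>)" using lower[of "\<alpha> *\<^sub>R \<theta>"] by linarith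
    then have le: "alpha_hat n x l \<theta> \<le> ereal \<alpha>" using \<alpha> by (intro alpha_hat_le) auto
    then obtain a where a: "0 < a" "alpha_hat n x l \<theta> = ereal a"
      using alpha_hat_root[OF n l, of x \<theta>] by (cases "alpha_hat n x l \<theta> = \<infinity>") auto
    have "a\<^sup>2 \<le> \<alpha>\<^sup>2" using le a by (intro power_mono) auto
    then have "l / \<alpha>\<^sup>2 \<le> l / a\<^sup>2" using a l \<alpha>(1) by (intro divide_left_mono) auto
    also have "l / \<alpha>\<^sup>2 = N * inverse (1 + t)"
      unfolding \<alpha>(2) using l by simp (simp add: divide_inverse)
    also have "l / a\<^sup>2 = N_tilde n x l \<theta>" using a by (simp add: N_tilde_def)
    finally show ?thesis using True
      by (simp add: Phi_plus_def Let_def \<tau>_def[symmetric] \<xi>_def[symmetric]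
          \<mu>_def[symmetric] \<gamma>_def[symmetric] N_def[symmetric] g_def t_def)
  next
    case False
    then show ?thesis using N_tilde_nonneg[OF l, of n x \<theta>]
      by (auto simp: Phi_plus_def Let_def \<tau>_def[symmetric] \<xi>_def[symmetric]
          \<mu>_def[symmetric] \<gamma>_def[symmetric] N_def[symmetric])
  qed
qed

text \<open>The lower bound at \<open>Phi_plus t\<close> composes the losses \<open>(1 - 3w)/(1 - 2w)\<close> of \<open>Phi_plus\<close> and
  \<open>(1 - w)(1 - 4w)/(1 - 4w + 2w\<^sup>2)\<close> of \<open>Phi_minus\<close>.\<close>

lemma Phi_minus_ge:
  assumes small: "mu P l b \<le> 2 * gam P n \<epsilon> l b" "xi P l \<le> 3 * gam P n \<epsilon> l b" "xi P l - mu P l b \<le> gam P n \<epsilon> l b"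
    and w: "0 < w" "w \<le> 1 / 7" "gam P n \<epsilon> l b + delta_param n l b * l / t \<le> w"
    and t: "0 < t" and u: "Phi_plus P n \<epsilon> l b t \<le> u"
  shows "t * ((1 - 4 * w) / (1 - 2 * w)) \<le> Phi_minus P n \<epsilon> l b u"
proof -
  define \<xi> \<mu> \<gamma> where "\<xi> = xi P l" and "\<mu> = mu P l b" and "\<gamma> = gam P n \<epsilon> l b"
  define d where "d = delta_param n l b * l"
  have d: "0 \<le> d" using n l b by (simp add: d_def delta_param_def)
  define \<tau> where "\<tau> = d / t"
  have \<tau>: "0 \<le> \<tau>" "\<gamma> + \<tau> \<le> w" using d t w by (auto simp: \<tau>_def d_def \<gamma>_def)
  have small': "\<mu> \<le> 2 * \<gamma>" "\<xi> \<le> 3 * \<gamma>" "\<xi> - \<mu> \<le> \<gamma>" "0 \<le> \<mu>" "0 \<le> \<gamma>"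
    using small nonneg by (auto simp: \<xi>_def \<mu>_def \<gamma>_def)
  define u1 where "u1 = t * ((1 - 3 * w) / (1 - 2 * w))"
  have "u1 \<le> Phi_plus P n \<epsilon> l b t"
  proof -
    have cond: "\<xi> + \<mu> + \<gamma> + 2 * \<tau> < 1" using small' \<tau> w by linarith
    have "(\<gamma> + \<tau>) / (1 - \<mu> - \<gamma> - 2 * \<tau>) \<le> w / (1 - 3 * w)"
      using small' \<tau> w by (intro frac_le) auto
    then have "1 + (\<gamma> + \<tau>) / (1 - \<mu> - \<gamma> - 2 * \<tau>) \<le> (1 - 2 * w) / (1 - 3 * w)"
      using w by (simp add: field_simps)
    moreover have "0 \<le> (\<gamma> + \<tau>) / (1 - \<mu> - \<gamma> - 2 * \<tau>)" using small' \<tau> w by (intro divide_nonneg_nonneg) auto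
    ultimately have "inverse ((1 - 2 * w) / (1 - 3 * w)) \<le> inverse (1 + (\<gamma> + \<tau>) / (1 - \<mu> - \<gamma> - 2 * \<tau>))"
      by (intro le_imp_inverse_le) auto
    then have "u1 \<le> t * inverse (1 + (\<gamma> + \<tau>) / (1 - \<mu> - \<gamma> - 2 * \<tau>))"
      unfolding u1_def using t by (intro mult_left_mono) auto
    then show ?thesis using cond t
      by (simp add: Phi_plus_def Let_def d_def[symmetric] \<tau>_def[symmetric] \<xi>_def[symmetric]
          \<mu>_def[symmetric] \<gamma>_def[symmetric])
  qed
  then have u1: "u1 \<le> u" "0 < u1" using u t w by (auto simp: u1_def)
  \<comment> \<open>\<open>G\<close> bounds \<gamma> + \<tau>': passing from t down to u1 inflates
    the penalty by the factor (1 - 2w) / (1 - 3w).\<close>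
  define G where "G = w * (1 - 2 * w) / (1 - 3 * w)"
  define \<tau>' where "\<tau>' = d / u"
  have \<tau>'0: "0 \<le> \<tau>'" using d u1 by (simp add: \<tau>'_def)
  have r: "1 \<le> (1 - 2 * w) / (1 - 3 * w)" using w by simp
  have "\<gamma> + \<tau>' \<le> G"
  proof -
    have "\<tau>' \<le> d / u1" unfolding \<tau>'_def using d u1 by (intro divide_left_mono) auto
    also have "\<dots> = \<tau> * ((1 - 2 * w) / (1 - 3 * w))" using t w by (simp add: u1_def \<tau>_def field_simps)
    finally have "\<gamma> + \<tau>' \<le> \<gamma> * ((1 - 2 * w) / (1 - 3 * w)) + \<tau> * ((1 - 2 * w) / (1 - 3 * w))"
      using mult_left_mono[OF r, of \<gamma>] small' by linarith
    also have "\<dots> = (\<gamma> + \<tau>) * ((1 - 2 * w) / (1 - 3 * w))" by (simp only: distrib_right)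
    also have "\<dots> \<le> w * ((1 - 2 * w) / (1 - 3 * w))" using \<tau> r by (intro mult_right_mono) auto
    finally show ?thesis by (simp add: G_def)
  qed
  have G: "0 < G" "G \<le> 1 / 4"
  proof -
    show "0 < G" using w by (simp add: G_def)
    have "w * (1 - 2 * w) \<le> w * 1" using w by (intro mult_left_mono) auto
    also have "w * 1 \<le> (1 - 3 * w) / 4" using w by simp
    finally show "G \<le> 1 / 4" using w by (simp add: G_def field_simps)
  qed
  have cond: "\<xi> - \<mu> + 2 * \<gamma> + 2 * \<tau>' < 1" using small' \<open>\<gamma> + \<tau>' \<le> G\<close> G \<tau> w by linarith
  have "t * ((1 - 4 * w) / (1 - 2 * w)) \<le> u1 * ((1 - 2 * G) / (1 - G))"
  proof -
    have den: "0 < 1 - 4 * w + 2 * w\<^sup>2" using w by (simp add: add_pos_nonneg)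
    have e1: "1 - 2 * G = (1 - w) * (1 - 4 * w) / (1 - 3 * w)"
      using w by (simp add: G_def field_simps power2_eq_square)
    have e2: "1 - G = (1 - 4 * w + 2 * w\<^sup>2) / (1 - 3 * w)"
      using w by (simp add: G_def field_simps power2_eq_square)
    have "(1 - 4 * w) / (1 - 2 * w) * 1 \<le> (1 - 4 * w) / (1 - 2 * w) * ((1 - 3 * w) * (1 - w) / (1 - 4 * w + 2 * w\<^sup>2))"
      using w den by (intro mult_left_mono) (auto simp: power2_eq_square algebra_simps)
    also have "\<dots> = (1 - 3 * w) / (1 - 2 * w) * ((1 - 2 * G) / (1 - G))"
      unfolding e1 e2 using w den by simp
    finally show ?thesis unfolding u1_def mult.assoc using t by (intro mult_left_mono) auto
  qed
  also have "\<dots> \<le> u * ((1 - 2 * G) / (1 - G))"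
    using u1 G by (intro mult_right_mono) auto
  also have "\<dots> = u * (1 - G / (1 - G))" using G by (simp add: field_simps)
  also have "\<dots> \<le> u * (1 - (\<gamma> + \<tau>') / (1 + \<mu> - \<gamma> - \<tau>'))"
  proof -
    have "(\<gamma> + \<tau>') / (1 + \<mu> - \<gamma> - \<tau>') \<le> G / (1 - G)"
      using \<open>\<gamma> + \<tau>' \<le> G\<close> G small' \<tau>'0 by (intro frac_le) auto
    then show ?thesis using u1 by (intro mult_left_mono) auto
  qed
  also have "\<dots> = Phi_minus P n \<epsilon> l b u"
    using cond u1
    by (simp add: Phi_minus_def Let_def d_def[symmetric] \<tau>'_def[symmetric] \<xi>_def[symmetric]
        \<mu>_def[symmetric] \<gamma>_def[symmetric])
  finally show ?thesis .
qed

text \<open>S + 2 S w / (1 - 4w) equals S (1 - 2w) / (1 - 4w), the inverse of the composed loss in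
  \<open>Phi_minus_ge\<close>. A point of the interval beyond it would push \<open>Phi_minus\<close>
  above S.\<close>

lemma confidence_interval_width:
  assumes small: "mu P l b \<le> 2 * gam P n \<epsilon> l b" "xi P l \<le> 3 * gam P n \<epsilon> l b" "xi P l - mu P l b \<le> gam P n \<epsilon> l b"
    and w: "0 < w" "w \<le> 1 / 8" "gam P n \<epsilon> l b + delta_param n l b * l / S \<le> w"
    and S: "0 < S"
  shows "Phi_minus P n \<epsilon> l b u \<le> S \<Longrightarrow> ereal q \<le> Phi_plus_inv P n \<epsilon> l b u \<Longrightarrow> q \<le> S + 2 * S * (w / (1 - 4 * w))"
    and "Phi_minus P n \<epsilon> l b u \<le> q \<Longrightarrow> ereal S \<le> Phi_plus_inv P n \<epsilon> l b u \<Longrightarrow> S - 2 * S * (w / (1 - 4 * w)) \<le> q"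
proof -
  define \<gamma> d where "\<gamma> = gam P n \<epsilon> l b" and "d = delta_param n l b * l"
  have d: "0 \<le> d" using n l b by (simp add: d_def delta_param_def)
  have \<gamma>: "0 \<le> \<gamma>" using nonneg by (simp add: \<gamma>_def)
  show "q \<le> S + 2 * S * (w / (1 - 4 * w))"
    if u: "Phi_minus P n \<epsilon> l b u \<le> S" and q: "ereal q \<le> Phi_plus_inv P n \<epsilon> l b u"
  proof (rule ccontr)
    assume "\<not> ?thesis"
    then have less: "S + 2 * S * (w / (1 - 4 * w)) < q" by simp
    then have "ereal (S + 2 * S * (w / (1 - 4 * w))) < Phi_plus_inv P n \<epsilon> l b u"
      using q by (meson ereal_less(1) less_le_trans less_ereal.simps(1))
    then obtain t where t: "S + 2 * S * (w / (1 - 4 * w)) < t" "Phi_plus P n \<epsilon> l b t \<le> u"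
      unfolding Phi_plus_inv_def less_Sup_iff by auto
    have "0 \<le> 2 * S * (w / (1 - 4 * w))" using S w by simp
    then have "S \<le> t" using t by linarith
    then have "d / t \<le> d / S" using S d by (intro divide_left_mono) auto
    then have "t * ((1 - 4 * w) / (1 - 2 * w)) \<le> Phi_minus P n \<epsilon> l b u"
      using w S \<open>S \<le> t\<close> t by (intro Phi_minus_ge small) (auto simp: d_def[symmetric])
    then have le: "t * ((1 - 4 * w) / (1 - 2 * w)) \<le> S" using u by linarith
    have "S + 2 * S * (w / (1 - 4 * w)) = S * ((1 - 2 * w) / (1 - 4 * w))"
      using w by (simp add: field_simps)
    then have "S = (S + 2 * S * (w / (1 - 4 * w))) * ((1 - 4 * w) / (1 - 2 * w))"
      using w by simp
    also have "\<dots> < t * ((1 - 4 * w) / (1 - 2 * w))"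
      using t w by (intro mult_strict_right_mono) auto
    finally show False using le by simp
  qed
  show "S - 2 * S * (w / (1 - 4 * w)) \<le> q"
    if u: "Phi_minus P n \<epsilon> l b u \<le> q" and q: "ereal S \<le> Phi_plus_inv P n \<epsilon> l b u"
  proof -
    \<comment> \<open>The supremum in \<open>Phi_plus_inv\<close> need not be attained, so t is only
      known to exceed S (1 - w^2). This replaces w by v = w / (1 - w^2) \<le> 8/63, which is why
      \<open>Phi_minus_ge\<close> reaches up to 1/7; a gain of order w^2 in the final inequality
      absorbs the change.\<close>
    have w2: "w\<^sup>2 \<le> 1 / 64" "0 < w\<^sup>2" using power_mono[of w "1 / 8" 2] w by (auto simp: power_divide)
    have "S * (1 - w\<^sup>2) < S" using S w2 by (simp add: algebra_simps)
    then have "ereal (S * (1 - w\<^sup>2)) < Phi_plus_inv P n \<epsilon> l b u"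
      using q by (meson less_le_trans less_ereal.simps(1))
    then obtain t where t: "S * (1 - w\<^sup>2) < t" "Phi_plus P n \<epsilon> l b t \<le> u"
      unfolding Phi_plus_inv_def less_Sup_iff by auto
    have t0: "0 < S * (1 - w\<^sup>2)" using S w2 by simp
    define v where "v = w / (1 - w\<^sup>2)"
    have v: "0 < v" "v \<le> 1 / 7" using w w2 by (auto simp: v_def field_simps)
    have "\<gamma> + d / t \<le> \<gamma> / (1 - w\<^sup>2) + d / S / (1 - w\<^sup>2)"
    proof (rule add_mono)
      show "\<gamma> \<le> \<gamma> / (1 - w\<^sup>2)" using \<gamma> w2 by (simp add: field_simps)
      have "d / t \<le> d / (S * (1 - w\<^sup>2))" using t t0 d by (intro divide_left_mono) auto
      then show "d / t \<le> d / S / (1 - w\<^sup>2)" by simp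
    qed
    also have "\<dots> = (\<gamma> + d / S) / (1 - w\<^sup>2)" by (simp only: add_divide_distrib)
    also have "\<dots> \<le> v" unfolding v_def using w w2 by (intro divide_right_mono) (auto simp: d_def \<gamma>_def)
    finally have "t * ((1 - 4 * v) / (1 - 2 * v)) \<le> Phi_minus P n \<epsilon> l b u"
      using v t t0 by (intro Phi_minus_ge small) (auto simp: d_def \<gamma>_def)
    then have "t * ((1 - 4 * v) / (1 - 2 * v)) \<le> q" using u by linarith
    moreover have "S * (1 - w\<^sup>2) * ((1 - 4 * v) / (1 - 2 * v)) \<le> t * ((1 - 4 * v) / (1 - 2 * v))"
      using t v by (intro mult_right_mono) auto
    moreover have "S - 2 * S * (w / (1 - 4 * w)) \<le> S * (1 - w\<^sup>2) * ((1 - 4 * v) / (1 - 2 * v))"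
    proof -
      have vw: "(1 - 4 * v) / (1 - 2 * v) = (1 - w\<^sup>2 - 4 * w) / (1 - w\<^sup>2 - 2 * w)"
      proof -
        have "1 - 4 * v = (1 - w\<^sup>2 - 4 * w) / (1 - w\<^sup>2)" "1 - 2 * v = (1 - w\<^sup>2 - 2 * w) / (1 - w\<^sup>2)"
          using w2 by (simp_all add: v_def diff_divide_distrib)
        then show ?thesis using w2 by simp
      qed
      have pos: "0 < 1 - w\<^sup>2 - 2 * w" "0 < 1 - 4 * w" using w w2 by auto
      have poly: "(1 - 6 * w) * (1 - w\<^sup>2 - 2 * w) \<le> (1 - w\<^sup>2) * (1 - w\<^sup>2 - 4 * w) * (1 - 4 * w)"
      proof -
        have "(1 - w\<^sup>2) * (1 - w\<^sup>2 - 4 * w) * (1 - 4 * w) - (1 - 6 * w) * (1 - w\<^sup>2 - 2 * w)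
            = w\<^sup>2 * (3 + 6 * w - 15 * w\<^sup>2 - 4 * (w * w\<^sup>2))"
          by (simp add: power2_eq_square algebra_simps)
        moreover have "w * w\<^sup>2 \<le> 1 * (1 / 64)" using w w2 by (intro mult_mono) auto
        then have "0 \<le> w\<^sup>2 * (3 + 6 * w - 15 * w\<^sup>2 - 4 * (w * w\<^sup>2))" using w w2 by (intro mult_nonneg_nonneg) auto
        ultimately show ?thesis by linarith
      qed
      have "(1 - 6 * w) / (1 - 4 * w) \<le> (1 - w\<^sup>2) * (1 - w\<^sup>2 - 4 * w) / (1 - w\<^sup>2 - 2 * w)"
        using poly pos by (simp add: divide_le_eq le_divide_eq mult.commute mult.left_commute)
      then have "S * ((1 - 6 * w) / (1 - 4 * w)) \<le> S * ((1 - w\<^sup>2) * ((1 - 4 * v) / (1 - 2 * v)))"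
        unfolding vw using S by (intro mult_left_mono) auto
      moreover have "S - 2 * S * (w / (1 - 4 * w)) = S * ((1 - 6 * w) / (1 - 4 * w))"
        using pos by (simp add: field_simps)
      ultimately show ?thesis by (simp add: mult.assoc)
    qed
    ultimately show ?thesis by linarith
  qed
qed

end

section \<open>The Gram matrix\<close>

text \<open>The ratio \<open>r\<close> measures how far \<open>lam\<close> is from the minimiser of the left-hand side; on the grid
  \<open>r\<close> stays within \<open>exp (\<plusminus> 1/4)\<close> for \<open>\<lambda>\<close> and \<open>exp (\<plusminus> 1/2)\<close> for \<open>\<beta>\<close>, which yields 2.032 and 98.5.\<close>

lemma sqrt_add_inverse_le:
  fixes A B C V lam :: real
  assumes "0 < A" "0 < V" "0 < lam" "lam\<^sup>2 * A = r * V" "0 < r" "r + inverse r \<le> C - 2"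
  shows "lam * A + V / lam \<le> sqrt (C * (A * V))"
proof (rule real_le_rsqrt)
  have lam2: "lam\<^sup>2 = r * V / A" using assms by (simp add: field_simps)
  have "(lam * A + V / lam)\<^sup>2 = lam\<^sup>2 * A\<^sup>2 + V\<^sup>2 / lam\<^sup>2 + 2 * (A * V)"
    using assms by (simp add: power2_sum power_mult_distrib power_divide)
  also have "\<dots> = A * V * (r + inverse r + 2)"
    unfolding lam2 using assms by (simp add: field_simps power2_eq_square)
  also have "\<dots> \<le> A * V * C" using assms by (intro mult_left_mono) auto
  finally show "(lam * A + V / lam)\<^sup>2 \<le> C * (A * V)" by (simp add: mult.commute)
qed

lemma add_inverse_le_exp:
  fixes r c :: real
  assumes "exp (- c) \<le> r" "r \<le> exp c"
  shows "r + inverse r \<le> exp c + exp (- c)"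
proof -
  have r: "0 < r" using assms(1) exp_gt_zero[of "- c"] by linarith
  have "0 \<le> (exp c - r) * (r - exp (- c))" using assms by simp
  also have "\<dots> = r * (exp c + exp (- c)) - r\<^sup>2 - 1"
    by (simp add: power2_eq_square algebra_simps flip: exp_add)
  finally have "r\<^sup>2 + 1 \<le> r * (exp c + exp (- c))" by simp
  then have "(r\<^sup>2 + 1) / r \<le> exp c + exp (- c)" using r by (simp add: pos_divide_le_eq mult.commute)
  then show ?thesis using r by (simp add: power2_eq_square add_divide_distrib inverse_eq_divide)
qed

text \<open>Rounds an ideal real index to the grid; the margin 1/2 below X keeps the rounded value
  inside.\<close>

lemma abs_round_index:
  fixes v X :: real
  assumes "0 \<le> v" "v + 1 / 2 \<le> X"
  obtains j :: int where "0 \<le> j" "j \<le> \<lceil>X\<rceil>" "\<bar>v - j\<bar> \<le> 1 / 2"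
proof
  show "0 \<le> round v" using assms by (simp add: round_def)
  show "round v \<le> \<lceil>X\<rceil>" unfolding round_def using assms by linarith
  show "\<bar>v - round v\<bar> \<le> 1 / 2" using of_int_round_abs_le[of v] by (simp add: abs_minus_commute)
qed

section \<open>Trace and quadratic form of the Gram matrix\<close>

lemma norm2_eq_sum_axis: "(norm x)\<^sup>2 = (\<Sum>i\<in>UNIV. (axis i 1 \<bullet> (x :: real ^ 'd))\<^sup>2)"
  unfolding power2_norm_eq_inner inner_axis' by (simp add: inner_vec_def power2_eq_square)

context kurtosis_law
begin

definition second_moment :: real where "second_moment = (\<integral>x. (norm x)\<^sup>2 \<partial>P)"

lemma trace_gram: "trace (gram P) = second_moment"
proof -
  have int: "integrable P (\<lambda>x. x $ i * x $ i)" for i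
    using integrable_inner2[of "axis i 1"] by (simp add: inner_axis' power2_eq_square)
  have "second_moment = (\<integral>x. (\<Sum>i\<in>UNIV. x $ i * x $ i) \<partial>P)"
    unfolding second_moment_def by (simp add: power2_norm_eq_inner inner_vec_def)
  also have "\<dots> = trace (gram P)"
    using int by (simp add: trace_def gram_def)
  finally show ?thesis ..
qed

lemma second_moment_nonneg: "0 \<le> second_moment"
  unfolding second_moment_def by (rule Bochner_Integration.integral_nonneg) simp

lemma energy_axis_sum: "(\<Sum>i\<in>UNIV. energy P (axis i 1)) = second_moment"
proof -
  have "(\<Sum>i\<in>UNIV. energy P (axis i 1)) = (\<integral>x. (\<Sum>i\<in>UNIV. (axis i 1 \<bullet> x)\<^sup>2) \<partial>P)"
    unfolding energy_def by (rule Bochner_Integration.integral_sum[symmetric]) (rule integrable_inner2)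
  also have "\<dots> = second_moment"
    unfolding second_moment_def norm2_eq_sum_axis ..
  finally show ?thesis .
qed

text \<open>Writing |x|^4 as the sum of <e_i, x>^2 |x|^2 and applying the mixed moment bound gives
  s_4^4 \<le> sqrt kappa s_4^2 Tr(G), and s_4^2 cancels. This turns the s_4^2 of the parameters into
  the Tr(G) of \<open>zeta_star\<close>.\<close>

lemma s4_le_second_moment: "(s4 P)\<^sup>2 \<le> sqrt (kappa P) * second_moment"
proof -
  have "((s4 P)\<^sup>2)\<^sup>2 = s4 P ^ 4" by (simp flip: power_mult)
  also have "\<dots> = (\<integral>x. (\<Sum>i\<in>UNIV. (axis i 1 \<bullet> x)\<^sup>2 * (norm x)\<^sup>2) \<partial>P)"
  proof -
    have "norm x ^ 4 = (\<Sum>i\<in>UNIV. (axis i 1 \<bullet> x)\<^sup>2 * (norm x)\<^sup>2)" for x :: "real ^ 'd"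
    proof -
      have "norm x ^ 4 = (norm x)\<^sup>2 * (norm x)\<^sup>2" by (simp flip: power_add)
      also have "\<dots> = (\<Sum>i\<in>UNIV. (axis i 1 \<bullet> x)\<^sup>2) * (norm x)\<^sup>2" by (simp only: norm2_eq_sum_axis)
      finally show ?thesis by (simp only: sum_distrib_right)
    qed
    then show ?thesis by (simp add: s4_power4)
  qed
  also have "\<dots> = (\<Sum>i\<in>UNIV. \<integral>x. (axis i 1 \<bullet> x)\<^sup>2 * (norm x)\<^sup>2 \<partial>P)"
    by (rule Bochner_Integration.integral_sum) (rule integrable_inner2_norm2)
  also have "\<dots> \<le> (\<Sum>i\<in>UNIV. sqrt (kappa P) * (s4 P)\<^sup>2 * energy P (axis i 1))"
    by (intro sum_mono mixed_moment_le)
  also have "\<dots> = sqrt (kappa P) * (s4 P)\<^sup>2 * second_moment"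
    by (simp add: energy_axis_sum flip: sum_distrib_left)
  finally have le: "(s4 P)\<^sup>2 * (s4 P)\<^sup>2 \<le> (s4 P)\<^sup>2 * (sqrt (kappa P) * second_moment)"
    by (simp add: power2_eq_square mult_ac)
  show ?thesis
  proof (cases "s4 P = 0")
    case True
    then show ?thesis using second_moment_nonneg kappa_pos by simp
  next
    case False
    then show ?thesis using le by (subst (asm) mult_le_cancel_left_pos) auto
  qed
qed

lemma second_moment_le_s4: "second_moment \<le> (s4 P)\<^sup>2"
proof (rule power2_le_imp_le)
  have "second_moment\<^sup>2 = (\<integral>x. 1 * (norm x)\<^sup>2 \<partial>P)\<^sup>2" by (simp add: second_moment_def)
  also have "\<dots> \<le> (\<integral>x. 1\<^sup>2 \<partial>P) * (\<integral>x. ((norm x)\<^sup>2)\<^sup>2 \<partial>P)"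
    using int4 integrable_norm2 by (intro integral_Cauchy_Schwarz) (simp_all flip: power_mult)
  also have "\<dots> = ((s4 P)\<^sup>2)\<^sup>2" using prob_space by (simp add: s4_power4 flip: power_mult)
  finally show "second_moment\<^sup>2 \<le> ((s4 P)\<^sup>2)\<^sup>2" .
qed simp

lemma energy_le_s4: "norm \<theta> = 1 \<Longrightarrow> energy P \<theta> \<le> (s4 P)\<^sup>2"
proof -
  assume "norm \<theta> = 1"
  then have "energy P \<theta> \<le> second_moment"
    unfolding energy_def second_moment_def using inner2_le[of \<theta>]
    by (intro integral_mono integrable_inner2 integrable_norm2) simp
  then show ?thesis using second_moment_le_s4 by linarith
qed

lemma quad_gram: "quad (gram P) \<theta> = energy P \<theta>"
proof -
  have int: "integrable P (\<lambda>x. x $ i * x $ j)" for i j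
  proof (rule Bochner_Integration.integrable_bound[OF integrable_norm2])
    show "AE x in P. norm (x $ i * x $ j) \<le> norm ((norm x)\<^sup>2)"
      using component_le_norm_cart
      by (intro AE_I2) (auto simp: abs_mult power2_eq_square intro!: mult_mono)
    have "continuous_on UNIV (\<lambda>x :: real ^ 'd. x $ i * x $ j)" by (intro continuous_intros)
    then show "(\<lambda>x. x $ i * x $ j) \<in> borel_measurable P"
      using borel_measurable_continuous_onI by (simp add: measurable_cong_sets[OF sets_P refl])
  qed
  have "energy P \<theta> = (\<integral>x. (\<Sum>i\<in>UNIV. \<Sum>j\<in>UNIV. \<theta> $ i * \<theta> $ j * (x $ i * x $ j)) \<partial>P)"
    unfolding energy_def power2_eq_square inner_vec_def
    by (simp add: sum_product mult_ac)
  also have "\<dots> = (\<Sum>i\<in>UNIV. \<Sum>j\<in>UNIV. \<theta> $ i * \<theta> $ j * gram P $ i $ j)"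
    using int by (simp add: gram_def)
  also have "\<dots> = quad (gram P) \<theta>"
    by (simp add: quad_def inner_vec_def matrix_vector_mult_def sum_distrib_left mult_ac)
  finally show ?thesis ..
qed

lemma transpose_gram: "transpose (gram P) = gram P"
  by (simp add: transpose_def gram_def vec_eq_iff mult.commute)

end

section \<open>The parameter grid\<close>

context kurtosis_law
begin

lemma zeta_star_antimono:
  assumes "0 < t" "t \<le> t'" "kappa P \<ge> 1"
  shows "zeta_star P n \<epsilon> t' \<le> zeta_star P n \<epsilon> t"
proof -
  have "second_moment * c / t' \<le> second_moment * c / t" if "0 \<le> c" for c
    using assms that second_moment_nonneg by (intro divide_left_mono) auto
  from this[of "0.73"] this[of "98.5 * kappa P"] show ?thesis
    unfolding zeta_star_def trace_gram using assms
    by (intro add_mono real_sqrt_le_mono mult_left_mono) (auto simp: mult_ac)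
qed

text \<open>With z = l (kappa - 3/2), all three parameters are combinations of z, l, B and R with
  nonnegative coefficients. The comparison \<xi> \<le> 3 \<gamma> is tight in l at kappa = 3/2,
  where both sides contain 3 l / 4.\<close>

lemma small_parameters:
  assumes "kappa P \<ge> 3 / 2" "0 < l" "0 < b" "0 \<le> ln (card (Lambda P n \<epsilon>) / \<epsilon>)"
  shows "0 \<le> xi P l" "0 \<le> mu P l b" "0 \<le> gam P n \<epsilon> l b"
    "mu P l b \<le> 2 * gam P n \<epsilon> l b" "xi P l \<le> 3 * gam P n \<epsilon> l b" "xi P l - mu P l b \<le> gam P n \<epsilon> l b"
proof -
  define B where "B = (2 + c_const) * sqrt (kappa P) * (s4 P)\<^sup>2 / b"
  define R where "R = (2 + 3 * c_const) * s4 P ^ 4 / (2 * b\<^sup>2 * l) + ln (card (Lambda P n \<epsilon>) / \<epsilon>) / (n * l)"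
  have B: "0 \<le> B" using assms c_const_lower by (simp add: B_def)
  have R: "0 \<le> R" using assms c_const_lower unfolding R_def by (intro add_nonneg_nonneg divide_nonneg_nonneg) auto
  define z where "z = l * (kappa P - 3 / 2)"
  have z: "0 \<le> z" using assms by (simp add: z_def)
  have e: "xi P l = z / 2 + 3 / 4 * l" "mu P l b = z + l / 2 + B" "gam P n \<epsilon> l b = z / 2 + l / 4 + B + R"
    by (simp_all add: z_def xi_def mu_def gam_def B_def R_def algebra_simps diff_divide_distrib)
  show "0 \<le> xi P l" "0 \<le> mu P l b" "0 \<le> gam P n \<epsilon> l b"
    "mu P l b \<le> 2 * gam P n \<epsilon> l b" "xi P l \<le> 3 * gam P n \<epsilon> l b" "xi P l - mu P l b \<le> gam P n \<epsilon> l b"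
    unfolding e distrib_left using B R z assms(2) by linarith+
qed

lemma finite_Lambda: "finite (Lambda P n \<epsilon>)"
  by (simp add: Lambda_def)

lemma card_Lambda:
  assumes "K_grid P n \<ge> 1"
  shows "1 \<le> card (Lambda P n \<epsilon>)" "card (Lambda P n \<epsilon>) \<le> K_grid P n"
proof -
  have "Lambda P n \<epsilon> \<noteq> {}" using assms by (simp add: Lambda_def)
  then show "1 \<le> card (Lambda P n \<epsilon>)" using finite_Lambda by (simp add: Suc_le_eq card_gt_0_iff)
  have "card (Lambda P n \<epsilon>) \<le> card {0..<K_grid P n}" unfolding Lambda_def by (rule card_image_le) simp
  then show "card (Lambda P n \<epsilon>) \<le> K_grid P n" using assms by simp
qed

lemma ln_card_Lambda:
  assumes "K_grid P n \<ge> 1" "0 < \<epsilon>" "\<epsilon> < 1"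
  shows "0 \<le> ln (card (Lambda P n \<epsilon>) / \<epsilon>)"
    "ln (card (Lambda P n \<epsilon>) / \<epsilon>) \<le> ln (K_grid P n / \<epsilon>)"
    "ln (K_grid P n / \<epsilon>) = ln (K_grid P n) + ln (inverse \<epsilon>)"
proof -
  note c = card_Lambda[OF assms(1), of \<epsilon>]
  have c': "1 \<le> real (card (Lambda P n \<epsilon>))" "real (card (Lambda P n \<epsilon>)) \<le> K_grid P n"
    using c by linarith+
  then have "1 \<le> card (Lambda P n \<epsilon>) / \<epsilon>" using assms by (simp add: le_divide_eq)
  then show "0 \<le> ln (card (Lambda P n \<epsilon>) / \<epsilon>)" by simp
  show "ln (card (Lambda P n \<epsilon>) / \<epsilon>) \<le> ln (K_grid P n / \<epsilon>)"
    using c' assms by (intro ln_mono divide_right_mono) auto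
  show "ln (K_grid P n / \<epsilon>) = ln (K_grid P n) + ln (inverse \<epsilon>)"
    using assms by (simp add: ln_div ln_inverse)
qed

lemma Lambda_pos:
  assumes "n \<ge> 1" "kappa P \<ge> 3 / 2" "K_grid P n \<ge> 1" "0 < \<epsilon>" "\<epsilon> < 1" "0 < s4 P" "(l, b) \<in> Lambda P n \<epsilon>"
  shows "0 < l" "0 < b"
proof -
  obtain j where j: "l = lambda_grid P n \<epsilon> j" "b = beta_grid P n j" using assms(7) by (auto simp: Lambda_def)
  have "0 \<le> ln (K_grid P n / \<epsilon>)" using ln_card_Lambda[OF assms(3-5)] by linarith
  moreover have "0 < (2 + 3 * c_const) / (4 * (2 + c_const) * sqrt (kappa P) * exp (- (of_int j * a_const)))"
    using c_const_lower assms by (intro divide_pos_pos mult_pos_pos) auto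
  ultimately show "0 < l" unfolding j lambda_grid_def using assms c_const_lower
    by (intro real_sqrt_gt_zero mult_pos_pos divide_pos_pos add_pos_nonneg) auto
  show "0 < b" unfolding j beta_grid_def using assms c_const_lower
    by (intro real_sqrt_gt_zero mult_pos_pos) auto
qed

text \<open>6304 = 64 * 98.5: the second root in \<open>zeta_star\<close> alone is at most sqrt n /
  8. This will place every threshold from \<sigma> on within reach of the grid.\<close>

lemma sigma_lower_bound:
  assumes "n \<ge> 1" "0 < \<sigma>" "kappa P \<ge> 3 / 2" "K_grid P n \<ge> 1" "0 < \<epsilon>" "\<epsilon> < 1"
    and "8 * zeta_star P n \<epsilon> \<sigma> \<le> sqrt n"
  shows "6304 * sqrt (kappa P) * (s4 P)\<^sup>2 \<le> n * \<sigma>"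
proof -
  have K: "0 \<le> ln (real_of_int (K_grid P n)) + ln (inverse \<epsilon>)"
    using ln_card_Lambda[OF assms(4-6)] by linarith
  have "0 \<le> 0.73 * second_moment / \<sigma>" using second_moment_nonneg assms by simp
  then have "0 \<le> sqrt (2.032 * (kappa P - 1) * (0.73 * second_moment / \<sigma> + ln (real_of_int (K_grid P n)) + ln (inverse \<epsilon>)))"
    using K assms by simp
  then have "sqrt (98.5 * kappa P * second_moment / \<sigma>) \<le> zeta_star P n \<epsilon> \<sigma>"
    unfolding zeta_star_def trace_gram by linarith
  then have "8 * sqrt (98.5 * kappa P * second_moment / \<sigma>) \<le> sqrt n" using assms(7) by linarith
  then have "sqrt (64 * (98.5 * kappa P * second_moment / \<sigma>)) \<le> sqrt n"
    by (simp only: real_sqrt_mult) simp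
  then have "64 * (98.5 * kappa P * second_moment / \<sigma>) \<le> n" by (simp only: real_sqrt_le_iff)
  then have *: "6304 * (kappa P * second_moment) \<le> n * \<sigma>" using assms by (simp add: field_simps)
  have "sqrt (kappa P) * (s4 P)\<^sup>2 \<le> sqrt (kappa P) * (sqrt (kappa P) * second_moment)"
    using kappa_pos by (intro mult_left_mono s4_le_second_moment) simp
  also have "\<dots> = kappa P * second_moment" using kappa_pos by (simp flip: mult.assoc)
  finally show ?thesis using * by simp
qed

text \<open>The width is at most l (kappa - 1)/2 + V / (n l) plus b / (2 n t) + b0 / b, two sums of
  the shape treated by \<open>sqrt_add_inverse_le\<close>. Their minimisers depend on t through
  s_4^2 / t, which a geometric grid of ratio exp (-1/2) follows up to rounding of the index.\<close>

lemma grid_bound: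
  assumes n: "n \<ge> 1" and kap: "kappa P \<ge> 3 / 2" and K: "K_grid P n \<ge> 1" and \<epsilon>: "0 < \<epsilon>" "\<epsilon> < 1"
    and \<sigma>: "0 < \<sigma>" "8 * zeta_star P n \<epsilon> \<sigma> \<le> sqrt n"
    and t: "\<sigma> \<le> t" "t \<le> (s4 P)\<^sup>2"
  obtains l b where "(l, b) \<in> Lambda P n \<epsilon>"
    "gam P n \<epsilon> l b + delta_param n l b * l / t \<le> zeta_star P n \<epsilon> t / sqrt n"
proof -
  define k s where "k = sqrt (kappa P)" and "s = (s4 P)\<^sup>2"
  define c where "c = c_const"
  have c: "40 \<le> c" "c \<le> 44.29" using c_const_lower c_const_upper by (auto simp: c_def)
  have k: "0 < k" "k\<^sup>2 = kappa P" using kap by (auto simp: k_def)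
  have t0: "0 < t" using \<sigma> t by simp
  have s: "0 < s" "t \<le> s" using t0 t by (auto simp: s_def)
  have s4pos: "0 < s4 P" using s s4_nonneg by (cases "s4 P = 0") (auto simp: s_def)
  have s2: "s4 P ^ 4 = s\<^sup>2" by (simp add: s_def flip: power_mult)
  have n0: "0 < real n" using n by simp
  define L where "L = ln (K_grid P n / \<epsilon>)"
  note lnL = ln_card_Lambda[OF K \<epsilon>, folded L_def]
  have L: "0 \<le> L" using lnL by linarith
  define X where "X = 1 / a_const * ln (n / (72 * (2 + c) * k))"
  have KX: "K_grid P n = 1 + \<lceil>X\<rceil>" by (simp add: K_grid_def X_def c_def k_def)
  \<comment> \<open>The real index at which exp (- v / 2) = t / s.\<close>
  define v where "v = 2 * ln (s / t)"
  have v0: "0 \<le> v" using s t0 by (simp add: v_def)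
  have "v + 1 / 2 \<le> X"
  proof -
    have "6304 * k * s \<le> n * \<sigma>"
      using sigma_lower_bound[OF n \<sigma>(1) kap K \<epsilon> \<sigma>(2)] by (simp add: k_def s_def)
    also have "\<dots> \<le> n * t" using t by (intro mult_left_mono) auto
    finally have le: "6304 * k * s \<le> n * t" .
    \<comment> \<open>exp (1/4) is the price of the half unit reserved for rounding the
      index.\<close>
    have "72 * (2 + c) * exp (1 / 4) \<le> 6304"
    proof -
      have "exp (1 / 4 :: real) \<le> 1.2841"
        by (rule order.trans[OF exp_le_taylor]) (simp_all add: power_divide)
      then have "(2 + c) * exp (1 / 4) \<le> (2 + 44.29) * 1.2841" using c by (intro mult_mono) auto
      also have "\<dots> \<le> 6304 / 72" by simp
      finally show ?thesis by (simp only: mult.assoc)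
    qed
    then have "72 * (2 + c) * exp (1 / 4) * (k * s) \<le> 6304 * (k * s)"
      using k s by (intro mult_right_mono) auto
    then have "s * exp (1 / 4) * (72 * (2 + c) * k) \<le> n * t" using le by (simp add: mult_ac)
    moreover have D: "0 < 72 * (2 + c) * k" using k c by simp
    ultimately have "s * exp (1 / 4) \<le> n * t / (72 * (2 + c) * k)" by (simp only: pos_le_divide_eq)
    then have "s * exp (1 / 4) / t \<le> n * t / (72 * (2 + c) * k) / t" using t0 by (intro divide_right_mono) auto
    then have "s / t * exp (1 / 4) \<le> n / (72 * (2 + c) * k)" using t0 by simp
    then have "ln (s / t * exp (1 / 4)) \<le> ln (n / (72 * (2 + c) * k))"
      using s t0 by (intro ln_mono) auto
    also have "ln (s / t * exp (1 / 4)) = v / 2 + 1 / 4"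
      using s t0 by (subst ln_mult) (auto simp: v_def)
    finally show ?thesis by (simp add: X_def a_const_def)
  qed
  with v0 obtain j where j: "0 \<le> j" "j \<le> \<lceil>X\<rceil>" "\<bar>v - j\<bar> \<le> 1 / 2" by (rule abs_round_index)
  define l b where "l = lambda_grid P n \<epsilon> j" and "b = beta_grid P n j"
  have mem: "(l, b) \<in> Lambda P n \<epsilon>" using j KX by (auto simp: Lambda_def l_def b_def)
  have lb: "0 < l" "0 < b" using Lambda_pos[OF n kap K \<epsilon> s4pos mem] by auto
  define p where "p = (v - j) / 2"
  have "v - j \<le> 1 / 2" "- (v - j) \<le> 1 / 2" using j(3) by (simp_all only: abs_le_iff)
  then have p: "- (1 / 4) \<le> p" "p \<le> 1 / 4" by (simp_all add: p_def)
  define E where "E = exp (- (of_int j * a_const))"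
  have E: "E = t / s * exp p"
  proof -
    have "exp (- (v / 2)) = t / s" using s t0 by (simp add: v_def exp_minus)
    moreover have "- (of_int j * a_const) = - (v / 2) + p" by (simp add: a_const_def p_def diff_divide_distrib)
    ultimately show ?thesis by (simp only: E_def exp_add)
  qed
  \<comment> \<open>This ratio increases with c towards 3/4; at c = 44.29 it is still below
    0.73.\<close>
  define a0 where "a0 = (2 + 3 * c) / (4 * (2 + c))"
  have a0: "0 < a0" "a0 \<le> 0.73" using c by (auto simp: a0_def divide_simps)
  define V0 where "V0 = a0 * s / (k * t)"
  define V where "V = V0 + L"
  define W where "W = a0 / (k * E) + L"
  have V0: "0 < V0" using a0 s k t0 by (simp add: V0_def)
  then have V: "0 < V" using L by (simp add: V_def)
  have a0E: "a0 / (k * E) = V0 * exp (- p)"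
    using s t0 k by (simp add: E V0_def exp_minus field_simps)
  have W: "exp (- (1 / 4)) * V \<le> W" "W \<le> exp (1 / 4) * V"
  proof -
    have "exp (- (1 / 4)) * V0 \<le> V0 * exp (- p)" "V0 * exp (- p) \<le> exp (1 / 4) * V0"
      using V0 p by (auto simp: mult.commute)
    moreover have "exp (- (1 / 4)) * L \<le> 1 * L" "1 * L \<le> exp (1 / 4) * L"
      using L by (intro mult_right_mono; simp)+
    ultimately show "exp (- (1 / 4)) * V \<le> W" "W \<le> exp (1 / 4) * V"
      unfolding V_def W_def a0E by (simp_all only: distrib_left)
  qed
  have l2: "l\<^sup>2 = 2 / (n * (kappa P - 1)) * W"
  proof -
    have "0 \<le> W" using W(1) V by (intro order.trans[OF _ W(1)]) simp
    then have "0 \<le> 2 / (n * (kappa P - 1)) * W" using kap by (intro mult_nonneg_nonneg) auto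
    moreover have "W = (2 + 3 * c_const) / (4 * (2 + c_const) * sqrt (kappa P) * exp (- (of_int j * a_const))) + ln (K_grid P n / \<epsilon>)"
      by (simp add: W_def a0_def L_def E_def k_def c_def)
    ultimately show ?thesis unfolding l_def lambda_grid_def by simp
  qed
  define b0 where "b0 = (2 + c) * k * s"
  have b0: "0 < b0" using c k s by (simp add: b0_def)
  \<comment> \<open>The half step in \<open>beta_grid\<close> shifts the rounding exponent p from
    [-1/4, 1/4] to p + 1/4 in [0, 1/2].\<close>
  have b2: "b\<^sup>2 = 2 * b0 * s * n * (E * exp (1 / 4))"
  proof -
    have "- ((real_of_int j - 1 / 2) * a_const) = - (of_int j * a_const) + 1 / 4"
      by (simp add: a_const_def field_simps)
    then have "exp (- ((real_of_int j - 1 / 2) * a_const)) = E * exp (1 / 4)"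
      by (simp only: E_def exp_add)
    then have "b\<^sup>2 = 2 * (2 + c) * k * s\<^sup>2 * n * (E * exp (1 / 4))"
      unfolding b_def beta_grid_def using c k by (simp add: E_def s2 c_def k_def)
    then show ?thesis by (simp add: b0_def power2_eq_square mult_ac)
  qed
  have lam_part: "l * ((kappa P - 1) / 2) + V / n / l \<le> sqrt (4.064 * ((kappa P - 1) / 2 * (V / n)))"
  proof (rule sqrt_add_inverse_le)
    show "l\<^sup>2 * ((kappa P - 1) / 2) = W / V * (V / n)"
      using kap V n0 by (simp add: l2 divide_simps)
    have r: "exp (- (1 / 4)) \<le> W / V" "W / V \<le> exp (1 / 4)"
      using W V by (auto simp: le_divide_eq divide_le_eq)
    then show "0 < W / V" using exp_gt_zero[of "- (1 / 4) :: real"] by linarith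
    have "exp (1 / 4) + exp (- (1 / 4)) \<le> (4.064 - 2 :: real)" using exp_quarter_sum by simp
    with add_inverse_le_exp[OF r] show "W / V + inverse (W / V) \<le> 4.064 - 2" by (rule order.trans)
  qed (use kap V n0 lb in auto)
  also have "\<dots> = sqrt (2.032 * (kappa P - 1) * V) / sqrt n"
    by (simp flip: real_sqrt_divide)
  also have "\<dots> \<le> sqrt (2.032 * (kappa P - 1) * (0.73 * second_moment / t + L)) / sqrt n"
  proof -
    have "V0 \<le> 0.73 * second_moment / t"
    proof -
      have "s / k \<le> second_moment" using s4_le_second_moment k by (simp add: s_def k_def pos_divide_le_eq mult.commute)
      then have "a0 * (s / k) \<le> 0.73 * second_moment" using a0 s k by (intro mult_mono) auto
      then have "a0 * (s / k) / t \<le> 0.73 * second_moment / t" using t0 by (intro divide_right_mono) auto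
      then show ?thesis by (simp add: V0_def)
    qed
    then show ?thesis unfolding V_def using kap
      by (intro divide_right_mono real_sqrt_le_mono mult_left_mono add_right_mono) auto
  qed
  finally have lam_part: "l * ((kappa P - 1) / 2) + V / n / l \<le> sqrt (2.032 * (kappa P - 1) * (0.73 * second_moment / t + L)) / sqrt n" .
  have "b * (1 / (2 * n * t)) + b0 / b \<le> sqrt (4.2553 * (1 / (2 * n * t) * b0))"
  proof (rule sqrt_add_inverse_le)
    define r where "r = exp (p + 1 / 4)"
    show "b\<^sup>2 * (1 / (2 * n * t)) = r * b0"
      unfolding b2 r_def exp_add E using n0 t0 s by (simp add: field_simps)
    show "0 < r" by (simp add: r_def)
    have "exp (- (1 / 2)) \<le> r" "r \<le> exp (1 / 2)" using p by (auto simp: r_def)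
    then have "r + inverse r \<le> exp (1 / 2) + exp (- (1 / 2))" by (rule add_inverse_le_exp)
    moreover have "exp (1 / 2) + exp (- (1 / 2)) \<le> (4.2553 - 2 :: real)" using exp_half_sum by simp
    ultimately show "r + inverse r \<le> 4.2553 - 2" by (rule order.trans)
  qed (use b0 n0 t0 lb in auto)
  also have "\<dots> \<le> sqrt (98.5 * kappa P * second_moment / t / n)"
  proof (rule real_sqrt_le_mono)
    have "b0 \<le> (2 + c) * k * (k * second_moment)"
      unfolding b0_def using c k s4_le_second_moment by (intro mult_left_mono) (auto simp: s_def k_def)
    also have "\<dots> = (2 + c) * (kappa P * second_moment)" by (simp add: k(2)[symmetric] power2_eq_square mult_ac)
    also have "\<dots> \<le> 46.29 * (kappa P * second_moment)"
      using c kap second_moment_nonneg by (intro mult_right_mono) auto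
    finally have "4.2553 / 2 * b0 \<le> 4.2553 / 2 * (46.29 * (kappa P * second_moment))" by (rule mult_left_mono) simp
    also have "\<dots> = 4.2553 / 2 * 46.29 * (kappa P * second_moment)" by (simp only: mult.assoc)
    also have "\<dots> \<le> 98.5 * (kappa P * second_moment)" using kap second_moment_nonneg by (intro mult_right_mono) auto
    finally have "4.2553 / 2 * b0 \<le> 98.5 * (kappa P * second_moment)" .
    then have "4.2553 / 2 * b0 / (t * n) \<le> 98.5 * (kappa P * second_moment) / (t * n)"
      using t0 n0 by (intro divide_right_mono) auto
    then show "4.2553 * (1 / (2 * n * t) * b0) \<le> 98.5 * kappa P * second_moment / t / n"
      by (simp add: mult_ac)
  qed
  also have "\<dots> = sqrt (98.5 * kappa P * second_moment / t) / sqrt n" by (simp only: real_sqrt_divide)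
  finally have b_part: "b * (1 / (2 * n * t)) + b0 / b \<le> sqrt (98.5 * kappa P * second_moment / t) / sqrt n" .
  \<comment> \<open>Because p + 1/4 \<ge> 0, the summand in 1 / (b^2 l) is at most V0 / (n l), the
    amount reserved for it in \<open>V\<close>.\<close>
  have rest: "(2 + 3 * c) * s\<^sup>2 / (2 * b\<^sup>2 * l) + ln (card (Lambda P n \<epsilon>) / \<epsilon>) / (n * l) \<le> V / n / l"
  proof -
    have "(2 + 3 * c) * s\<^sup>2 / (2 * b\<^sup>2) = V0 * exp (- (p + 1 / 4)) / n"
    proof -
      have "(2 + 3 * c) = 4 * (2 + c) * a0" using c by (simp add: a0_def)
      then have "(2 + 3 * c) * s\<^sup>2 / (2 * b\<^sup>2) = a0 / (k * E * exp (1 / 4) * n)"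
        unfolding b2 b0_def using c k s n0 t0 by (simp add: E power2_eq_square divide_simps)
      also have "k * E * exp (1 / 4) * n = k * (t / s) * exp (p + 1 / 4) * n"
        by (simp only: E exp_add mult.assoc)
      also have "a0 / (k * (t / s) * exp (p + 1 / 4) * n) = V0 * exp (- (p + 1 / 4)) / n"
      proof -
        have "a0 / (k * (t / s) * e * n) = a0 * s / (k * t) * inverse e / n" if "0 < e" for e
          using that s t0 k n0 by (simp add: field_simps)
        then show ?thesis by (simp only: V0_def exp_minus exp_gt_zero)
      qed
      finally show ?thesis .
    qed
    also have "\<dots> \<le> V0 / n" using p V0 n0 by (intro divide_right_mono) (auto simp: mult_left_le)
    finally have "(2 + 3 * c) * s\<^sup>2 / (2 * b\<^sup>2) + ln (card (Lambda P n \<epsilon>) / \<epsilon>) / n \<le> V0 / n + L / n"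
      using lnL(2) n0 by (intro add_mono divide_right_mono) auto
    then have "((2 + 3 * c) * s\<^sup>2 / (2 * b\<^sup>2) + ln (card (Lambda P n \<epsilon>) / \<epsilon>) / n) / l \<le> (V0 / n + L / n) / l"
      using lb by (intro divide_right_mono) auto
    then show ?thesis by (simp add: V_def add_divide_distrib)
  qed
  have "gam P n \<epsilon> l b + delta_param n l b * l / t
      = l * ((kappa P - 1) / 2) + ((2 + 3 * c) * s\<^sup>2 / (2 * b\<^sup>2 * l) + ln (card (Lambda P n \<epsilon>) / \<epsilon>) / (n * l))
        + (b * (1 / (2 * n * t)) + b0 / b)"
    unfolding gam_def delta_param_def using lb n0 t0
    by (simp add: s2 b0_def c_def[symmetric] k_def[symmetric] s_def[symmetric])
  also have "\<dots> \<le> sqrt (2.032 * (kappa P - 1) * (0.73 * second_moment / t + L)) / sqrt n + sqrt (98.5 * kappa P * second_moment / t) / sqrt n"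
    using lam_part b_part rest by linarith
  also have "\<dots> = zeta_star P n \<epsilon> t / sqrt n"
    by (simp add: zeta_star_def trace_gram lnL(3) add_divide_distrib add.assoc)
  finally show ?thesis using that mem by blast
qed

end

section \<open>Confidence region and covering argument\<close>

text \<open>With r = sqrt (t1 / t2), the difference (1 - 4 w1) - r (1 - 4 r w1) factors as (1 - r)
  (1 - 4 w1 (1 + r)), nonnegative for w1 \<le> 1/8. So t w / (1 - 4w) increases provided w decreases
  no faster than 1 / sqrt t.\<close>

lemma rescaled_error_mono:
  fixes t1 t2 w1 w2 :: real
  assumes t: "0 < t1" "t1 \<le> t2" and w: "0 < w1" "w1 \<le> 1 / 8" "w2 \<le> 1 / 8" "w1 * sqrt (t1 / t2) \<le> w2"
  shows "t1 * (w1 / (1 - 4 * w1)) \<le> t2 * (w2 / (1 - 4 * w2))"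
proof -
  define r where "r = sqrt (t1 / t2)"
  have r: "0 < r" "r \<le> 1" "r\<^sup>2 = t1 / t2" using t by (auto simp: r_def)
  have rw: "r * w1 \<le> w1" "0 < r * w1" using r w by (auto simp: mult_left_le_one_le)
  have "4 * w1 * (1 + r) \<le> 4 * (1 / 8) * (1 + 1)" using r w by (intro mult_mono) auto
  then have "4 * w1 * (1 + r) * (1 - r) \<le> 1 * (1 - r)" using r by (intro mult_right_mono) auto
  then have key: "r * (1 - 4 * (r * w1)) \<le> 1 - 4 * w1" by (simp add: algebra_simps)
  have "r * w1 \<le> 1 / 8" using rw(1) w(2) by (rule order.trans)
  then have pos: "0 < 1 - 4 * (r * w1)" "0 < 1 - 4 * w1" "0 < 1 - 4 * w2" using w by auto
  have "w1 / (1 - 4 * w1) \<le> w1 / (r * (1 - 4 * (r * w1)))"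
    using key pos r w by (intro divide_left_mono mult_pos_pos) auto
  then have "t1 * (w1 / (1 - 4 * w1)) \<le> t1 * (w1 / (r * (1 - 4 * (r * w1))))"
    using t by (intro mult_left_mono) auto
  also have "\<dots> = t1 / r\<^sup>2 * (r * w1 / (1 - 4 * (r * w1)))"
    using r(1) by (simp add: power2_eq_square)
  also have "t1 / r\<^sup>2 = t2" using t by (simp add: r)
  also have "t2 * (r * w1 / (1 - 4 * (r * w1))) \<le> t2 * (w2 / (1 - 4 * w2))"
    using pos w rw t by (intro mult_left_mono frac_le) (auto simp: r_def mult.commute)
  finally show ?thesis .
qed

section \<open>Quadratic forms of symmetric matrices near the net\<close>

lemma trace_square_symmetric:
  fixes Q :: "real ^ 'd ^ 'd"
  assumes "transpose Q = Q"
  shows "trace (Q ** Q) = (\<Sum>i\<in>UNIV. (norm (Q $ i))\<^sup>2)"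
proof -
  have "trace (Q ** Q) = (\<Sum>i\<in>UNIV. \<Sum>k\<in>UNIV. Q $ i $ k * Q $ k $ i)"
    by (simp add: trace_def matrix_matrix_mult_def)
  also have "\<dots> = (\<Sum>i\<in>UNIV. \<Sum>k\<in>UNIV. Q $ i $ k * Q $ i $ k)"
    using assms by (intro sum.cong refl) (metis transpose_def vec_lambda_beta)
  also have "\<dots> = (\<Sum>i\<in>UNIV. (norm (Q $ i))\<^sup>2)"
    unfolding power2_norm_eq_inner by (simp add: inner_vec_def)
  finally show ?thesis .
qed

text \<open>For symmetric Q, Tr(Q^2) is the squared Frobenius norm, which dominates the squared
  operator norm.\<close>

lemma inner_matrix_vector_le:
  fixes Q :: "real ^ 'd ^ 'd"
  assumes "transpose Q = Q"
  shows "\<bar>x \<bullet> (Q *v y)\<bar> \<le> norm x * norm y * sqrt (trace (Q ** Q))"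
proof -
  note tr = trace_square_symmetric[OF assms]
  have "(norm (Q *v y))\<^sup>2 = (\<Sum>i\<in>UNIV. (Q $ i \<bullet> y)\<^sup>2)"
    unfolding power2_norm_eq_inner
    by (simp add: inner_vec_def matrix_vector_mult_def power2_eq_square)
  also have "\<dots> \<le> (\<Sum>i\<in>UNIV. (norm (Q $ i))\<^sup>2 * (norm y)\<^sup>2)"
    using power_mono[OF Cauchy_Schwarz_ineq2, of _ y 2]
    by (intro sum_mono) (simp add: power_mult_distrib)
  also have "\<dots> = (norm y * sqrt (trace (Q ** Q)))\<^sup>2"
    by (simp add: tr sum_nonneg power_mult_distrib mult.commute flip: sum_distrib_left)
  finally have "norm (Q *v y) \<le> norm y * sqrt (trace (Q ** Q))"
    by (rule power2_le_imp_le) (simp add: tr sum_nonneg)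
  then have "norm x * norm (Q *v y) \<le> norm x * (norm y * sqrt (trace (Q ** Q)))"
    by (rule mult_left_mono) simp
  then show ?thesis using Cauchy_Schwarz_ineq2[of x "Q *v y"] by (simp add: mult.assoc)
qed

text \<open>By symmetry of Q the difference is <\<theta> - \<xi>, Q (\<theta> + \<xi>)>, and
  |\<theta> + \<xi>| \<le> 2.\<close>

lemma quad_diff_le:
  fixes Q :: "real ^ 'd ^ 'd"
  assumes Q: "transpose Q = Q" and unit: "norm \<theta> = 1" "norm \<xi> = 1"
    and near: "norm (\<theta> - \<xi>) \<le> \<delta>" and tr: "trace (Q ** Q) \<le> T"
  shows "\<bar>quad Q \<theta> - quad Q \<xi>\<bar> \<le> 2 * \<delta> * sqrt T"
proof -
  have "\<theta> \<bullet> (Q *v \<xi>) = \<xi> \<bullet> (Q *v \<theta>)"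
    by (metis Q dot_lmul_matrix inner_commute transpose_matrix_vector)
  then have "quad Q \<theta> - quad Q \<xi> = (\<theta> - \<xi>) \<bullet> (Q *v (\<theta> + \<xi>))"
    by (simp add: quad_def matrix_vector_right_distrib inner_add_right inner_diff_left)
  then have "\<bar>quad Q \<theta> - quad Q \<xi>\<bar> \<le> norm (\<theta> - \<xi>) * norm (\<theta> + \<xi>) * sqrt (trace (Q ** Q))"
    using inner_matrix_vector_le[OF Q] by simp
  also have "\<dots> \<le> \<delta> * 2 * sqrt T"
    using near tr unit norm_triangle_ineq[of \<theta> \<xi>] order.trans[OF norm_ge_zero near]
    by (intro mult_mono) (auto simp: trace_square_symmetric[OF Q] sum_nonneg)
  finally show ?thesis by (simp add: mult_ac)
qed

section \<open>The confidence event\<close>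

context kurtosis_law
begin

text \<open>Substituting N = l (1 + t) and collecting powers of t, at confidence level \<epsilon> /
  |Lambda|, yields the formulas of \<open>xi\<close>, \<open>mu\<close>, \<open>gam\<close> and
  \<open>delta_param\<close>.\<close>

lemma pac_bound_eq:
  assumes "n \<ge> 1" "0 < l" "0 < b"
  shows "pac_bound 1 l b \<theta> + (b * (norm \<theta>)\<^sup>2 / 2 + ln (card (Lambda P n \<epsilon>) / \<epsilon>)) / n = r_upper P n \<epsilon> l b \<theta>"
    and "pac_bound (- 1) l b \<theta> + (b * (norm \<theta>)\<^sup>2 / 2 + ln (card (Lambda P n \<epsilon>) / \<epsilon>)) / n = - r_lower P n \<epsilon> l b \<theta>"
proof -
  define t where "t = energy P \<theta> / l - 1"
  have N: "energy P \<theta> = l * (1 + t)" using assms by (simp add: t_def)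
  define B0 R0 k where "B0 = (2 + c_const) * sqrt (kappa P) * (s4 P)\<^sup>2" and "R0 = (2 + 3 * c_const) * s4 P ^ 4"
    and "k = kappa P"
  define C where "C = ln (card (Lambda P n \<epsilon>) / \<epsilon>)"
  have n: "0 < real n" using assms by simp
  have pb: "pac_bound \<eta> l b \<theta> = \<eta> * (l * t) + l * (l * (k / 2) * t\<^sup>2 + l * (k - 1) * t + l / 2 * (k - 1))
      + l * (B0 / b * t + B0 / b) + R0 / (2 * b\<^sup>2)" for \<eta>
    unfolding pac_bound_def N B0_def[symmetric] R0_def[symmetric] unfolding k_def[symmetric]
    by (simp add: power2_eq_square algebra_simps add_divide_distrib diff_divide_distrib)
  have g: "l * gam P n \<epsilon> l b = l * (l / 2 * (k - 1)) + l * (B0 / b) + R0 / (2 * b\<^sup>2) + C / n"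
    unfolding gam_def B0_def[symmetric] R0_def[symmetric] C_def[symmetric] unfolding k_def[symmetric]
    using assms(2) by (simp add: distrib_left mult.commute)
  have d: "l * (delta_param n l b * (norm \<theta>)\<^sup>2) = b * (norm \<theta>)\<^sup>2 / 2 / n"
    unfolding delta_param_def using assms(2) n by simp
  have m: "mu P l b = l * (k - 1) + B0 / b" and x: "xi P l = l * (k / 2)"
    by (simp_all add: mu_def xi_def B0_def k_def)
  show "pac_bound 1 l b \<theta> + (b * (norm \<theta>)\<^sup>2 / 2 + ln (card (Lambda P n \<epsilon>) / \<epsilon>)) / n = r_upper P n \<epsilon> l b \<theta>"
    unfolding r_upper_def Let_def t_def[symmetric] C_def[symmetric]
    by (simp only: distrib_left g d m x pb add_divide_distrib) (simp add: algebra_simps)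
  show "pac_bound (- 1) l b \<theta> + (b * (norm \<theta>)\<^sup>2 / 2 + ln (card (Lambda P n \<epsilon>) / \<epsilon>)) / n = - r_lower P n \<epsilon> l b \<theta>"
    unfolding r_lower_def Let_def t_def[symmetric] C_def[symmetric] mult_minus_left minus_minus
    by (simp only: distrib_left right_diff_distrib g d m x pb add_divide_distrib) (simp add: algebra_simps)
qed

text \<open>\<open>pac_bayes\<close> is used once for each grid point and each sign, at level
  \<epsilon> / |Lambda|; the 2 |Lambda| exceptional sets have total measure at most 2
  \<epsilon>.\<close>

lemma confidence_event:
  fixes M :: "'a measure" and X :: "nat \<Rightarrow> 'a \<Rightarrow> real ^ 'd"
  assumes M: "prob_space M"
    and indep: "prob_space.indep_vars M (\<lambda>_. borel) X {1..n}"
    and law: "\<And>i. i \<in> {1..n} \<Longrightarrow> distr M borel (X i) = P"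
    and n: "n \<ge> 1" and kap: "kappa P \<ge> 3 / 2" and K: "K_grid P n \<ge> 1" and \<epsilon>: "0 < \<epsilon>" "\<epsilon> < 1" and s4: "0 < s4 P"
  shows "\<exists>A\<in>sets M. 1 - 2 * \<epsilon> \<le> measure M A \<and> (\<forall>\<omega>\<in>A. \<forall>(l, b)\<in>Lambda P n \<epsilon>. \<forall>\<theta>.
    r_crit n (\<lambda>i\<in>{1..n}. X i \<omega>) l \<theta> \<le> r_upper P n \<epsilon> l b \<theta>
    \<and> r_lower P n \<epsilon> l b \<theta> \<le> r_crit n (\<lambda>i\<in>{1..n}. X i \<omega>) l \<theta>)"
proof -
  interpret M: prob_space M by (rule M)
  define m where "m = card (Lambda P n \<epsilon>)"
  have m: "1 \<le> m" using card_Lambda(1)[OF K] by (simp add: m_def)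
  define I where "I = Lambda P n \<epsilon> \<times> {1, - 1 :: real}"
  have fin: "finite I" using finite_Lambda by (simp add: I_def)
  have cardI: "card I = 2 * m" by (simp add: I_def m_def card_cartesian_product)
  have "\<exists>A\<in>sets M. measure M (space M - A) \<le> \<epsilon> / m \<and> (\<forall>\<omega>\<in>A. \<forall>\<theta>.
    (\<Sum>i=1..n. psi (snd z * ((\<theta> \<bullet> X i \<omega>)\<^sup>2 - fst (fst z))))
      \<le> n * pac_bound (snd z) (fst (fst z)) (snd (fst z)) \<theta> + snd (fst z) * (norm \<theta>)\<^sup>2 / 2 + ln (1 / (\<epsilon> / m)))"
    if z: "z \<in> I" for z
  proof (rule pac_bayes[OF M indep law])
    show "(snd z)\<^sup>2 = 1" using z by (auto simp: I_def)
    show "0 < snd (fst z)" using z Lambda_pos(2)[OF n kap K \<epsilon> s4, of "fst (fst z)"] by (auto simp: I_def)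
    show "0 < \<epsilon> / m" using m \<epsilon> by simp
  qed
  then obtain A where A: "\<And>z. z \<in> I \<Longrightarrow> A z \<in> sets M" "\<And>z. z \<in> I \<Longrightarrow> measure M (space M - A z) \<le> \<epsilon> / m"
    and bound: "\<And>z \<omega> \<theta>. z \<in> I \<Longrightarrow> \<omega> \<in> A z \<Longrightarrow>
      (\<Sum>i=1..n. psi (snd z * ((\<theta> \<bullet> X i \<omega>)\<^sup>2 - fst (fst z))))
      \<le> n * pac_bound (snd z) (fst (fst z)) (snd (fst z)) \<theta> + snd (fst z) * (norm \<theta>)\<^sup>2 / 2 + ln (1 / (\<epsilon> / m))"
    by metis
  define U where "U = (\<Union>z\<in>I. space M - A z)"
  have U: "U \<in> sets M" unfolding U_def by (intro sets.finite_UN fin sets.Diff sets.top A(1))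
  have "measure M U \<le> (\<Sum>z\<in>I. measure M (space M - A z))"
    unfolding U_def using A(1) by (intro M.finite_measure_subadditive_finite fin) auto
  also have "\<dots> \<le> (\<Sum>z\<in>I. \<epsilon> / m)" by (intro sum_mono A(2))
  also have "\<dots> = 2 * \<epsilon>" using m by (simp add: cardI)
  finally have PU: "measure M U \<le> 2 * \<epsilon>" .
  show ?thesis
  proof (intro bexI[of _ "space M - U"] conjI ballI)
    show "1 - 2 * \<epsilon> \<le> measure M (space M - U)" using PU U by (simp add: M.prob_compl)
    show "space M - U \<in> sets M" using U by simp
    fix \<omega> z assume \<omega>: "\<omega> \<in> space M - U" and z: "z \<in> Lambda P n \<epsilon>"
    obtain l b where lb: "z = (l, b)" by (cases z)
    have pos: "0 < l" "0 < b" using Lambda_pos[OF n kap K \<epsilon> s4] z lb by auto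
    have n0: "0 < real n" using n by simp
    have r: "r_crit n (\<lambda>i\<in>{1..n}. X i \<omega>) l \<theta> = (\<Sum>i=1..n. psi ((\<theta> \<bullet> X i \<omega>)\<^sup>2 - l)) / n" for \<theta>
      by (simp add: r_crit_def)
    have C: "ln (1 / (\<epsilon> / m)) = ln (m / \<epsilon>)" by simp
    have up: "r_crit n (\<lambda>i\<in>{1..n}. X i \<omega>) l \<theta> \<le> r_upper P n \<epsilon> l b \<theta>" for \<theta>
    proof -
      have "((l, b), 1) \<in> I" "\<omega> \<in> A ((l, b), 1)" using z lb \<omega> by (auto simp: I_def U_def)
      from bound[OF this, of \<theta>]
      have "(\<Sum>i=1..n. psi ((\<theta> \<bullet> X i \<omega>)\<^sup>2 - l)) \<le> n * pac_bound 1 l b \<theta> + (b * (norm \<theta>)\<^sup>2 / 2 + ln (m / \<epsilon>))"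
        by (simp add: add.assoc)
      then have "(\<Sum>i=1..n. psi ((\<theta> \<bullet> X i \<omega>)\<^sup>2 - l)) / n \<le> (n * pac_bound 1 l b \<theta> + (b * (norm \<theta>)\<^sup>2 / 2 + ln (m / \<epsilon>))) / n"
        by (rule divide_right_mono) simp
      also have "\<dots> = r_upper P n \<epsilon> l b \<theta>"
        unfolding pac_bound_eq(1)[OF n pos, symmetric] m_def using n0 by (simp add: add_divide_distrib)
      finally show ?thesis unfolding r .
    qed
    have lo: "r_lower P n \<epsilon> l b \<theta> \<le> r_crit n (\<lambda>i\<in>{1..n}. X i \<omega>) l \<theta>" for \<theta>
    proof -
      have "((l, b), - 1) \<in> I" "\<omega> \<in> A ((l, b), - 1)" using z lb \<omega> by (auto simp: I_def U_def)
      note b = bound[OF this, of \<theta>]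
      \<comment> \<open>Oddness of \<psi> turns the upper bound for the sign -1 into a lower bound
        on the criterion.\<close>
      have "(\<Sum>i=1..n. psi (- 1 * ((\<theta> \<bullet> X i \<omega>)\<^sup>2 - l))) = - (\<Sum>i=1..n. psi ((\<theta> \<bullet> X i \<omega>)\<^sup>2 - l))"
        by (simp only: mult_minus1 psi_minus sum_negf)
      with b have "- (\<Sum>i=1..n. psi ((\<theta> \<bullet> X i \<omega>)\<^sup>2 - l)) \<le> n * pac_bound (- 1) l b \<theta> + (b * (norm \<theta>)\<^sup>2 / 2 + ln (m / \<epsilon>))"
        by (simp only: fst_conv snd_conv C add.assoc)
      then have "- (\<Sum>i=1..n. psi ((\<theta> \<bullet> X i \<omega>)\<^sup>2 - l)) / n \<le> (n * pac_bound (- 1) l b \<theta> + (b * (norm \<theta>)\<^sup>2 / 2 + ln (m / \<epsilon>))) / n"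
        by (rule divide_right_mono) simp
      also have "\<dots> = - r_lower P n \<epsilon> l b \<theta>"
        unfolding pac_bound_eq(2)[OF n pos, symmetric] m_def using n0 by (simp add: add_divide_distrib)
      finally show ?thesis unfolding r by simp
    qed
    show "case z of (l, b) \<Rightarrow> \<forall>\<theta>. r_crit n (\<lambda>i\<in>{1..n}. X i \<omega>) l \<theta> \<le> r_upper P n \<epsilon> l b \<theta>
        \<and> r_lower P n \<epsilon> l b \<theta> \<le> r_crit n (\<lambda>i\<in>{1..n}. X i \<omega>) l \<theta>"
      using up lo lb by simp
  qed
qed

end

section \<open>The relative error as a function of the energy\<close>

locale gram_setup = kurtosis_law P for P :: "(real ^ 'd) measure" +
  fixes n :: nat and \<epsilon> \<sigma> :: real
  assumes n: "n \<ge> 1" and kap: "kappa P \<ge> 3 / 2" and K: "K_grid P n \<ge> 1" and \<epsilon>: "0 < \<epsilon>" "\<epsilon> < 1"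
    and \<sigma>: "0 < \<sigma>" "\<sigma> \<le> (s4 P)\<^sup>2" and zeta: "8 * zeta_star P n \<epsilon> \<sigma> \<le> sqrt n"
begin

lemma s4_pos: "0 < s4 P"
  using \<sigma> s4_nonneg by (cases "s4 P = 0") auto

definition rel_width :: "real \<Rightarrow> real" where
  "rel_width t = zeta_star P n \<epsilon> t / sqrt n"

text \<open>For S \<ge> \<sigma> this is S times \<open>B_star\<close> at min S s_4^2. The cap
  reflects that the grid is tuned to energies up to s_4^2, the largest ones possible on the
  sphere.\<close>

definition error_bound :: "real \<Rightarrow> real" where
  "error_bound S = S * (rel_width (min S ((s4 P)\<^sup>2)) / (1 - 4 * rel_width (min S ((s4 P)\<^sup>2))))"

lemma second_moment_pos: "0 < second_moment"
proof -
  have "0 < (s4 P)\<^sup>2" using s4_pos by simp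
  then have "0 < sqrt (kappa P) * second_moment" using s4_le_second_moment by linarith
  then show ?thesis using kappa_pos by (simp add: zero_less_mult_iff)
qed

lemma rel_width_bounds: "\<sigma> \<le> t \<Longrightarrow> 0 < rel_width t" "\<sigma> \<le> t \<Longrightarrow> rel_width t \<le> 1 / 8"
proof -
  assume t: "\<sigma> \<le> t"
  have n0: "0 < sqrt n" using n by simp
  have K0: "0 \<le> ln (real_of_int (K_grid P n)) + ln (inverse \<epsilon>)" using ln_card_Lambda[OF K \<epsilon>] by linarith
  have t0: "0 < t" using \<sigma> t by simp
  have "0 \<le> 0.73 * second_moment / t" using second_moment_pos t0 by simp
  then have "0 \<le> sqrt (2.032 * (kappa P - 1) * (0.73 * second_moment / t + ln (real_of_int (K_grid P n)) + ln (inverse \<epsilon>)))"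
    using K0 kap by simp
  moreover have "0 < sqrt (98.5 * kappa P * second_moment / t)" using second_moment_pos kap t0 by simp
  ultimately have "0 < zeta_star P n \<epsilon> t" unfolding zeta_star_def trace_gram by (rule add_nonneg_pos)
  then show "0 < rel_width t" using n0 by (simp add: rel_width_def)
  have "8 * zeta_star P n \<epsilon> t \<le> 8 * zeta_star P n \<epsilon> \<sigma>"
    using zeta_star_antimono[of \<sigma> t] \<sigma> t kap by simp
  then show "rel_width t \<le> 1 / 8" using zeta n0 by (simp add: rel_width_def pos_divide_le_eq)
qed

lemma rel_width_antimono: "\<sigma> \<le> t \<Longrightarrow> t \<le> t' \<Longrightarrow> rel_width t' \<le> rel_width t"
  unfolding rel_width_def using zeta_star_antimono[of t t'] \<sigma> kap by (intro divide_right_mono) auto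

text \<open>Inside the roots, multiplication by t / t' carries Tr(G) / t exactly to Tr(G) / t' and
  can only shrink the logarithms. So sqrt t times the width is nondecreasing, the growth condition
  of \<open>rescaled_error_mono\<close>.\<close>

lemma rel_width_scale:
  assumes "\<sigma> \<le> t" "t \<le> t'"
  shows "rel_width t * sqrt (t / t') \<le> rel_width t'"
proof -
  define L where "L = ln (real_of_int (K_grid P n)) + ln (inverse \<epsilon>)"
  have L: "0 \<le> L" using ln_card_Lambda[OF K \<epsilon>] by (simp add: L_def)
  have t: "0 < t" "0 < t'" using assms \<sigma> by auto
  define u where "u = t / t'"
  have u: "0 \<le> u" "u \<le> 1" using t assms by (auto simp: u_def)
  have "u * (2.032 * (kappa P - 1) * (0.73 * second_moment / t + L)) \<le> 2.032 * (kappa P - 1) * (0.73 * second_moment / t' + L)"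
  proof -
    have "u * (0.73 * second_moment / t + L) \<le> 0.73 * second_moment / t' + L"
    proof -
      have "u * (0.73 * second_moment / t) = 0.73 * second_moment / t'" using t by (simp add: u_def)
      moreover have "u * L \<le> L" using L u by (simp add: mult_left_le_one_le)
      ultimately show ?thesis by (simp only: distrib_left add_left_mono)
    qed
    then have "2.032 * (kappa P - 1) * (u * (0.73 * second_moment / t + L)) \<le> 2.032 * (kappa P - 1) * (0.73 * second_moment / t' + L)"
      using kap by (intro mult_left_mono) auto
    then show ?thesis by (simp only: mult.left_commute)
  qed
  then have 1: "sqrt u * sqrt (2.032 * (kappa P - 1) * (0.73 * second_moment / t + L)) \<le> sqrt (2.032 * (kappa P - 1) * (0.73 * second_moment / t' + L))"
    by (simp only: real_sqrt_mult[symmetric] real_sqrt_le_iff)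
  have "u * (98.5 * kappa P * second_moment / t) = 98.5 * kappa P * second_moment / t'"
    using t by (simp add: u_def)
  then have 2: "sqrt u * sqrt (98.5 * kappa P * second_moment / t) = sqrt (98.5 * kappa P * second_moment / t')"
    by (simp only: real_sqrt_mult[symmetric])
  have "zeta_star P n \<epsilon> t * sqrt u \<le> zeta_star P n \<epsilon> t'"
    unfolding zeta_star_def trace_gram add.assoc L_def[symmetric] distrib_right
    using 1 2 by (simp only: mult.commute[of _ "sqrt u"])
  then have "zeta_star P n \<epsilon> t * sqrt u / sqrt n \<le> zeta_star P n \<epsilon> t' / sqrt n"
    by (rule divide_right_mono) simp
  then show ?thesis by (simp add: rel_width_def u_def)
qed

text \<open>Upwards, the width can only decrease, so the increase is at most (S' - S) w / (1 - 4w)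
  with w \<le> 1/8. Downwards, the bound is monotone: by rescaling up to s_4^2, and beyond it
  because the width is frozen.\<close>

lemma error_bound_mono_lipschitz:
  assumes "\<sigma> \<le> S" "\<sigma> \<le> S'"
  shows "error_bound S' \<le> error_bound S + \<bar>S' - S\<bar> / 4"
proof (cases "S \<le> S'")
  case True
  define t t' where "t = min S ((s4 P)\<^sup>2)" and "t' = min S' ((s4 P)\<^sup>2)"
  have t: "\<sigma> \<le> t" "t \<le> t'" using True assms \<sigma> by (auto simp: t_def t'_def)
  have w: "0 < rel_width t" "rel_width t \<le> 1 / 8" "0 < rel_width t'" "rel_width t' \<le> rel_width t"
    using rel_width_bounds t rel_width_antimono[OF t] by auto
  have "rel_width t' / (1 - 4 * rel_width t') \<le> rel_width t / (1 - 4 * rel_width t)" using w by (intro frac_le) auto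
  then have "error_bound S' \<le> S' * (rel_width t / (1 - 4 * rel_width t))"
    unfolding error_bound_def t'_def[symmetric] using assms \<sigma> by (intro mult_left_mono) auto
  also have "\<dots> = error_bound S + (S' - S) * (rel_width t / (1 - 4 * rel_width t))"
    unfolding error_bound_def t_def[symmetric] by (simp only: left_diff_distrib)
  also have "(S' - S) * (rel_width t / (1 - 4 * rel_width t)) \<le> (S' - S) * (1 / 4)"
    using w True by (intro mult_left_mono) (auto simp: divide_le_eq)
  finally show ?thesis using True by simp
next
  case False
  define t t' where "t = min S' ((s4 P)\<^sup>2)" and "t' = min S ((s4 P)\<^sup>2)"
  have t: "\<sigma> \<le> t" "t \<le> t'" using False assms \<sigma> by (auto simp: t_def t'_def)
  have w: "0 < rel_width t" "rel_width t \<le> 1 / 8" "0 < rel_width t'" "rel_width t' \<le> 1 / 8"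
    using rel_width_bounds t by auto
  have "error_bound S' \<le> error_bound S"
  proof (cases "S' \<le> (s4 P)\<^sup>2")
    case True
    then have "error_bound S' = t * (rel_width t / (1 - 4 * rel_width t))" by (simp add: error_bound_def t_def)
    also have "\<dots> \<le> t' * (rel_width t' / (1 - 4 * rel_width t'))"
      using t w \<sigma> rel_width_scale[OF t] by (intro rescaled_error_mono) auto
    also have "\<dots> \<le> S * (rel_width t' / (1 - 4 * rel_width t'))"
      using w by (intro mult_right_mono) (auto simp: t'_def)
    finally show ?thesis by (simp add: error_bound_def t'_def)
  next
    case big: False
    then have "t = t'" using False by (simp add: t_def t'_def)
    then show ?thesis unfolding error_bound_def t_def[symmetric] t'_def[symmetric] \<open>t = t'\<close>
      using False w by (intro mult_right_mono) auto
  qed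
  then show ?thesis by (simp add: add_increasing2)
qed

text \<open>kappa \<ge> 3/2 gives 6 + 1 / (kappa - 1) \<le> 8, so \<open>B_star\<close> takes its
  finite branch and the extended real bound becomes a real one.\<close>

lemma B_star_eq:
  "ereal (2 * max q \<sigma>) * B_star P n \<epsilon> \<sigma> (min q ((s4 P)\<^sup>2)) = ereal (2 * error_bound (max q \<sigma>))"
proof -
  define t where "t = max (min q ((s4 P)\<^sup>2)) \<sigma>"
  have t: "t = min (max q \<sigma>) ((s4 P)\<^sup>2)" "\<sigma> \<le> t" using \<sigma> by (auto simp: t_def)
  have w: "0 < rel_width t" "rel_width t \<le> 1 / 8" using rel_width_bounds t by auto
  have n0: "0 < sqrt n" using n by simp
  have z: "8 * zeta_star P n \<epsilon> t \<le> sqrt n" "0 < zeta_star P n \<epsilon> t"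
    using w n0 by (auto simp: rel_width_def pos_divide_le_eq zero_less_divide_iff)
  have "inverse (kappa P - 1) \<le> inverse (1 / 2)" using kap by (intro le_imp_inverse_le) auto
  then have "(6 + inverse (kappa P - 1)) * zeta_star P n \<epsilon> t \<le> 8 * zeta_star P n \<epsilon> t"
    using z by (intro mult_right_mono) auto
  then have "(6 + inverse (kappa P - 1)) * zeta_star P n \<epsilon> t \<le> sqrt n" using z by linarith
  then have "B_star P n \<epsilon> \<sigma> (min q ((s4 P)\<^sup>2)) = ereal (rel_width t / (1 - 4 * rel_width t))"
    by (simp add: B_star_def Let_def t_def[symmetric] rel_width_def)
  then show ?thesis by (simp add: error_bound_def t(1)[symmetric])
qed

text \<open>The grid point is chosen for the reference c clipped to [\<sigma>, s_4^2], and its width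
  carries over to S, which is no smaller. The assumptions are symmetric in q and c, so either the
  energy or the form of Q can serve as the reference.\<close>

lemma confidence_interval_diameter:
  assumes range: "\<And>l b. (l, b) \<in> Lambda P n \<epsilon> \<Longrightarrow> Phi_minus P n \<epsilon> l b (u l) \<le> q \<and> ereal q \<le> Phi_plus_inv P n \<epsilon> l b (u l)"
    "\<And>l b. (l, b) \<in> Lambda P n \<epsilon> \<Longrightarrow> Phi_minus P n \<epsilon> l b (u l) \<le> c \<and> ereal c \<le> Phi_plus_inv P n \<epsilon> l b (u l)"
  shows "\<bar>max q \<sigma> - max c \<sigma>\<bar> \<le> 2 * error_bound (max c \<sigma>)"
proof -
  define S where "S = max c \<sigma>"
  define t where "t = min S ((s4 P)\<^sup>2)"
  have t: "\<sigma> \<le> t" "t \<le> (s4 P)\<^sup>2" "t \<le> S" "0 < t" using \<sigma> by (auto simp: t_def S_def)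
  obtain l b where lb: "(l, b) \<in> Lambda P n \<epsilon>" "gam P n \<epsilon> l b + delta_param n l b * l / t \<le> rel_width t"
    using grid_bound[OF n kap K \<epsilon> \<sigma>(1) zeta t(1,2)] unfolding rel_width_def by blast
  have pos: "0 < l" "0 < b" using Lambda_pos[OF n kap K \<epsilon> s4_pos lb(1)] by auto
  note small = small_parameters[OF kap pos ln_card_Lambda(1)[OF K \<epsilon>]]
  have "0 \<le> delta_param n l b * l" using pos by (simp add: delta_param_def)
  then have "delta_param n l b * l / S \<le> delta_param n l b * l / t" using t by (intro divide_left_mono) auto
  then have wS: "gam P n \<epsilon> l b + delta_param n l b * l / S \<le> rel_width t" using lb by linarith
  have S0: "0 < S" using \<sigma> by (simp add: S_def)
  note width = confidence_interval_width[OF n pos small(1-3) small(4-6) rel_width_bounds[OF t(1)] wS S0, of "u l" q]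
  have shrS: "2 * error_bound S = 2 * S * (rel_width t / (1 - 4 * rel_width t))" by (simp add: error_bound_def t_def)
  have "0 \<le> 2 * error_bound S" unfolding shrS using rel_width_bounds[OF t(1)] S0 by simp
  have "q \<le> S + 2 * error_bound S"
    unfolding shrS using range[OF lb(1)] by (intro width(1)) (auto simp: S_def)
  then have 1: "max q \<sigma> \<le> S + 2 * error_bound S" using \<open>0 \<le> 2 * error_bound S\<close> by (simp add: S_def)
  have 2: "S - 2 * error_bound S \<le> max q \<sigma>"
  proof (cases "c \<ge> \<sigma>")
    case True
    then have "S - 2 * error_bound S \<le> q" unfolding shrS using range[OF lb(1)] by (intro width(2)) (auto simp: S_def)
    then show ?thesis by simp
  next
    case False
    then show ?thesis using \<open>0 \<le> 2 * error_bound S\<close> by (simp add: S_def)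
  qed
  show ?thesis using 1 2 unfolding S_def[symmetric] abs_le_iff by linarith
qed

section \<open>Deterministic consequences on the confidence event\<close>

context
  fixes x :: "nat \<Rightarrow> real ^ 'd"
  assumes event: "\<And>l b \<theta>. (l, b) \<in> Lambda P n \<epsilon> \<Longrightarrow>
    r_crit n x l \<theta> \<le> r_upper P n \<epsilon> l b \<theta> \<and> r_lower P n \<epsilon> l b \<theta> \<le> r_crit n x l \<theta>"
begin

lemma energy_in_range:
  assumes lb: "(l, b) \<in> Lambda P n \<epsilon>" and \<theta>: "norm \<theta> = 1"
  shows "Phi_minus P n \<epsilon> l b (N_tilde n x l \<theta>) \<le> energy P \<theta> \<and> ereal (energy P \<theta>) \<le> Phi_plus_inv P n \<epsilon> l b (N_tilde n x l \<theta>)"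
proof -
  have pos: "0 < l" "0 < b" using Lambda_pos[OF n kap K \<epsilon> s4_pos lb] by auto
  note small = small_parameters[OF kap pos ln_card_Lambda(1)[OF K \<epsilon>]]
  have "Phi_minus P n \<epsilon> l b (N_tilde n x l \<theta>) \<le> energy P \<theta>"
    using event[OF lb] by (intro Phi_minus_le_energy n pos small \<theta>) auto
  moreover have "Phi_plus P n \<epsilon> l b (energy P \<theta>) \<le> N_tilde n x l \<theta>"
    using event[OF lb] by (intro Phi_plus_energy_le n pos small \<theta>) auto
  then have "ereal (energy P \<theta>) \<le> Phi_plus_inv P n \<epsilon> l b (N_tilde n x l \<theta>)"
    unfolding Phi_plus_inv_def using energy_nonneg by (intro Sup_upper) auto
  ultimately show ?thesis by simp
qed

lemma gram_admissible:
  assumes "sphere_net \<delta> \<Theta>"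
  shows "admissible P n \<epsilon> \<Theta> x (gram P)"
proof -
  have ne: "Lambda P n \<epsilon> \<noteq> {}" using card_Lambda(1)[OF K, of \<epsilon>] by auto
  have "B_minus P n \<epsilon> x \<theta> \<le> energy P \<theta> \<and> ereal (energy P \<theta>) \<le> B_plus P n \<epsilon> x \<theta>" if "\<theta> \<in> \<Theta>" for \<theta>
  proof -
    have "norm \<theta> = 1" using that assms by (auto simp: sphere_net_def)
    note range = energy_in_range[OF _ this]
    show ?thesis unfolding B_minus_def B_plus_def using ne finite_Lambda range
      by (subst Max_le_iff, simp, simp, subst Min_ge_iff) auto
  qed
  then show ?thesis by (simp add: admissible_def transpose_gram quad_gram)
qed

text \<open>The comparison takes place at a net point within \<delta> of \<theta>. Let \<eta> be
  \<delta> times sqrt (Tr(G^2)). Moving the form of Q and the energy there costs 2 \<eta> each;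
  moving the reference inside \<open>error_bound\<close> costs a quarter of 2 \<eta>, doubled by the
  factor 2. The total is 5 \<eta>.\<close>

lemma admissible_bounds:
  assumes net: "sphere_net \<delta> \<Theta>" and Q: "admissible P n \<epsilon> \<Theta> x Q" and \<theta>: "norm \<theta> = 1"
  shows "\<bar>max (quad Q \<theta>) \<sigma> - max (energy P \<theta>) \<sigma>\<bar>
      \<le> 2 * error_bound (max (energy P \<theta>) \<sigma>) + 5 * \<delta> * sqrt (trace (gram P ** gram P))"
    and "\<bar>max (quad Q \<theta>) \<sigma> - max (energy P \<theta>) \<sigma>\<bar>
      \<le> 2 * error_bound (max (quad Q \<theta>) \<sigma>) + 5 * \<delta> * sqrt (trace (gram P ** gram P))"
proof -
  define \<eta> where "\<eta> = \<delta> * sqrt (trace (gram P ** gram P))"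
  have "\<theta> \<in> sphere 0 1" using \<theta> by simp
  then obtain \<xi> where \<xi>: "\<xi> \<in> \<Theta>" "norm (\<theta> - \<xi>) \<le> \<delta>" using net unfolding sphere_net_def by blast
  have \<xi>1: "norm \<xi> = 1" using \<xi> net by (auto simp: sphere_net_def)
  define q q' N N' where "q = quad Q \<theta>" and "q' = quad Q \<xi>" and "N = energy P \<theta>" and "N' = energy P \<xi>"
  have dq: "\<bar>q - q'\<bar> \<le> 2 * \<eta>"
    using quad_diff_le[OF _ \<theta> \<xi>1 \<xi>(2), of Q] Q by (simp add: admissible_def q_def q'_def \<eta>_def mult.assoc)
  have dN: "\<bar>N - N'\<bar> \<le> 2 * \<eta>"
    using quad_diff_le[OF transpose_gram \<theta> \<xi>1 \<xi>(2) order.refl]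
    by (simp add: quad_gram N_def N'_def \<eta>_def mult.assoc)
  have ne: "Lambda P n \<epsilon> \<noteq> {}" using card_Lambda(1)[OF K, of \<epsilon>] by auto
  have rq: "Phi_minus P n \<epsilon> l b (N_tilde n x l \<xi>) \<le> q' \<and> ereal q' \<le> Phi_plus_inv P n \<epsilon> l b (N_tilde n x l \<xi>)"
    if "(l, b) \<in> Lambda P n \<epsilon>" for l b
  proof -
    have "B_minus P n \<epsilon> x \<xi> \<le> q'" "ereal q' \<le> B_plus P n \<epsilon> x \<xi>"
      using Q \<xi> by (auto simp: admissible_def q'_def)
    moreover have "Phi_minus P n \<epsilon> l b (N_tilde n x l \<xi>) \<le> B_minus P n \<epsilon> x \<xi>"
      unfolding B_minus_def using finite_Lambda that by (intro Max_ge) (auto intro!: image_eqI[where x = "(l, b)"])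
    moreover have "B_plus P n \<epsilon> x \<xi> \<le> Phi_plus_inv P n \<epsilon> l b (N_tilde n x l \<xi>)"
      unfolding B_plus_def using finite_Lambda that by (intro Min_le) (auto intro!: image_eqI[where x = "(l, b)"])
    ultimately show ?thesis by (metis order.trans)
  qed
  have rN: "Phi_minus P n \<epsilon> l b (N_tilde n x l \<xi>) \<le> N' \<and> ereal N' \<le> Phi_plus_inv P n \<epsilon> l b (N_tilde n x l \<xi>)"
    if "(l, b) \<in> Lambda P n \<epsilon>" for l b
    unfolding N'_def using that \<xi>1 by (rule energy_in_range)
  define A A' B B' where "A = max q \<sigma>" and "A' = max q' \<sigma>" and "B = max N \<sigma>" and "B' = max N' \<sigma>"
  have lip: "\<bar>max y \<sigma> - max y' \<sigma>\<bar> \<le> \<bar>y - y'\<bar>" for y y' by (auto simp: max_def abs_if)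
  have dA: "\<bar>A - A'\<bar> \<le> 2 * \<eta>" unfolding A_def A'_def using lip dq by (rule order.trans)
  have dB: "\<bar>B - B'\<bar> \<le> 2 * \<eta>" unfolding B_def B'_def using lip dN by (rule order.trans)
  have ge: "\<sigma> \<le> A" "\<sigma> \<le> A'" "\<sigma> \<le> B" "\<sigma> \<le> B'" by (auto simp: A_def A'_def B_def B'_def)
  have "\<bar>A' - B'\<bar> \<le> 2 * error_bound B'"
    unfolding A'_def B'_def by (rule confidence_interval_diameter[OF rq rN])
  moreover have "error_bound B' \<le> error_bound B + \<eta> / 2"
    using error_bound_mono_lipschitz[OF ge(3,4)] dB by (simp add: abs_minus_commute)
  ultimately have 1: "\<bar>A' - B'\<bar> \<le> 2 * error_bound B + \<eta>" by simp
  have "\<bar>B' - A'\<bar> \<le> 2 * error_bound A'"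
    unfolding A'_def B'_def by (rule confidence_interval_diameter[OF rN rq])
  moreover have "error_bound A' \<le> error_bound A + \<eta> / 2"
    using error_bound_mono_lipschitz[OF ge(1,2)] dA by (simp add: abs_minus_commute)
  ultimately have 2: "\<bar>A' - B'\<bar> \<le> 2 * error_bound A + \<eta>" by (simp add: abs_minus_commute)
  have "\<bar>A - B\<bar> \<le> \<bar>A - A'\<bar> + \<bar>A' - B'\<bar> + \<bar>B - B'\<bar>" by (auto simp: abs_if)
  also have "\<dots> \<le> 2 * \<eta> + \<bar>A' - B'\<bar> + 2 * \<eta>" using dA dB by (intro add_mono) auto
  finally have tri: "\<bar>A - B\<bar> \<le> \<bar>A' - B'\<bar> + 4 * \<eta>" by simp
  have eta: "5 * \<delta> * sqrt (trace (gram P ** gram P)) = 5 * \<eta>" by (simp add: \<eta>_def)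
  show "\<bar>max (quad Q \<theta>) \<sigma> - max (energy P \<theta>) \<sigma>\<bar>
      \<le> 2 * error_bound (max (energy P \<theta>) \<sigma>) + 5 * \<delta> * sqrt (trace (gram P ** gram P))"
    using tri 1 unfolding eta q_def[symmetric] N_def[symmetric] A_def[symmetric] B_def[symmetric] by linarith
  show "\<bar>max (quad Q \<theta>) \<sigma> - max (energy P \<theta>) \<sigma>\<bar>
      \<le> 2 * error_bound (max (quad Q \<theta>) \<sigma>) + 5 * \<delta> * sqrt (trace (gram P ** gram P))"
    using tri 2 unfolding eta q_def[symmetric] N_def[symmetric] A_def[symmetric] B_def[symmetric] by linarith
qed

end

end

theorem proposition2p4:
  fixes M :: "'a measure"
    and P :: "(real ^ 'd) measure"
    and X :: "nat \<Rightarrow> 'a \<Rightarrow> real ^ 'd"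
    and n :: nat
    and \<epsilon> \<delta> \<sigma> :: real
    and \<Theta> :: "(real ^ 'd) set"
    and Q :: "(nat \<Rightarrow> real ^ 'd) \<Rightarrow> real ^ 'd ^ 'd"
  assumes "prob_space M"
    and "prob_space P" and "sets P = sets borel"
    and "n \<ge> 1"
    and "prob_space.indep_vars M (\<lambda>_. borel) X {1..n}"
    and "\<And>i. i \<in> {1..n} \<Longrightarrow> distr M borel (X i) = P"
    and "integrable P (\<lambda>x. norm x ^ 4)"
    and "bdd_above (kurtosis_ratios P)"
    and "kappa P \<ge> 3 / 2"
    and "K_grid P n \<ge> 1"
    and "0 < \<epsilon>" and "\<epsilon> < 1"
    and "\<delta> > 0"
    and "0 < \<sigma>" and "\<sigma> \<le> (s4 P)\<^sup>2"
    and "8 * zeta_star P n \<epsilon> \<sigma> \<le> sqrt (real n)"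
    and "finite \<Theta>" and "sphere_net \<delta> \<Theta>"
    and "\<And>\<omega>. \<omega> \<in> space M \<Longrightarrow>
           transpose (Q (\<lambda>i\<in>{1..n}. X i \<omega>)) = Q (\<lambda>i\<in>{1..n}. X i \<omega>)"
    and "\<And>\<omega>. \<omega> \<in> space M \<Longrightarrow>
           (\<exists>Q'. admissible P n \<epsilon> \<Theta> (\<lambda>i\<in>{1..n}. X i \<omega>) Q') \<Longrightarrow>
           admissible P n \<epsilon> \<Theta> (\<lambda>i\<in>{1..n}. X i \<omega>) (Q (\<lambda>i\<in>{1..n}. X i \<omega>))"
  shows "\<exists>A\<in>sets M. measure M A \<ge> 1 - 2 * \<epsilon> \<and>
    (\<forall>\<omega>\<in>A. \<forall>\<theta>\<in>sphere 0 1.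
       (let q = quad (Q (\<lambda>i\<in>{1..n}. X i \<omega>)) \<theta>; N = energy P \<theta> in
         ereal \<bar>max q \<sigma> - max N \<sigma>\<bar>
           \<le> ereal (2 * max N \<sigma>) * B_star P n \<epsilon> \<sigma> N
             + ereal (5 * \<delta> * sqrt (trace (gram P ** gram P)))
       \<and> ereal \<bar>max q \<sigma> - max N \<sigma>\<bar>
           \<le> ereal (2 * max q \<sigma>) * B_star P n \<epsilon> \<sigma> (min q ((s4 P)\<^sup>2))
             + ereal (5 * \<delta> * sqrt (trace (gram P ** gram P)))))"
proof -
  have kurt: "kurtosis_law P"
    using assms by (intro kurtosis_law.intro kurtosis_law_axioms.intro) auto
  interpret gram_setup P n \<epsilon> \<sigma>
    using kurt assms by (intro gram_setup.intro gram_setup_axioms.intro) auto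
  obtain A where A: "A \<in> sets M" "1 - 2 * \<epsilon> \<le> measure M A"
    and event: "\<And>\<omega> l b \<theta>. \<omega> \<in> A \<Longrightarrow> (l, b) \<in> Lambda P n \<epsilon> \<Longrightarrow>
      r_crit n (\<lambda>i\<in>{1..n}. X i \<omega>) l \<theta> \<le> r_upper P n \<epsilon> l b \<theta>
      \<and> r_lower P n \<epsilon> l b \<theta> \<le> r_crit n (\<lambda>i\<in>{1..n}. X i \<omega>) l \<theta>"
    using confidence_event[OF assms(1,5,6) n kap K \<epsilon> s4_pos] by fast
  have "let q = quad (Q (\<lambda>i\<in>{1..n}. X i \<omega>)) \<theta>; N = energy P \<theta> in
         ereal \<bar>max q \<sigma> - max N \<sigma>\<bar>
           \<le> ereal (2 * max N \<sigma>) * B_star P n \<epsilon> \<sigma> N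
             + ereal (5 * \<delta> * sqrt (trace (gram P ** gram P)))
       \<and> ereal \<bar>max q \<sigma> - max N \<sigma>\<bar>
           \<le> ereal (2 * max q \<sigma>) * B_star P n \<epsilon> \<sigma> (min q ((s4 P)\<^sup>2))
             + ereal (5 * \<delta> * sqrt (trace (gram P ** gram P)))"
    if \<omega>: "\<omega> \<in> A" and \<theta>: "\<theta> \<in> sphere 0 1" for \<omega> \<theta>
  proof -
    have \<theta>1: "norm \<theta> = 1" using \<theta> by simp
    have "\<omega> \<in> space M" using A(1) \<omega> sets.sets_into_space by blast
    moreover have "admissible P n \<epsilon> \<Theta> (\<lambda>i\<in>{1..n}. X i \<omega>) (gram P)"
      using event[OF \<omega>] assms(18) by (rule gram_admissible)
    ultimately have adm: "admissible P n \<epsilon> \<Theta> (\<lambda>i\<in>{1..n}. X i \<omega>) (Q (\<lambda>i\<in>{1..n}. X i \<omega>))"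
      using assms(20) by blast
    note bounds = admissible_bounds[OF event[OF \<omega>] assms(18) adm \<theta>1]
    \<comment> \<open>On the sphere the energy is at most s_4^2, so the first inequality can do
      without the cap that the second one carries.\<close>
    have "min (energy P \<theta>) ((s4 P)\<^sup>2) = energy P \<theta>"
      using energy_le_s4[OF \<theta>1] by simp
    then have "ereal (2 * max (energy P \<theta>) \<sigma>) * B_star P n \<epsilon> \<sigma> (energy P \<theta>) = ereal (2 * error_bound (max (energy P \<theta>) \<sigma>))"
      using B_star_eq[of "energy P \<theta>"] by simp
    then show ?thesis
      using bounds by (simp only: Let_def B_star_eq plus_ereal.simps ereal_less_eq)
  qed
  then show ?thesis using A by blast
qed

end
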